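(* Let $c:[t_0,\infty)\to P$, $t\mapsto c_t$, be the unique $C^1$ solution of the noncommutative Ricci flow $\frac{d}{dt}c_t=-\triangle\log c_t$ with a given initial value $c_{t_0}\in P$. Then the eigenvalues and normalized eigenvectors of the Laplace–Beltrami operators $\triangle_{c_t}:H_{c_t}\to H_{c_t}$ can be chosen as analytic functions of $t\in[t_0,\infty)$, and for each such analytic eigenvalue $\lambda_t$ with corresponding analytic eigenvector $a_t\in H_{c_t}$ normalized by $\langle a_t,a_t\rangle_{c_t}=1$, one has \[ \frac{d\lambda_t}{dt}=\lambda_t\,\tau\big(|a_t|^2\,\triangle\log c_t\big),\qquad |a_t|^2:=a_t^*a_t, \] for all $t\in[t_0,\infty)$ (at $t=t_0$ the derivative being the right-hand derivative).
   Context: Fix integers $n\ge 2$ and $m\in\{1,\dots,n-1\}$ with $\gcd(m,n)=1$, and put $q=e^{2\pi i m/n}$. Let $A=M_n$ be the algebra of complex $n\times n$ matrices with the conjugate-transpose involution $a\mapsto a^*$, unit $I$, and usual trace $\tau$. Let $u,v\in A$ be unitary matrices generating $A$ with $vu=quv$. Choose Hermitian matrices $x,y$ with $u=e^{2\pi i x/n}$ and $v=e^{2\pi i y/n}$, and define derivations $\delta_1=[y,\cdot\,]$, $\delta_2=-[x,\cdot\,]$ on $A$. The (flat) Laplacian is $\triangle=\delta_1^2+\delta_2^2$, i.e. $\triangle a=[y,[y,a]]+[x,[x,a]]$. Let $P=\{a\in A: a \text{ Hermitian with all eigenvalues strictly positive}\}$ (noncommutative metrics); for $a\in P$, $\log a$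 is defined via the spectral decomposition. For $c\in P$, $H_c$ denotes the vector space $A$ with inner product $\langle a,b\rangle_c=\tau(c\,a^*b)$. The Laplace–Beltrami operator for the metric $c$ is $\triangle_c:H_c\to H_c$, $\triangle_c a=(\triangle a)\,c^{-1}$ (product in $A$). It is known that the Ricci flow initial value problem has a unique $C^1$ solution in $P$ on $[t_0,\infty)$, and that it is analytic in $t$. *)

theory Defs
  imports "HOL-Analysis.Analysis"
begin

type_synonym 'n cmat = "complex^'n^'n"

definition madj :: "'n::finite cmat \<Rightarrow> 'n cmat" where
  "madj a = (\<chi> i j. cnj (a $ j $ i))"

definition hermitian :: "'n::finite cmat \<Rightarrow> bool" where
  "hermitian a \<longleftrightarrow> madj a = a"

definition unitary :: "'n::finite cmat \<Rightarrow> bool" where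
  "unitary a \<longleftrightarrow> madj a ** a = mat 1 \<and> a ** madj a = mat 1"

definition mtrace :: "'n::finite cmat \<Rightarrow> complex" where
  "mtrace a = (\<Sum>i\<in>UNIV. a $ i $ i)"

definition smul :: "complex \<Rightarrow> 'n::finite cmat \<Rightarrow> 'n cmat" where
  "smul z a = (\<chi> i j. z * a $ i $ j)"

definition diagm :: "('n::finite \<Rightarrow> complex) \<Rightarrow> 'n cmat" where
  "diagm d = (\<chi> i j. if i = j then d i else 0)"

definition hfun :: "(real \<Rightarrow> complex) \<Rightarrow> 'n::finite cmat \<Rightarrow> 'n cmat" where
  "hfun f a = (SOME b. \<exists>U d. unitary U \<and> a = U ** diagm (\<lambda>i. complex_of_real (d i)) ** madj U
                              \<and> b = U ** diagm (\<lambda>i. f (d i)) ** madj U)"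

definition mlog :: "'n::finite cmat \<Rightarrow> 'n cmat" where
  "mlog a = hfun (\<lambda>s. complex_of_real (ln s)) a"

definition is_eigenvalue :: "'n::finite cmat \<Rightarrow> complex \<Rightarrow> bool" where
  "is_eigenvalue a \<mu> \<longleftrightarrow> (\<exists>w. w \<noteq> 0 \<and> a *v w = \<mu> *s w)"

definition metrics :: "'n::finite cmat set" where
  "metrics = {a. hermitian a \<and> (\<forall>\<mu>. is_eigenvalue a \<mu> \<longrightarrow> (\<exists>r>0. \<mu> = complex_of_real r))}"

definition comm :: "'n::finite cmat \<Rightarrow> 'n cmat \<Rightarrow> 'n cmat" where
  "comm a b = a ** b - b ** a"

definition gen_alg :: "'n::finite cmat set \<Rightarrow> 'n cmat set" where
  "gen_alg S = \<Inter>{B. S \<subseteq> B \<and> mat 1 \<in> B \<and>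
      (\<forall>a\<in>B. \<forall>b\<in>B. a + b \<in> B \<and> a ** b \<in> B) \<and>
      (\<forall>z. \<forall>a\<in>B. smul z a \<in> B) \<and> (\<forall>a\<in>B. madj a \<in> B)}"

definition lap :: "'n::finite cmat \<Rightarrow> 'n cmat \<Rightarrow> 'n cmat \<Rightarrow> 'n cmat" where
  "lap x y a = comm y (comm y a) + comm x (comm x a)"

definition ipc :: "'n::finite cmat \<Rightarrow> 'n cmat \<Rightarrow> 'n cmat \<Rightarrow> complex" where
  "ipc c a b = mtrace (c ** madj a ** b)"

definition lapc :: "'n::finite cmat \<Rightarrow> 'n cmat \<Rightarrow> 'n cmat \<Rightarrow> 'n cmat \<Rightarrow> 'n cmat" where
  "lapc x y c a = lap x y a ** matrix_inv c"

definition real_analytic_on :: "real set \<Rightarrow> (real \<Rightarrow> 'a::real_normed_vector) \<Rightarrow> bool" where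
  "real_analytic_on S f \<longleftrightarrow> (\<forall>s\<in>S. \<exists>r>0. \<exists>co::nat \<Rightarrow> 'a.
      \<forall>t\<in>S. \<bar>t - s\<bar> < r \<longrightarrow> (\<lambda>k. ((t - s) ^ k) *\<^sub>R co k) sums f t)"

end

theory Submission
  imports Defs "HOL-Complex_Analysis.Complex_Singularities"
begin

text \<open>The flow is the ordinary differential equation of a vector field that is holomorphic near each
  positive matrix, because the logarithm is a power series in \<open>1 - c / K\<close>; complex Picard iteration
  shows that \<open>c\<close> is analytic. Right multiplication by \<open>c\<^sup>-\<^sup>1\<^sup>/\<^sup>2\<close> conjugates the Laplace-Beltrami
  operators into an analytic family of hermitian matrices, to which Rellich's theorem applies.

  Locally, Rellich's theorem follows by induction on the rank: the traceless part of the family is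
  \<open>(t - s)\<^sup>k W t\<close> with \<open>W s\<close> having eigenvalues of both signs, and the spectral projection of \<open>W\<close>
  is analytic. Globally, eigenvalues are continued along the half-line, one obtains a non-zero
  analytic eigenvector by multiplying with the factors \<open>A - g\<close> of the other eigenvalues \<open>g\<close>, and
  dividing it by an analytic branch of \<open>\<plusminus>norm\<close> makes it a unit vector, which is then split off.

  The derivative formula comes from differentiating \<open>\<lambda> = \<tau>(a\<^sup>* \<triangle>a)\<close> and the normalisation
  \<open>\<tau>(c a\<^sup>* a) = 1\<close>.\<close>

section \<open>Functions of a real variable that extend analytically at a point\<close>

text \<open>Eigenvalue curves may cross. Listing eigenvalues by size destroys analyticity there, and
  a spectral gap argument for a single eigenvalue breaks down at the crossing. What rescues
  analyticity is hermiticity at real parameters: it excludes the fractional powers that roots of a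
  characteristic polynomial can produce. Here it enters without polynomials: after division by the
  full power of \<open>t - s\<close> the traceless part is still hermitian at \<open>s\<close>, so
  it has a genuine gap there. Crossings are also the reason why eigenvalues are continued as members
  of a finite set of branches, with the identity theorem as the only means of telling branches
  apart. The time interval is closed at \<open>t0\<close>, so every notion is relative to
  \<open>{t0..}\<close>: a function is compared on the half-line with one that is holomorphic in a
  full complex disc. Complex times in turn dictate the form of the vector field of the flow: Picard
  iterates at non-real times are not hermitian, so the spectral definition of the logarithm says
  nothing about them, whereas a power series still makes sense.\<close>

abbreviation nhds_within :: "real \<Rightarrow> real set \<Rightarrow> real filter" where
  "nhds_within s J \<equiv> inf (nhds s) (principal J)"

lemma eventually_nhds_within:
  "eventually P (nhds_within s J) \<longleftrightarrow> (\<exists>r>0. \<forall>t\<in>J. \<bar>t - s\<bar> < r \<longrightarrow> P t)"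
  unfolding eventually_inf_principal eventually_nhds_metric dist_real_def by blast

lemma eventually_nhds_within_self: "eventually P (nhds_within s J) \<Longrightarrow> s \<in> J \<Longrightarrow> P s"
  unfolding eventually_nhds_within by force

lemma eventually_within_nhds_within:
  "eventually P (nhds_within s J) \<Longrightarrow> eventually P (at s within J)"
  unfolding eventually_inf_principal eventually_at_filter by (auto elim: eventually_mono)

text \<open>This filter keeps the point \<open>s\<close> that \<open>at s within J\<close> drops.
  Limits control the punctured part, and the value at \<open>s\<close> is then checked
  separately.\<close>

lemma eventually_nhds_within_iff:
  "eventually P (nhds_within s J) \<longleftrightarrow> eventually P (at s within J) \<and> (s \<in> J \<longrightarrow> P s)"
proof -
  have "eventually P (nhds_within s J)" if "eventually P (at s within J)" "s \<in> J \<longrightarrow> P s"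
    using that(1) unfolding eventually_inf_principal eventually_at_filter
    by eventually_elim (use that(2) in auto)
  then show ?thesis
    using eventually_within_nhds_within eventually_nhds_within_self by blast
qed

lemma eventually_eventually_nhds_within:
  assumes "eventually P (nhds_within s J)"
  shows "eventually (\<lambda>t. eventually P (nhds_within t J)) (nhds_within s J)"
  using assms unfolding eventually_inf_principal
  by (subst (asm) eventually_eventually[symmetric]) (auto elim: eventually_mono)

lemma eventually_nhds_within_in: "eventually (\<lambda>t. t \<in> J) (nhds_within s J)"
  by (simp add: eventually_inf_principal)

text \<open>Agreement is demanded on \<open>J\<close> only, while the extension lives on a complex
  disc around \<open>s\<close>. This covers the boundary point \<open>t0\<close> and gives access to
  orders of zeros, square roots and power series.\<close>

definition analytic_within :: "real set \<Rightarrow> real \<Rightarrow> (real \<Rightarrow> complex) \<Rightarrow> bool" where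
  "analytic_within J s f \<longleftrightarrow>
     (\<exists>g. g analytic_on {of_real s} \<and> eventually (\<lambda>t. f t = g (of_real t)) (nhds_within s J))"

lemma analytic_withinE:
  assumes "analytic_within J s f"
  obtains g r where "r > 0" "g holomorphic_on ball (of_real s) r"
    "\<And>t. t \<in> J \<Longrightarrow> \<bar>t - s\<bar> < r \<Longrightarrow> f t = g (of_real t)"
proof -
  obtain g r1 where "g analytic_on {of_real s}" "r1 > 0"
      and r1: "\<And>t. t \<in> J \<Longrightarrow> \<bar>t - s\<bar> < r1 \<Longrightarrow> f t = g (of_real t)"
    using assms unfolding analytic_within_def eventually_nhds_within by blast
  moreover obtain r2 where "r2 > 0" "g holomorphic_on ball (of_real s) r2"
    using \<open>g analytic_on _\<close> by (auto simp: analytic_at_ball)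
  ultimately show thesis
    by (intro that[of "min r1 r2" g])
      (auto intro: holomorphic_on_subset[where s = "ball (of_real s) r2"])
qed

lemma analytic_withinI:
  assumes "r > 0" "g holomorphic_on ball (of_real s) r"
    "\<And>t. t \<in> J \<Longrightarrow> \<bar>t - s\<bar> < r \<Longrightarrow> f t = g (of_real t)"
  shows "analytic_within J s f"
  unfolding analytic_within_def eventually_nhds_within analytic_at_ball using assms by blast

lemma analytic_within_cong:
  assumes "eventually (\<lambda>t. f t = g t) (nhds_within s J)" "analytic_within J s g"
  shows "analytic_within J s f"
proof -
  obtain h where "h analytic_on {of_real s}"
      and h: "eventually (\<lambda>t. g t = h (of_real t)) (nhds_within s J)"
    using assms(2) unfolding analytic_within_def by blast
  moreover have "eventually (\<lambda>t. f t = h (of_real t)) (nhds_within s J)"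
    using assms(1) h by eventually_elim simp
  ultimately show ?thesis unfolding analytic_within_def by blast
qed

lemma analytic_within_eventually:
  assumes "analytic_within J s f"
  shows "eventually (\<lambda>t. analytic_within J t f) (nhds_within s J)"
proof -
  obtain g r where r: "r > 0" "g holomorphic_on ball (of_real s) r"
    "\<And>t. t \<in> J \<Longrightarrow> \<bar>t - s\<bar> < r \<Longrightarrow> f t = g (of_real t)"
    using assms by (rule analytic_withinE) blast
  have "analytic_within J t f" if "\<bar>t - s\<bar> < r" for t
  proof (rule analytic_withinI[where r = "r - \<bar>t - s\<bar>" and g = g])
    have "ball (complex_of_real t) (r - \<bar>t - s\<bar>) \<subseteq> ball (of_real s) r"
      using that by (subst ball_subset_ball_iff)
        (auto simp: dist_norm abs_minus_commute simp flip: of_real_diff)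
    then show "g holomorphic_on ball (complex_of_real t) (r - \<bar>t - s\<bar>)"
      using r(2) holomorphic_on_subset by blast
  qed (use that r(3) in auto)
  then show ?thesis unfolding eventually_nhds_within using r(1) by blast
qed

lemma analytic_within_const [simp, intro]: "analytic_within J s (\<lambda>_. a)"
  unfolding analytic_within_def by (rule exI[of _ "\<lambda>_. a"]) auto

lemma analytic_within_of_real [simp, intro]: "analytic_within J s of_real"
  unfolding analytic_within_def by (rule exI[of _ "\<lambda>z. z"]) auto

lemma analytic_within_add [intro]:
  assumes "analytic_within J s f" "analytic_within J s g"
  shows "analytic_within J s (\<lambda>t. f t + g t)"
proof -
  obtain f' g' where a: "f' analytic_on {of_real s}" "g' analytic_on {of_real s}"
      and e: "eventually (\<lambda>t. f t = f' (of_real t)) (nhds_within s J)"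
         "eventually (\<lambda>t. g t = g' (of_real t)) (nhds_within s J)"
    using assms unfolding analytic_within_def by blast
  show ?thesis unfolding analytic_within_def
    by (rule exI[of _ "\<lambda>z. f' z + g' z"], intro conjI analytic_on_add a)
      (use e in eventually_elim, simp)
qed

lemma analytic_within_mult [intro]:
  assumes "analytic_within J s f" "analytic_within J s g"
  shows "analytic_within J s (\<lambda>t. f t * g t)"
proof -
  obtain f' g' where a: "f' analytic_on {of_real s}" "g' analytic_on {of_real s}"
      and e: "eventually (\<lambda>t. f t = f' (of_real t)) (nhds_within s J)"
         "eventually (\<lambda>t. g t = g' (of_real t)) (nhds_within s J)"
    using assms unfolding analytic_within_def by blast
  show ?thesis unfolding analytic_within_def
    by (rule exI[of _ "\<lambda>z. f' z * g' z"], intro conjI analytic_on_mult a)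
      (use e in eventually_elim, simp)
qed

lemma analytic_within_minus [intro]:
  "analytic_within J s f \<Longrightarrow> analytic_within J s (\<lambda>t. - f t)"
  using analytic_within_mult[of J s "\<lambda>_. -1" f] by simp

lemma analytic_within_diff [intro]:
  "analytic_within J s f \<Longrightarrow> analytic_within J s g \<Longrightarrow> analytic_within J s (\<lambda>t. f t - g t)"
  using analytic_within_add[of J s f "\<lambda>t. - g t"] by auto

lemma analytic_within_sum [intro]:
  "(\<And>i. i \<in> I \<Longrightarrow> analytic_within J s (f i)) \<Longrightarrow> analytic_within J s (\<lambda>t. \<Sum>i\<in>I. f i t)"
  by (induction I rule: infinite_finite_induct) auto

lemma analytic_within_power [intro]:
  "analytic_within J s f \<Longrightarrow> analytic_within J s (\<lambda>t. f t ^ n)"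
  by (induction n) auto

text \<open>Conjugation is not holomorphic, but at real \<open>t\<close> the values agree with those
  of the Schwarz reflection \<open>cnj \<circ> g \<circ> cnj\<close>, which is.\<close>

lemma analytic_within_cnj [intro]:
  assumes "analytic_within J s f"
  shows "analytic_within J s (\<lambda>t. cnj (f t))"
proof -
  obtain g r where r: "r > 0" "g holomorphic_on ball (of_real s) r"
    "\<And>t. t \<in> J \<Longrightarrow> \<bar>t - s\<bar> < r \<Longrightarrow> f t = g (of_real t)"
    using assms by (rule analytic_withinE) blast
  have cnj_ball: "cnj z \<in> ball (complex_of_real s) r \<longleftrightarrow> z \<in> ball (complex_of_real s) r" for z
    unfolding mem_ball dist_norm
    by (metis complex_cnj_complex_of_real complex_cnj_diff complex_mod_cnj)
  have eq: "cnj ` ball (complex_of_real s) r = ball (of_real s) r"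
  proof (intro equalityI subsetI)
    fix z assume "z \<in> ball (complex_of_real s) r"
    then have "cnj z \<in> ball (complex_of_real s) r" by (simp only: cnj_ball)
    then show "z \<in> cnj ` ball (complex_of_real s) r" by (metis complex_cnj_cnj imageI)
  qed (use cnj_ball in blast)
  have "(cnj \<circ> g \<circ> cnj) holomorphic_on ball (of_real s) r"
    by (rule holomorphic_on_compose_cnj_cnj) (simp_all add: eq r)
  then show ?thesis
    by (rule analytic_withinI[OF r(1)]) (simp add: r(3))
qed

lemma analytic_within_inverse [intro]:
  assumes "analytic_within J s f" "f s \<noteq> 0" "s \<in> J"
  shows "analytic_within J s (\<lambda>t. inverse (f t))"
proof -
  obtain f' where a: "f' analytic_on {of_real s}"
      and e: "eventually (\<lambda>t. f t = f' (of_real t)) (nhds_within s J)"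
    using assms unfolding analytic_within_def by blast
  have "f' (of_real s) \<noteq> 0"
    using eventually_nhds_within_self[OF e] assms by auto
  then show ?thesis unfolding analytic_within_def
    by (intro exI[of _ "\<lambda>z. inverse (f' z)"] conjI analytic_on_inverse a)
      (auto intro: eventually_mono[OF e])
qed

lemma analytic_within_divide [intro]:
  "analytic_within J s f \<Longrightarrow> analytic_within J s g \<Longrightarrow> g s \<noteq> 0 \<Longrightarrow> s \<in> J
    \<Longrightarrow> analytic_within J s (\<lambda>t. f t / g t)"
  by (simp add: divide_inverse analytic_within_mult analytic_within_inverse)

lemma analytic_within_csqrt:
  assumes "analytic_within J s f" "f s \<notin> \<real>\<^sub>\<le>\<^sub>0" "s \<in> J"
  shows "analytic_within J s (\<lambda>t. csqrt (f t))"
proof -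
  obtain f' where a: "f' analytic_on {of_real s}"
      and e: "eventually (\<lambda>t. f t = f' (of_real t)) (nhds_within s J)"
    using assms unfolding analytic_within_def by blast
  have "f' (of_real s) \<notin> \<real>\<^sub>\<le>\<^sub>0"
    using eventually_nhds_within_self[OF e] assms by auto
  then show ?thesis unfolding analytic_within_def
    by (intro exI[of _ "\<lambda>z. csqrt (f' z)"] conjI analytic_on_csqrt' a)
      (auto intro: eventually_mono[OF e])
qed

lemma analytic_within_deriv:
  assumes "analytic_within J s f" "s \<in> J"
  shows "\<exists>D. (f has_vector_derivative D) (at s within J)"
proof -
  obtain g r where r: "r > 0" "g holomorphic_on ball (of_real s) r"
    "\<And>t. t \<in> J \<Longrightarrow> \<bar>t - s\<bar> < r \<Longrightarrow> f t = g (of_real t)"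
    using assms(1) by (rule analytic_withinE) blast
  obtain D where "(g has_field_derivative D) (at (of_real s))"
    using r by (auto dest!: holomorphic_on_imp_differentiable_at[where x = "of_real s"]
        simp: field_differentiable_def)
  then have "((\<lambda>t. g (of_real t)) has_vector_derivative D) (at s within J)"
    by (auto intro!: has_vector_derivative_real_field)
  then have "(f has_vector_derivative D) (at s within J)"
    by (rule has_vector_derivative_transform_within[OF _ r(1) assms(2)])
      (auto simp: r(3) dist_real_def)
  then show ?thesis by blast
qed

lemma analytic_within_tendsto:
  assumes "analytic_within J s f" "s \<in> J"
  shows "(f \<longlongrightarrow> f s) (at s within J)"
proof -
  obtain D where "(f has_vector_derivative D) (at s within J)"
    using analytic_within_deriv[OF assms] by blast
  then show ?thesis
    using has_vector_derivative_continuous by (simp add: continuous_within)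
qed

lemma analytic_within_eventually_nonzero:
  assumes "analytic_within J s f" "s \<in> J" "f s \<noteq> 0"
  shows "eventually (\<lambda>t. f t \<noteq> 0) (nhds_within s J)"
  unfolding eventually_nhds_within_iff
  using tendsto_imp_eventually_ne[OF analytic_within_tendsto[OF assms(1,2)] assms(3)] assms by auto

text \<open>The exponent is the order of vanishing of the holomorphic extension at \<open>s\<close>
  (possibly 0), and the cofactor is its \<open>zor_poly\<close>. The first alternative arises when
  the extension vanishes on the whole disc.\<close>

lemma analytic_within_factor:
  assumes "analytic_within J s f"
  obtains "eventually (\<lambda>t. f t = 0) (nhds_within s J)"
  | k g where "analytic_within J s g" "g s \<noteq> 0"
      "eventually (\<lambda>t. f t = of_real (t - s) ^ k * g t) (nhds_within s J)"
proof -
  obtain g r where r: "r > 0" "g holomorphic_on ball (of_real s) r"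
    "\<And>t. t \<in> J \<Longrightarrow> \<bar>t - s\<bar> < r \<Longrightarrow> f t = g (of_real t)"
    using assms by (rule analytic_withinE) blast
  have ball: "of_real t \<in> ball (complex_of_real s) r \<longleftrightarrow> \<bar>t - s\<bar> < r" for t
    by (auto simp: dist_norm abs_minus_commute simp flip: of_real_diff)
  show thesis
  proof (cases "\<exists>w\<in>ball (complex_of_real s) r. g w \<noteq> 0")
    case False
    then show thesis
      using r ball by (intro that(1)) (auto simp: eventually_nhds_within)
  next
    case True
    let ?z = "complex_of_real s"
    have "?z \<in> ball ?z r" using r(1) by simp
    from conjunct2[OF zorder_exist_zero[OF r(2) open_ball connected_ball this True]]
    obtain r' where r': "r' > 0" "cball ?z r' \<subseteq> ball ?z r" "zor_poly g ?z holomorphic_on cball ?z r'"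
      "\<forall>w\<in>cball ?z r'. g w = zor_poly g ?z w * (w - ?z) ^ nat (zorder g ?z) \<and> zor_poly g ?z w \<noteq> 0"
      by blast
    show thesis
    proof (rule that(2))
      show "analytic_within J s (\<lambda>t. zor_poly g ?z (of_real t))"
        by (rule analytic_withinI[OF r'(1), of "zor_poly g ?z"])
          (use holomorphic_on_subset[OF r'(3) ball_subset_cball] in simp_all)
      have "?z \<in> cball ?z r'" using r'(1) by simp
      with r'(4) show "zor_poly g ?z (of_real s) \<noteq> 0" by blast
      have "f t = of_real (t - s) ^ nat (zorder g ?z) * zor_poly g ?z (of_real t)"
        if "t \<in> J" "\<bar>t - s\<bar> < min r r'" for t
      proof -
        have "of_real t \<in> cball ?z r'"
          using that by (simp add: dist_norm abs_minus_commute flip: of_real_diff)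
        with r'(4) have "g (of_real t) = zor_poly g ?z (of_real t) * (of_real t - ?z) ^ nat (zorder g ?z)"
          by blast
        moreover have "f t = g (of_real t)" using r(3) that by simp
        ultimately show ?thesis by (simp only: of_real_diff mult.commute)
      qed
      then show "eventually (\<lambda>t. f t = of_real (t - s) ^ nat (zorder g ?z) * zor_poly g ?z (of_real t))
          (nhds_within s J)"
        unfolding eventually_nhds_within using r(1) r'(1)
        by (intro exI[of _ "min r r'"] conjI ballI impI) simp_all
    qed
  qed
qed

text \<open>Zeros of an analytic function are isolated unless its germ is zero.\<close>

lemma analytic_within_dichotomy:
  assumes "analytic_within J s f" "s \<in> J"
  shows "eventually (\<lambda>t. f t = 0) (nhds_within s J) \<or> eventually (\<lambda>t. f t \<noteq> 0) (at s within J)"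
  using assms(1)
proof (cases rule: analytic_within_factor)
  case (2 k g)
  have "eventually (\<lambda>t. f t \<noteq> 0) (at s within J)"
    using eventually_within_nhds_within[OF 2(3)]
      eventually_within_nhds_within[OF analytic_within_eventually_nonzero[OF 2(1) assms(2) 2(2)]]
      eventually_neq_at_within[of s s J]
    by eventually_elim simp
  then show ?thesis by blast
qed auto

section \<open>Holomorphic germs and real power series\<close>

lemma real_analytic_on_if_analytic_within:
  fixes f :: "real \<Rightarrow> complex"
  assumes "\<And>s. s \<in> J \<Longrightarrow> analytic_within J s f"
  shows "real_analytic_on J f"
  unfolding real_analytic_on_def
proof
  fix s assume "s \<in> J"
  from assms[OF this] obtain g r where r: "r > 0" "g holomorphic_on ball (of_real s) r"
    "\<And>t. t \<in> J \<Longrightarrow> \<bar>t - s\<bar> < r \<Longrightarrow> f t = g (of_real t)"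
    by (rule analytic_withinE) blast
  have "(\<lambda>k. (t - s) ^ k *\<^sub>R ((deriv ^^ k) g (of_real s) / fact k)) sums f t"
    if "t \<in> J" "\<bar>t - s\<bar> < r" for t
  proof -
    have "of_real t \<in> ball (complex_of_real s) r"
      using that by (auto simp: dist_norm abs_minus_commute simp flip: of_real_diff)
    from holomorphic_power_series[OF r(2) this] show ?thesis
      using r(3)[OF that] by (simp add: scaleR_conv_of_real mult.commute)
  qed
  then show "\<exists>r>0. \<exists>co. \<forall>t\<in>J. \<bar>t - s\<bar> < r \<longrightarrow> (\<lambda>k. (t - s) ^ k *\<^sub>R co k) sums f t"
    using r(1) by (intro exI[of _ r] conjI exI[of _ "\<lambda>k. (deriv ^^ k) g (of_real s) / fact k"]) simp_all
qed

text \<open>Convergence of the series is given only at points of the half-line. Since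
  \<open>s + r / 2\<close> always belongs to it, even for \<open>s = t0\<close>, convergence at this
  one point yields convergence on the complex disc of radius \<open>r / 2\<close>.\<close>

lemma analytic_within_if_real_analytic_on:
  fixes f :: "real \<Rightarrow> complex"
  assumes "real_analytic_on {t0..} f" "s \<ge> t0"
  shows "analytic_within {t0..} s f"
proof -
  obtain r co where r: "r > 0"
    and co: "\<And>t. t \<ge> t0 \<Longrightarrow> \<bar>t - s\<bar> < r \<Longrightarrow> (\<lambda>k. (t - s) ^ k *\<^sub>R co k) sums f t"
    using assms unfolding real_analytic_on_def by (metis atLeast_iff)
  define z where "z = complex_of_real s"
  define g where "g w = (\<Sum>k. co k * (w - z) ^ k)" for w
  have sums: "(\<lambda>k. co k * (w - z) ^ k) sums g w" if "w \<in> ball z (r / 2)" for w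
  proof -
    have "(\<lambda>k. (s + r / 2 - s) ^ k *\<^sub>R co k) sums f (s + r / 2)"
      using assms(2) r by (intro co) auto
    then have "summable (\<lambda>k. co k * (complex_of_real (r / 2)) ^ k)"
      by (auto simp: sums_iff scaleR_conv_of_real mult.commute)
    then have "summable (\<lambda>k. co k * (w - z) ^ k)"
      by (rule powser_inside) (use that r in \<open>simp add: dist_norm norm_minus_commute\<close>)
    then show ?thesis unfolding g_def by (rule summable_sums)
  qed
  show ?thesis
  proof (rule analytic_withinI)
    show "r / 2 > 0" using r by simp
    show "g holomorphic_on ball (of_real s) (r / 2)"
      using power_series_holomorphic[OF sums] unfolding z_def .
    show "f t = g (of_real t)" if "t \<in> {t0..}" "\<bar>t - s\<bar> < r / 2" for t
    proof -
      have "(\<lambda>k. co k * (of_real t - z) ^ k) sums f t"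
        using co[of t] that r by (simp add: scaleR_conv_of_real mult.commute z_def)
      moreover have "of_real t \<in> ball z (r / 2)"
        using that by (simp add: z_def dist_norm abs_minus_commute flip: of_real_diff)
      ultimately show ?thesis using sums sums_unique2 by blast
    qed
  qed
qed

lemma real_analytic_on_vec_nth:
  assumes "real_analytic_on J (f :: real \<Rightarrow> 'a::real_normed_vector ^ 'n)"
  shows "real_analytic_on J (\<lambda>t. f t $ i)"
  unfolding real_analytic_on_def
proof
  fix s assume "s \<in> J"
  then obtain r co where r: "r > 0"
    "\<forall>t\<in>J. \<bar>t - s\<bar> < r \<longrightarrow> (\<lambda>k. (t - s) ^ k *\<^sub>R co k) sums f t"
    using assms unfolding real_analytic_on_def by blast
  have "(\<lambda>k. (t - s) ^ k *\<^sub>R (co k $ i)) sums (f t $ i)" if "t \<in> J" "\<bar>t - s\<bar> < r" for t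
    using bounded_linear.sums[OF bounded_linear_vec_nth r(2)[rule_format, OF that], of i] by simp
  with r(1) show "\<exists>r>0. \<exists>co. \<forall>t\<in>J. \<bar>t - s\<bar> < r \<longrightarrow> (\<lambda>k. (t - s) ^ k *\<^sub>R co k) sums (f t $ i)"
    by (intro exI[of _ r] conjI exI[of _ "\<lambda>k. co k $ i"]) simp_all
qed

lemma real_analytic_on_vec:
  fixes f :: "real \<Rightarrow> 'a::real_normed_vector ^ 'n"
  assumes "\<And>i. real_analytic_on J (\<lambda>t. f t $ i)"
  shows "real_analytic_on J f"
  unfolding real_analytic_on_def
proof
  fix s assume s: "s \<in> J"
  have "\<exists>r co. r > 0 \<and> (\<forall>t\<in>J. \<bar>t - s\<bar> < r \<longrightarrow> (\<lambda>k. (t - s) ^ k *\<^sub>R co k) sums (f t $ i))" for i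
    using assms[of i] s unfolding real_analytic_on_def by blast
  then obtain r co where r: "\<And>i. r i > 0"
    and co: "\<And>i t. t \<in> J \<Longrightarrow> \<bar>t - s\<bar> < r i \<Longrightarrow> (\<lambda>k. (t - s) ^ k *\<^sub>R co i k) sums (f t $ i)"
    by metis
  have "(\<lambda>k. (t - s) ^ k *\<^sub>R (\<chi> i. co i k)) sums f t" if "t \<in> J" "\<bar>t - s\<bar> < Min (range r)" for t
    unfolding sums_def
  proof (rule vec_tendstoI)
    fix i
    have "\<bar>t - s\<bar> < r i" using that(2) by simp
    from co[OF that(1) this]
    show "(\<lambda>n. (\<Sum>k<n. (t - s) ^ k *\<^sub>R (\<chi> i. co i k)) $ i) \<longlonglongrightarrow> f t $ i"
      by (simp add: sums_def sum_component)
  qed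
  moreover have "Min (range r) > 0" using r by (subst Min_gr_iff) auto
  ultimately show "\<exists>r>0. \<exists>co. \<forall>t\<in>J. \<bar>t - s\<bar> < r \<longrightarrow> (\<lambda>k. (t - s) ^ k *\<^sub>R co k) sums f t"
    by (intro exI[of _ "Min (range r)"] conjI exI[of _ "\<lambda>k. \<chi> i. co i k"]) simp_all
qed

section \<open>Hermitian matrices and the spectral theorem\<close>

lemma matrix_mul_add_rdistrib: "(A + B) ** C = A ** C + B ** (C :: 'n::finite cmat)"
  by (vector matrix_matrix_mult_def distrib_right sum.distrib)

lemma matrix_mul_diff_ldistrib: "A ** (B - C) = A ** B - A ** (C :: 'n::finite cmat)"
  by (vector matrix_matrix_mult_def right_diff_distrib sum_subtractf)

lemma matrix_mul_diff_rdistrib: "(A - B) ** C = A ** C - B ** (C :: 'n::finite cmat)"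
  by (vector matrix_matrix_mult_def left_diff_distrib sum_subtractf)

lemma matrix_mul_zero [simp]: "A ** 0 = (0 :: 'n::finite cmat)" "0 ** A = (0 :: 'n cmat)"
  by (vector matrix_matrix_mult_def)+

lemma matrix_mul_minus: "(- A) ** B = - (A ** (B :: 'n::finite cmat))" "A ** (- B) = - (A ** (B :: 'n cmat))"
  by (vector matrix_matrix_mult_def sum_negf)+

lemma matrix_mul_sum_left: "(\<Sum>i\<in>I. A i) ** B = (\<Sum>i\<in>I. A i ** (B :: 'n::finite cmat))"
  by (induction I rule: infinite_finite_induct) (simp_all add: matrix_mul_add_rdistrib)

lemma matrix_mul_sum_right: "B ** (\<Sum>i\<in>I. A i) = (\<Sum>i\<in>I. B ** (A i :: 'n::finite cmat))"
  by (induction I rule: infinite_finite_induct) (simp_all add: matrix_add_ldistrib)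

lemma smul_mult [simp]: "smul z A ** B = smul z (A ** B)" "A ** smul z B = smul z (A ** B)"
  by (vector smul_def matrix_matrix_mult_def sum_distrib_left mult_ac)+

lemma smul_smul [simp]: "smul w (smul z A) = smul (w * z) A"
  by (vector smul_def mult_ac)

lemma smul_add: "smul z (A + B) = smul z A + smul z B" "smul (w + z) A = smul w A + smul z A"
  by (vector smul_def algebra_simps)+

lemma smul_diff: "smul z (A - B) = smul z A - smul z B" "smul (w - z) A = smul w A - smul z A"
  by (vector smul_def algebra_simps)+

lemma smul_simps [simp]: "smul 0 A = 0" "smul 1 A = A" "smul z 0 = 0" "smul (- z) A = - smul z A"
    "smul z (- A) = - smul z A"
  by (vector smul_def)+

lemma smul_sum: "smul z (\<Sum>i\<in>I. A i) = (\<Sum>i\<in>I. smul z (A i))"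
  by (induction I rule: infinite_finite_induct) (simp_all add: smul_add)

lemma smul_nth [simp]: "smul z A $ i $ j = z * A $ i $ j"
  by (simp add: smul_def)

lemma smul_of_real: "smul (of_real r) A = r *\<^sub>R A"
  by (simp add: vec_eq_iff) (simp add: scaleR_conv_of_real)

lemma smul_eq_0_iff: "smul z A = 0 \<longleftrightarrow> z = 0 \<or> A = 0"
  by (auto simp: vec_eq_iff)

lemma smul_vector_mult [simp]: "smul z A *v w = z *s (A *v w)"
  by (vector smul_def matrix_vector_mult_def sum_distrib_left mult_ac)

lemma matrix_vector_mult_smult: "A *v (z *s w) = z *s (A *v (w :: complex^'n::finite))"
  by (vector matrix_vector_mult_def sum_distrib_left mult_ac)

lemma madj_nth [simp]: "madj A $ i $ j = cnj (A $ j $ i)"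
  by (simp add: madj_def)

lemma madj_simps [simp]:
  "madj (madj A) = A" "madj (A + B) = madj A + madj B" "madj (A - B) = madj A - madj B"
  "madj (- A) = - madj A" "madj 0 = 0" "madj (smul z A) = smul (cnj z) (madj A)" "madj (mat 1) = mat 1"
  by (auto simp: vec_eq_iff mat_def)

lemma madj_mult [simp]: "madj (A ** B) = madj B ** madj A"
  by (simp add: vec_eq_iff matrix_matrix_mult_def mult.commute)

lemma mtrace_simps [simp]:
  "mtrace (A + B) = mtrace A + mtrace B" "mtrace (A - B) = mtrace A - mtrace B"
  "mtrace (- A) = - mtrace A" "mtrace (smul z A) = z * mtrace A" "mtrace 0 = 0"
  "mtrace (madj A) = cnj (mtrace A)"
  by (simp_all add: mtrace_def sum.distrib sum_subtractf sum_negf sum_distrib_left)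

lemma mtrace_mat_1: "mtrace (mat 1 :: 'n::finite cmat) = of_nat CARD('n)"
  by (simp add: mtrace_def mat_def)

lemma mtrace_sum: "mtrace (\<Sum>i\<in>I. A i) = (\<Sum>i\<in>I. mtrace (A i))"
  by (induction I rule: infinite_finite_induct) simp_all

lemma mtrace_mult_commute: "mtrace (A ** B) = mtrace (B ** A)"
  unfolding mtrace_def matrix_matrix_mult_def vec_lambda_beta
  by (subst sum.swap) (simp add: mult.commute)

lemma hermitianD: "hermitian A \<Longrightarrow> madj A = A"
  by (simp add: hermitian_def)

lemma mult_cnj_self: "z * cnj z = (complex_of_real (cmod z))\<^sup>2"
  by (metis complex_norm_square of_real_power)

lemma mtrace_adj_mult: "mtrace (madj A ** A) = of_real (\<Sum>i\<in>UNIV. \<Sum>j\<in>UNIV. (cmod (A $ j $ i))\<^sup>2)"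
  unfolding mtrace_def matrix_matrix_mult_def of_real_sum
  by (simp add: mult_cnj_self mult.commute)

section \<open>Orthogonal projections, inner product and rank-one matrices\<close>

definition hproj :: "'n::finite cmat \<Rightarrow> bool" where
  "hproj Q \<longleftrightarrow> madj Q = Q \<and> Q ** Q = Q"

lemma mtrace_hproj_nonneg: "hproj Q \<Longrightarrow> Re (mtrace Q) \<ge> 0"
  using mtrace_adj_mult[of Q] by (auto simp: hproj_def intro!: sum_nonneg)

definition cdot :: "complex^'n::finite \<Rightarrow> complex^'n \<Rightarrow> complex" where
  "cdot v w = (\<Sum>i\<in>UNIV. cnj (v $ i) * w $ i)"

definition outer :: "complex^'n::finite \<Rightarrow> complex^'n \<Rightarrow> 'n cmat" where
  "outer v w = (\<chi> i j. v $ i * cnj (w $ j))"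

lemma outer_vector_mult: "outer v w *v u = cdot w u *s v"
  by (simp add: vec_eq_iff outer_def cdot_def matrix_vector_mult_def sum_distrib_left sum_distrib_right mult_ac)

lemma outer_zero [simp]: "outer 0 w = 0" "outer v 0 = 0"
  by (simp_all add: vec_eq_iff outer_def)

lemma madj_outer [simp]: "madj (outer v w) = outer w v"
  by (simp add: vec_eq_iff outer_def mult.commute)

lemma matrix_mul_outer: "A ** outer v w = outer (A *v v) w"
  by (simp add: vec_eq_iff outer_def matrix_matrix_mult_def matrix_vector_mult_def sum_distrib_left mult_ac)

lemma outer_matrix_mul: "outer v w ** A = outer v (madj A *v w)"
  by (simp add: vec_eq_iff outer_def matrix_matrix_mult_def matrix_vector_mult_def sum_distrib_left mult_ac)

lemma outer_smult: "outer (z *s v) w = smul z (outer v w)" "outer v (z *s w) = smul (cnj z) (outer v w)"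
  by (simp_all add: vec_eq_iff outer_def)

lemma mtrace_outer: "mtrace (outer v w) = cdot w v"
  by (simp add: mtrace_def outer_def cdot_def mult.commute)

lemma cdot_self: "cdot v v = of_real ((norm v)\<^sup>2)"
  unfolding cdot_def norm_vec_def L2_set_def
  by (simp add: sum_nonneg mult_cnj_self mult.commute)

lemma cdot_adj: "cdot (A *v v) w = cdot v (madj A *v w)"
  unfolding cdot_def matrix_vector_mult_def
  by (simp add: sum_distrib_left sum_distrib_right) (subst sum.swap, simp add: mult_ac)

lemma cdot_smult: "cdot (z *s v) w = cnj z * cdot v w" "cdot v (z *s w) = z * cdot v w"
  by (simp_all add: cdot_def sum_distrib_left mult_ac)

lemma cdot_sum_right: "cdot v (\<Sum>k\<in>I. w k) = (\<Sum>k\<in>I. cdot v (w k))"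
  by (induction I rule: infinite_finite_induct) (simp_all add: cdot_def ring_distribs sum.distrib)

lemma cdot_commute: "cdot v w = cnj (cdot w v)"
  by (simp add: cdot_def mult.commute)

lemma inner_eq_Re_cdot: "v \<bullet> w = Re (cdot v w)"
  by (simp add: cdot_def inner_vec_def inner_complex_def)

lemma inner_hermitian: "hermitian A \<Longrightarrow> (A *v v) \<bullet> w = v \<bullet> (A *v w)"
  by (simp add: inner_eq_Re_cdot cdot_adj hermitianD)

lemma scaleR_eq_smult: "r *\<^sub>R v = of_real r *s (v :: complex^'n)"
  by (simp add: vec_eq_iff) (simp add: scaleR_conv_of_real)

lemma matrix_vector_mult_scaleR_complex: "A *v (r *\<^sub>R w) = r *\<^sub>R (A *v (w :: complex^'n::finite))"
  by (simp add: scaleR_eq_smult matrix_vector_mult_smult)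

text \<open>The largest value of the quadratic form of \<open>A\<close> on the unit sphere of the range of \<open>Q\<close> is an
  eigenvalue: the first-order condition at a maximiser is the eigenvalue equation.\<close>

lemma hermitian_eigenvector_in_range:
  fixes A Q :: "'n::finite cmat"
  assumes A: "hermitian A" and Q: "hproj Q" "Q \<noteq> 0" and AQ: "A ** Q = Q ** A"
  obtains e r where "norm e = 1" "Q *v e = e" "A *v e = r *\<^sub>R e"
proof -
  define S where "S = {w. Q *v w = w} \<inter> sphere 0 1"
  have "compact S"
    unfolding S_def by (intro closed_Int_compact closed_Collect_eq continuous_intros) simp
  moreover have "S \<noteq> {}"
  proof -
    obtain w where w: "Q *v w \<noteq> 0"
      using Q(2) by (metis matrix_eq matrix_vector_mult_0)
    have "Q *v (Q *v w) = Q *v w"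
      using Q(1) by (simp add: matrix_vector_mul_assoc hproj_def)
    then have "(1 / norm (Q *v w)) *\<^sub>R (Q *v w) \<in> S"
      using w by (simp add: S_def matrix_vector_mult_scaleR_complex)
    then show ?thesis by blast
  qed
  moreover have "continuous_on S (\<lambda>w. w \<bullet> (A *v w))"
    by (intro continuous_intros) 
  ultimately obtain e where e: "e \<in> S" and max: "\<And>w. w \<in> S \<Longrightarrow> w \<bullet> (A *v w) \<le> e \<bullet> (A *v e)"
    by (metis continuous_attains_sup)
  define \<mu> where "\<mu> = e \<bullet> (A *v e)"
  have bound: "w \<bullet> (A *v w) \<le> \<mu> * (w \<bullet> w)" if "Q *v w = w" for w
  proof (cases "w = 0")
    case False
    have "(1 / norm w) *\<^sub>R w \<in> S"
      using False that by (simp add: S_def matrix_vector_mult_scaleR_complex)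
    from max[OF this] have "(1 / norm w)\<^sup>2 * (w \<bullet> (A *v w)) \<le> \<mu>"
      by (simp add: matrix_vector_mult_scaleR_complex \<mu>_def power2_eq_square)
    then show ?thesis
      using False by (simp add: field_simps power2_norm_eq_inner flip: power2_norm_eq_inner)
  qed simp
  \<comment> \<open>The residual of the eigenvalue equation. It lies in the range of
    \<open>Q\<close> because \<open>A\<close> commutes with \<open>Q\<close>, so
    \<open>e + \<epsilon> h\<close> is an admissible competitor.\<close>
  define h where "h = \<mu> *\<^sub>R e - A *v e"
  have Qe: "Q *v e = e" and ne: "e \<bullet> e = 1"
    using e by (auto simp: S_def norm_eq_1)
  have "Q *v (A *v e) = A *v e"
    using Qe AQ by (metis matrix_vector_mul_assoc)
  then have Qh: "Q *v h = h"
    by (simp add: h_def matrix_vector_mult_diff_distrib matrix_vector_mult_scaleR_complex Qe)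
  define K where "K = \<mu> * (h \<bullet> h) - h \<bullet> (A *v h)"
  have K: "K \<ge> 0" using bound[OF Qh] by (simp add: K_def)
  \<comment> \<open>The upper bound evaluated at \<open>e + \<epsilon> h\<close>: the constant term
    cancels by the definition of \<open>\<mu>\<close>, and the linear coefficient is twice the
    squared length of \<open>h\<close>.\<close>
  have quad: "0 \<le> 2 * \<epsilon> * (h \<bullet> h) + \<epsilon>\<^sup>2 * K" for \<epsilon>
  proof -
    have "Q *v (e + \<epsilon> *\<^sub>R h) = e + \<epsilon> *\<^sub>R h"
      by (simp add: matrix_vector_right_distrib matrix_vector_mult_scaleR_complex Qe Qh)
    from bound[OF this] have "0 \<le> \<mu> * ((e + \<epsilon> *\<^sub>R h) \<bullet> (e + \<epsilon> *\<^sub>R h)) - (e + \<epsilon> *\<^sub>R h) \<bullet> (A *v (e + \<epsilon> *\<^sub>R h))"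
      by simp
    also have "\<dots> = 2 * \<epsilon> * ((\<mu> *\<^sub>R e - A *v e) \<bullet> h) + \<epsilon>\<^sup>2 * K"
      using inner_hermitian[OF A, of e h] ne
      by (simp add: K_def matrix_vector_right_distrib matrix_vector_mult_scaleR_complex inner_add inner_diff
          power2_eq_square inner_commute algebra_simps \<mu>_def[symmetric])
    finally show ?thesis by (simp add: h_def[symmetric])
  qed
  have "h \<bullet> h \<le> 0"
  proof (rule ccontr)
    assume h: "\<not> h \<bullet> h \<le> 0"
    have "\<epsilon> * (h \<bullet> h) * 2 \<le> \<epsilon>\<^sup>2 * K" if "\<epsilon> > 0" for \<epsilon>
      using quad[of "- \<epsilon>"] by simp
    then have *: "(h \<bullet> h) * 2 \<le> \<epsilon> * K" if "\<epsilon> > 0" for \<epsilon>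
      using that by (simp add: power2_eq_square mult.assoc)
    \<comment> \<open>A step so short that the quadratic term stays below the linear one;
      \<open>K + 1\<close> avoids dividing by 0.\<close>
    have "(h \<bullet> h) * 2 \<le> (h \<bullet> h) / (K + 1) * K"
      using h K by (intro * divide_pos_pos) auto
    also have "\<dots> \<le> h \<bullet> h"
      using h K by (simp add: field_simps)
    finally show False using h by simp
  qed
  then have "h = 0" by (metis inner_gt_zero_iff not_less)
  then have "A *v e = \<mu> *\<^sub>R e" by (simp add: h_def)
  moreover have "norm e = 1" using e by (simp add: S_def)
  ultimately show thesis using that Qe by blast
qed

lemma hproj_diff_outer:
  assumes Q: "hproj Q" "Q *v e = e" "norm e = 1"
  shows "hproj (Q - outer e e)"
  using assms unfolding hproj_def
  by (simp add: matrix_mul_diff_ldistrib matrix_mul_diff_rdistrib matrix_mul_outer outer_matrix_mul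
      outer_vector_mult cdot_self matrix_vector_mult_diff_rdistrib)

lemma mtrace_outer_unit: "norm e = 1 \<Longrightarrow> mtrace (outer e e) = 1"
  by (simp add: mtrace_outer cdot_self)

text \<open>Removing a unit vector of the range lowers the trace by 1 and leaves a projection, whose
  trace is still non-negative. The trace thus acts as a rank: it measures progress in the
  inductions, and a projection of trace below 1 is zero.\<close>

lemma mtrace_hproj_ge_1:
  assumes "hproj Q" "Q \<noteq> 0"
  shows "Re (mtrace Q) \<ge> 1"
proof -
  have "mat 1 ** Q = Q ** mat 1" "hermitian (mat 1)" by (simp_all add: hermitian_def)
  then obtain e where "norm e = 1" "Q *v e = e"
    using hermitian_eigenvector_in_range assms by metis
  then show ?thesis
    using mtrace_hproj_nonneg[OF hproj_diff_outer[OF assms(1), of e]] mtrace_outer_unit[of e] by simp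
qed

section \<open>Orthonormal eigenbases\<close>

definition orthonormal_fam :: "nat \<Rightarrow> (nat \<Rightarrow> complex^'n::finite) \<Rightarrow> bool" where
  "orthonormal_fam n e \<longleftrightarrow> (\<forall>k<n. \<forall>l<n. cdot (e k) (e l) = (if k = l then 1 else 0))"

text \<open>Orthogonality of \<open>b\<close> to the family is a consequence:
  \<open>Q - outer b b\<close> annihilates \<open>b\<close>, so the expansion of \<open>b\<close>
  along the \<open>e k\<close> is zero, and pairing it with \<open>e k\<close> isolates each
  coefficient.\<close>

lemma orthonormal_fam_extend:
  assumes e: "orthonormal_fam n e" and Q: "Q - outer b b = (\<Sum>k<n. outer (e k) (e k))"
    and b: "norm b = 1" "Q *v b = b"
  shows "orthonormal_fam (Suc n) (e(n := b))"
    and "Q = (\<Sum>k<Suc n. outer ((e(n := b)) k) ((e(n := b)) k))"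
proof -
  show "Q = (\<Sum>k<Suc n. outer ((e(n := b)) k) ((e(n := b)) k))"
    using Q by (simp add: algebra_simps)
  have perp: "cdot (e k) b = 0" if "k < n" for k
  proof -
    have "(Q - outer b b) *v b = 0"
      using b by (simp add: matrix_vector_mult_diff_rdistrib outer_vector_mult cdot_self)
    then have "(\<Sum>k<n. outer (e k) (e k)) *v b = 0" by (simp add: Q)
    moreover have "(\<Sum>k<m. outer (e k) (e k)) *v b = (\<Sum>k<m. cdot (e k) b *s e k)" for m
      by (induction m) (simp_all add: matrix_vector_mult_add_rdistrib outer_vector_mult)
    ultimately have "cdot (e k) (\<Sum>k<n. cdot (e k) b *s e k) = 0"
      by (simp add: cdot_def)
    then have "(\<Sum>l<n. cdot (e l) b * cdot (e k) (e l)) = 0"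
      by (simp only: cdot_sum_right cdot_smult)
    moreover have "(\<Sum>l<n. cdot (e l) b * cdot (e k) (e l)) = (\<Sum>l<n. if l = k then cdot (e k) b else 0)"
      using e that by (intro sum.cong) (auto simp: orthonormal_fam_def)
    ultimately show ?thesis using that by simp
  qed
  then have "cdot b (e k) = 0" if "k < n" for k
    using that cdot_commute[of b] by simp
  then show "orthonormal_fam (Suc n) (e(n := b))"
    using e perp b by (auto simp: orthonormal_fam_def cdot_self less_Suc_eq)
qed

lemma orthonormal_fam_card:
  fixes e :: "nat \<Rightarrow> complex^'n::finite"
  assumes "orthonormal_fam n e" "mat 1 = (\<Sum>k<n. outer (e k) (e k))"
  shows "n = CARD('n)"
proof -
  have "complex_of_nat CARD('n) = mtrace (\<Sum>k<n. outer (e k) (e k))"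
    by (metis assms(2) mtrace_mat_1)
  also have "\<dots> = (\<Sum>k<n. 1)"
    unfolding mtrace_sum mtrace_outer using assms(1) by (intro sum.cong) (auto simp: orthonormal_fam_def)
  finally show ?thesis by simp
qed

text \<open>Induction on a strict bound for the trace. Working in the range of a projection that
  commutes with \<open>A\<close>, instead of the whole space, makes the statement inductive:
  splitting off an eigenvector leaves such a range again.\<close>

lemma hermitian_orthonormal_eigenbasis:
  fixes A Q :: "'n::finite cmat"
  assumes "hermitian A" "hproj Q" "A ** Q = Q ** A" "Re (mtrace Q) < of_nat N"
  shows "\<exists>n e d. orthonormal_fam n e \<and> Q = (\<Sum>k<n. outer (e k) (e k)) \<and> (\<forall>k<n. A *v e k = d k *\<^sub>R e k)"
  using assms(2-)
proof (induction N arbitrary: Q)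
  case 0
  then show ?case using mtrace_hproj_nonneg[of Q] by simp
next
  case (Suc N)
  show ?case
  proof (cases "Q = 0")
    case True
    then show ?thesis by (intro exI[of _ 0]) (simp add: orthonormal_fam_def)
  next
    case False
    obtain b r where b: "norm b = 1" "Q *v b = b" "A *v b = r *\<^sub>R b"
      using hermitian_eigenvector_in_range[OF assms(1) Suc.prems(1) False Suc.prems(2)] by blast
    have "A ** (Q - outer b b) = (Q - outer b b) ** A"
      using Suc.prems(2) b(3) hermitianD[OF assms(1)]
      by (simp add: matrix_mul_diff_ldistrib matrix_mul_diff_rdistrib matrix_mul_outer outer_matrix_mul
          scaleR_eq_smult outer_smult)
    moreover have "Re (mtrace (Q - outer b b)) < of_nat N"
      using Suc.prems(3) mtrace_outer_unit[OF b(1)] by simp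
    ultimately obtain n e d where IH: "orthonormal_fam n e" "Q - outer b b = (\<Sum>k<n. outer (e k) (e k))"
        "\<forall>k<n. A *v e k = d k *\<^sub>R e k"
      using Suc.IH[OF hproj_diff_outer[OF Suc.prems(1) b(2,1)]] by blast
    show ?thesis
      using orthonormal_fam_extend[OF IH(1,2) b(1,2)] IH(3) b(3)
      by (intro exI[of _ "Suc n"] exI[of _ "e(n := b)"] exI[of _ "d(n := r)"] conjI)
        (assumption | simp add: less_Suc_eq)+
  qed
qed

section \<open>Diagonalisation and the functional calculus\<close>

lemma diagm_mult: "(U ** diagm d) $ i $ j = U $ i $ j * d j" "(diagm d ** U) $ i $ j = d i * U $ i $ j"
proof -
  have "(\<Sum>k\<in>UNIV. U $ i $ k * (if k = j then d k else 0)) = (\<Sum>k\<in>UNIV. if k = j then U $ i $ j * d j else 0)"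
    by (intro sum.cong) auto
  then show "(U ** diagm d) $ i $ j = U $ i $ j * d j"
    by (simp add: matrix_matrix_mult_def diagm_def)
  have "(\<Sum>k\<in>UNIV. (if i = k then d i else 0) * U $ k $ j) = (\<Sum>k\<in>UNIV. if k = i then d i * U $ i $ j else 0)"
    by (intro sum.cong) auto
  then show "(diagm d ** U) $ i $ j = d i * U $ i $ j"
    by (simp add: matrix_matrix_mult_def diagm_def)
qed

lemma diagm_vector_mult: "(diagm d *v v) $ i = d i * v $ i"
proof -
  have "(\<Sum>k\<in>UNIV. (if i = k then d i else 0) * v $ k) = (\<Sum>k\<in>UNIV. if k = i then d i * v $ i else 0)"
    by (intro sum.cong) auto
  then show ?thesis by (simp add: matrix_vector_mult_def diagm_def)
qed

lemma diagm_simps [simp]: "madj (diagm d) = diagm (\<lambda>i. cnj (d i))" "diagm (\<lambda>_. 1) = mat 1"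
    "diagm d ** diagm d' = diagm (\<lambda>i. d i * d' i)" "diagm d + diagm d' = diagm (\<lambda>i. d i + d' i)"
    "diagm d - diagm d' = diagm (\<lambda>i. d i - d' i)" "smul z (diagm d) = diagm (\<lambda>i. z * d i)"
proof -
  show "diagm d ** diagm d' = diagm (\<lambda>i. d i * d' i)"
    by (simp add: vec_eq_iff diagm_mult) (simp add: diagm_def)
qed (auto simp: vec_eq_iff diagm_def mat_def)

text \<open>Entrywise, the assumption says that \<open>X $ i $ j\<close> vanishes unless
  \<open>d j = d' i\<close>, and then any function of the diagonal entries passes through as well.
  Both the well-definedness of \<open>hfun\<close> and its commutation properties rest on
  this.\<close>

lemma diagm_intertwine:
  fixes X :: "'n::finite cmat"
  assumes "X ** diagm (\<lambda>i. complex_of_real (d i)) = diagm (\<lambda>i. complex_of_real (d' i)) ** X"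
  shows "X ** diagm (\<lambda>i. f (d i)) = diagm (\<lambda>i. f (d' i)) ** X"
proof -
  have "X $ i $ j * complex_of_real (d j) = of_real (d' i) * X $ i $ j" for i j
    using assms by (simp add: vec_eq_iff diagm_mult)
  then have "X $ i $ j = 0 \<or> d j = d' i" for i j
    by (metis mult.commute mult_cancel_left of_real_eq_iff)
  then have "X $ i $ j * f (d j) = f (d' i) * X $ i $ j" for i j
    by (metis mult.commute mult_zero_left)
  then show ?thesis by (simp add: vec_eq_iff diagm_mult)
qed

lemma unitary_mult: "unitary U \<Longrightarrow> madj U ** U = mat 1" "unitary U \<Longrightarrow> U ** madj U = mat 1"
  by (simp_all add: unitary_def)

lemma unitary_cancel:
  assumes "unitary U"
  shows "U ** (madj U ** A) = A" "madj U ** (U ** A) = A" "A ** U ** madj U = A" "A ** madj U ** U = A"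
  using unitary_mult[OF assms] by (metis matrix_mul_assoc matrix_mul_lid matrix_mul_rid)+

lemma hermitian_diagonalize:
  fixes A :: "'n::finite cmat"
  assumes "hermitian A"
  obtains U d where "unitary U" "A = U ** diagm (\<lambda>i. complex_of_real (d i)) ** madj U"
proof -
  obtain N where "Re (mtrace (mat 1 :: 'n cmat)) < of_nat N"
    using reals_Archimedean2 by blast
  then obtain n e d where e: "orthonormal_fam n e" "(mat 1 :: 'n cmat) = (\<Sum>k<n. outer (e k) (e k))"
      "\<forall>k<n. A *v e k = d k *\<^sub>R e k"
    using hermitian_orthonormal_eigenbasis[OF assms, of "mat 1"]
    unfolding hproj_def matrix_mul_lid matrix_mul_rid madj_simps by blast
  have n: "n = CARD('n)" using orthonormal_fam_card[OF e(1,2)] .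
  then obtain h :: "'n \<Rightarrow> nat" where h: "bij_betw h UNIV {..<n}"
    by (metis card_lessThan finite finite_lessThan finite_same_card_bij)
  have hn: "h i < n" for i using h by (auto simp: bij_betw_def)
  have hi: "h i = h j \<longleftrightarrow> i = j" for i j using h by (auto simp: bij_betw_def inj_on_def)
  define U :: "'n cmat" where "U = (\<chi> i j. e (h j) $ i)"
  have "(madj U ** U) $ i $ j = cdot (e (h i)) (e (h j))" for i j
    by (simp add: U_def matrix_matrix_mult_def cdot_def)
  then have "madj U ** U = mat 1"
    using e(1) hn hi by (simp add: vec_eq_iff mat_def orthonormal_fam_def)
  then have U: "unitary U"
    using matrix_left_right_inverse[of "madj U" U] by (auto simp: unitary_def)
  have "(A ** U) $ i $ j = (A *v e (h j)) $ i" for i j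
    by (simp add: U_def matrix_matrix_mult_def matrix_vector_mult_def)
  then have "A ** U = U ** diagm (\<lambda>i. complex_of_real (d (h i)))"
    using e(3) hn by (simp add: vec_eq_iff diagm_mult U_def scaleR_eq_smult mult.commute)
  then have "A = U ** diagm (\<lambda>i. complex_of_real (d (h i))) ** madj U"
    using unitary_cancel(3)[OF U, of A] by simp
  with U show thesis by (rule that)
qed

text \<open>The choice in \<open>hfun\<close> is harmless: two diagonalisations are linked by
  \<open>madj U ** V\<close>, which intertwines the two diagonals and hence also their images under
  \<open>f\<close>.\<close>

lemma hfun_eq:
  assumes U: "unitary U" and A: "A = U ** diagm (\<lambda>i. complex_of_real (d i)) ** madj U"
  shows "hfun f A = U ** diagm (\<lambda>i. f (d i)) ** madj U"
  unfolding hfun_def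
proof (rule some_equality)
  fix B assume "\<exists>V d. unitary V \<and> A = V ** diagm (\<lambda>i. complex_of_real (d i)) ** madj V
      \<and> B = V ** diagm (\<lambda>i. f (d i)) ** madj V"
  then obtain V d' where V: "unitary V" "A = V ** diagm (\<lambda>i. complex_of_real (d' i)) ** madj V"
    and B: "B = V ** diagm (\<lambda>i. f (d' i)) ** madj V" by blast
  define X where "X = madj U ** V"
  have "X ** diagm (\<lambda>i. complex_of_real (d' i)) = madj U ** A ** V"
    unfolding X_def V(2) by (simp add: matrix_mul_assoc[symmetric] unitary_mult V)
  also have "\<dots> = diagm (\<lambda>i. complex_of_real (d i)) ** X"
    unfolding X_def A by (simp add: matrix_mul_assoc unitary_mult U)
  finally have "X ** diagm (\<lambda>i. f (d' i)) = diagm (\<lambda>i. f (d i)) ** X"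
    by (rule diagm_intertwine)
  then have "U ** (X ** diagm (\<lambda>i. f (d' i))) ** madj V = U ** (diagm (\<lambda>i. f (d i)) ** X) ** madj V"
    by simp
  then show "B = U ** diagm (\<lambda>i. f (d i)) ** madj U"
    unfolding X_def B by (simp add: matrix_mul_assoc unitary_mult U)
      (metis matrix_mul_assoc matrix_mul_rid unitary_mult(2) V(1))
qed (use assms in blast)

lemma hfun_commute:
  assumes A: "hermitian A" and X: "X ** A = A ** X"
  shows "X ** hfun f A = hfun f A ** X"
proof -
  obtain U d where U: "unitary U" "A = U ** diagm (\<lambda>i. complex_of_real (d i)) ** madj U"
    using hermitian_diagonalize[OF A] by blast
  define Y where "Y = madj U ** X ** U"
  have "Y ** diagm (\<lambda>i. complex_of_real (d i)) = madj U ** (X ** A) ** U"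
    unfolding Y_def U(2) by (simp add: matrix_mul_assoc[symmetric] unitary_mult U)
  also have "\<dots> = madj U ** (A ** X) ** U" by (simp add: X)
  also have "\<dots> = diagm (\<lambda>i. complex_of_real (d i)) ** Y"
    unfolding Y_def U(2) by (simp add: matrix_mul_assoc unitary_mult U)
  finally have "Y ** diagm (\<lambda>i. f (d i)) = diagm (\<lambda>i. f (d i)) ** Y"
    by (rule diagm_intertwine)
  then have "U ** (Y ** diagm (\<lambda>i. f (d i))) ** madj U = U ** (diagm (\<lambda>i. f (d i)) ** Y) ** madj U"
    by simp
  then show ?thesis
    unfolding Y_def hfun_eq[OF U] by (simp add: matrix_mul_assoc unitary_mult U)
      (metis matrix_mul_assoc matrix_mul_rid unitary_mult(2) U(1))
qed

lemma is_eigenvalue_diag: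
  assumes U: "unitary U" "A = U ** diagm d ** madj U"
  shows "is_eigenvalue A (d i)"
proof -
  define w where "w = U *v axis i 1"
  have "madj U *v w = axis i 1"
    unfolding w_def by (simp add: matrix_vector_mul_assoc unitary_mult U)
  then have "w \<noteq> 0" by (metis axis_eq_0_iff matrix_vector_mult_0_right zero_neq_one)
  moreover have "diagm d *v axis i 1 = d i *s axis i 1"
    by (simp add: vec_eq_iff diagm_vector_mult axis_def)
  then have "A *v w = d i *s w"
    using \<open>madj U *v w = _\<close> unfolding U(2)
    by (simp add: w_def matrix_vector_mult_smult flip: matrix_vector_mul_assoc)
  ultimately show ?thesis unfolding is_eigenvalue_def by blast
qed

lemma metrics_diagonalize:
  assumes "A \<in> metrics"
  obtains U d where "unitary U" "A = U ** diagm (\<lambda>i. complex_of_real (d i)) ** madj U" "\<And>i. d i > 0"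
proof -
  obtain U d where U: "unitary U" "A = U ** diagm (\<lambda>i. complex_of_real (d i)) ** madj U"
    using hermitian_diagonalize assms unfolding metrics_def by blast
  moreover have "d i > 0" for i
    using assms is_eigenvalue_diag[OF U, of i] unfolding metrics_def by fastforce
  ultimately show thesis using that by blast
qed

section \<open>Operator norm\<close>

definition opn :: "'n::finite cmat \<Rightarrow> real" where
  "opn A = onorm ((*v) A)"

lemma opn_bound: "norm (A *v w) \<le> opn A * norm w"
  unfolding opn_def by (rule onorm) (rule matrix_vector_mul_bounded_linear)

lemma opn_leI: "(\<And>w. norm (A *v w) \<le> r * norm w) \<Longrightarrow> opn A \<le> r"
  unfolding opn_def by (rule onorm_le)

lemma opn_nonneg: "opn A \<ge> 0"
  unfolding opn_def by (rule onorm_pos_le) (rule matrix_vector_mul_bounded_linear)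

lemma opn_mult: "opn (A ** B) \<le> opn A * opn B"
proof (rule opn_leI)
  fix w
  have "norm (A *v (B *v w)) \<le> opn A * norm (B *v w)" by (rule opn_bound)
  also have "\<dots> \<le> opn A * (opn B * norm w)"
    by (intro mult_left_mono opn_bound opn_nonneg)
  finally show "norm (A ** B *v w) \<le> opn A * opn B * norm w"
    by (simp add: matrix_vector_mul_assoc mult.assoc)
qed

lemma opn_add: "opn (A + B) \<le> opn A + opn B"
proof (rule opn_leI)
  fix w
  have "norm (A *v w + B *v w) \<le> opn A * norm w + opn B * norm w"
    by (intro norm_triangle_mono opn_bound)
  then show "norm ((A + B) *v w) \<le> (opn A + opn B) * norm w"
    by (simp add: matrix_vector_mult_add_rdistrib ring_distribs)
qed

lemma norm_vec_smult: "norm (z *s w) = cmod z * norm (w :: complex^'n)"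
  unfolding norm_vec_def by (simp add: norm_mult L2_set_right_distrib)

lemma opn_entry: "cmod (A $ i $ j) \<le> opn A"
proof -
  have "cmod (A $ i $ j) = cmod ((A *v axis j 1) $ i)"
    by (simp add: matrix_vector_mult_def axis_def if_distrib cong: if_cong)
  also have "\<dots> \<le> norm (A *v axis j 1)" by (rule Finite_Cartesian_Product.norm_nth_le)
  also have "\<dots> \<le> opn A" using opn_bound[of A "axis j 1"] by simp
  finally show ?thesis .
qed

lemma norm_le_entries: "norm (A :: 'n::finite cmat) \<le> (\<Sum>i\<in>UNIV. \<Sum>j\<in>UNIV. cmod (A $ i $ j))"
proof -
  have "norm A \<le> (\<Sum>i\<in>UNIV. norm (A $ i))" unfolding norm_vec_def by (rule L2_set_le_sum) simp
  also have "\<dots> \<le> (\<Sum>i\<in>UNIV. \<Sum>j\<in>UNIV. cmod (A $ i $ j))"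
    by (intro sum_mono) (simp add: norm_vec_def[of "_ $ _"] L2_set_le_sum)
  finally show ?thesis .
qed

lemma opn_le_norm: "opn (A :: 'n::finite cmat) \<le> CARD('n) * norm A"
proof (rule opn_leI)
  fix w
  have "norm (A *v w) \<le> (\<Sum>i\<in>UNIV. cmod ((A *v w) $ i))"
    unfolding norm_vec_def by (rule L2_set_le_sum) simp
  also have "\<dots> \<le> (\<Sum>i\<in>(UNIV::'n set). norm A * norm w)"
  proof (rule sum_mono)
    fix i
    have "cmod ((A *v w) $ i) \<le> (\<Sum>j\<in>UNIV. cmod (A $ i $ j) * cmod (w $ j))"
      unfolding matrix_vector_mult_def vec_lambda_beta
      by (rule order_trans[OF norm_sum]) (simp add: norm_mult)
    also have "\<dots> \<le> norm (A $ i) * norm w"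
      unfolding norm_vec_def using L2_set_mult_ineq[of "\<lambda>j. cmod (A $ i $ j)" "\<lambda>j. cmod (w $ j)" UNIV] by simp
    also have "\<dots> \<le> norm A * norm w"
      by (intro mult_right_mono Finite_Cartesian_Product.norm_nth_le) simp
    finally show "cmod ((A *v w) $ i) \<le> norm A * norm w" .
  qed
  finally show "norm (A *v w) \<le> CARD('n) * norm A * norm w" by simp
qed

lemma norm_unitary:
  assumes "unitary U"
  shows "norm (U *v w) = norm w"
proof -
  have "cdot (U *v w) (U *v w) = cdot w w"
    by (simp add: cdot_adj matrix_vector_mul_assoc unitary_mult assms)
  then have "(norm (U *v w))\<^sup>2 = (norm w)\<^sup>2"
    by (simp only: cdot_self of_real_eq_iff)
  then show ?thesis by simp
qed

lemma unitary_madj: "unitary U \<Longrightarrow> unitary (madj U)"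
  by (simp add: unitary_def)

text \<open>Together with \<open>diag_le_opn\<close> this identifies \<open>opn\<close> of a
  unitarily diagonalised matrix with its largest \<open>cmod (d i)\<close>. That is the reason for
  using \<open>opn\<close> next to the entrywise euclidean \<open>norm\<close>: being a strict
  contraction becomes a condition on eigenvalues.\<close>

lemma opn_diag_le:
  assumes U: "unitary U" and d: "\<And>i. cmod (d i) \<le> r" "r \<ge> 0"
  shows "opn (U ** diagm d ** madj U) \<le> r"
proof (rule opn_leI)
  fix w
  have "norm (U ** diagm d ** madj U *v w) = norm (diagm d *v (madj U *v w))"
    using norm_unitary[OF U] by (simp flip: matrix_vector_mul_assoc)
  also have "\<dots> \<le> r * norm (madj U *v w)"
    unfolding norm_vec_def using d
    by (subst L2_set_right_distrib) (auto intro!: L2_set_mono simp: diagm_vector_mult norm_mult mult_right_mono)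
  finally show "norm (U ** diagm d ** madj U *v w) \<le> r * norm w"
    by (simp add: norm_unitary[OF unitary_madj[OF U]])
qed

section \<open>Matrix power series\<close>

primrec mpow :: "'n::finite cmat \<Rightarrow> nat \<Rightarrow> 'n cmat" where
  "mpow A 0 = mat 1"
| "mpow A (Suc k) = A ** mpow A k"

text \<open>Summation is entrywise, so convergence and holomorphy reduce to scalar series. The
  coefficients in use are bounded by 1 in modulus, hence a geometric series in a bound
  \<open>\<rho> < 1\<close> for \<open>opn A\<close> dominates.\<close>

definition mseries :: "(nat \<Rightarrow> complex) \<Rightarrow> 'n::finite cmat \<Rightarrow> 'n cmat" where
  "mseries a A = (\<chi> i j. \<Sum>k. a k * mpow A k $ i $ j)"

lemma opn_mpow:
  assumes "opn A \<le> \<rho>"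
  shows "opn (mpow A k) \<le> \<rho> ^ k"
proof (induction k)
  case 0
  show ?case by (rule opn_leI) simp
next
  case (Suc k)
  have "opn (A ** mpow A k) \<le> opn A * opn (mpow A k)" by (rule opn_mult)
  also have "\<dots> \<le> \<rho> * \<rho> ^ k"
    using assms Suc opn_nonneg[of A] opn_nonneg[of "mpow A k"] by (intro mult_mono) auto
  finally show ?case by simp
qed

lemma mpow_entry_le: "opn A \<le> \<rho> \<Longrightarrow> cmod (mpow A k $ i $ j) \<le> \<rho> ^ k"
  using opn_mpow[of A \<rho> k] opn_entry[of "mpow A k" i j] by linarith

lemma mseries_term_le:
  assumes "opn A \<le> \<rho>" "cmod (a k) \<le> 1"
  shows "cmod (a k * mpow A k $ i $ j) \<le> \<rho> ^ k"
  using mult_mono[OF assms(2) mpow_entry_le[OF assms(1)], of k i j] by (simp add: norm_mult)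

lemma mseries_sums:
  assumes "opn A \<le> \<rho>" "\<rho> < 1" "\<And>k. cmod (a k) \<le> 1"
  shows "(\<lambda>k. a k * mpow A k $ i $ j) sums (mseries a A $ i $ j)"
proof -
  have "0 \<le> \<rho>" using opn_nonneg[of A] assms(1) by linarith
  then have "summable (\<lambda>k. \<rho> ^ k)" using assms(2) by (intro summable_geometric) simp
  then have "summable (\<lambda>k. a k * mpow A k $ i $ j)"
    by (rule summable_comparison_test'[where N = 0]) (rule mseries_term_le[OF assms(1,3)])
  then show ?thesis unfolding mseries_def by (simp add: summable_sums)
qed

lemma mseries_entry_le:
  assumes "opn A \<le> \<rho>" "\<rho> < 1" "\<And>k. cmod (a k) \<le> 1"
  shows "cmod (mseries a A $ i $ j) \<le> 1 / (1 - \<rho>)"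
proof -
  have \<rho>: "0 \<le> \<rho>" using opn_nonneg[of A] assms(1) by linarith
  show ?thesis
    using norm_sums_le[OF mseries_sums[OF assms] geometric_sums mseries_term_le[OF assms(1,3)]] \<rho> assms(2)
    by simp
qed

text \<open>Since \<open>A\<close> and \<open>B\<close> need not commute, the difference of powers
  is expanded by writing each new power as \<open>A\<close> times the previous difference plus
  \<open>A - B\<close> times a power of \<open>B\<close>.\<close>

lemma opn_mpow_diff:
  assumes "opn A \<le> \<rho>" "opn B \<le> \<rho>"
  shows "opn (mpow A (Suc k) - mpow B (Suc k)) \<le> of_nat (Suc k) * \<rho> ^ k * opn (A - B)"
proof (induction k)
  case (Suc k)
  have \<rho>: "0 \<le> \<rho>" using opn_nonneg[of A] assms(1) by linarith
  have "mpow A (Suc (Suc k)) - mpow B (Suc (Suc k)) =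
      A ** (mpow A (Suc k) - mpow B (Suc k)) + (A - B) ** mpow B (Suc k)"
    by (simp add: matrix_mul_diff_ldistrib matrix_mul_diff_rdistrib)
  then have "opn (mpow A (Suc (Suc k)) - mpow B (Suc (Suc k))) \<le>
      opn A * opn (mpow A (Suc k) - mpow B (Suc k)) + opn (A - B) * opn (mpow B (Suc k))"
    using opn_add[of "A ** (mpow A (Suc k) - mpow B (Suc k))" "(A - B) ** mpow B (Suc k)"]
      opn_mult[of A "mpow A (Suc k) - mpow B (Suc k)"] opn_mult[of "A - B" "mpow B (Suc k)"] by simp
  also have "\<dots> \<le> \<rho> * (of_nat (Suc k) * \<rho> ^ k * opn (A - B)) + opn (A - B) * \<rho> ^ Suc k"
    using assms Suc opn_mpow[OF assms(2), of "Suc k"] opn_nonneg \<rho>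
    by (intro add_mono mult_mono) auto
  also have "\<dots> = of_nat (Suc (Suc k)) * \<rho> ^ Suc k * opn (A - B)"
    by (simp add: algebra_simps)
  finally show ?case .
qed simp

text \<open>The constant is the sum of all (k + 1) \<rho>^k, the derivative of the geometric series.
  The terms of degree 0 cancel, hence the shift to \<open>Suc k\<close>.\<close>

lemma mseries_lipschitz:
  assumes "opn A \<le> \<rho>" "opn B \<le> \<rho>" "\<rho> < 1" "\<And>k. cmod (a k) \<le> 1"
  shows "cmod ((mseries a A - mseries a B) $ i $ j) \<le> opn (A - B) / (1 - \<rho>)\<^sup>2"
proof -
  have \<rho>: "0 \<le> \<rho>" using opn_nonneg[of A] assms(1) by linarith
  let ?t = "\<lambda>k. a k * mpow A k $ i $ j - a k * mpow B k $ i $ j"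
  have "?t sums ((mseries a A - mseries a B) $ i $ j)"
    using sums_diff[OF mseries_sums[OF assms(1,3,4), where i = i and j = j] mseries_sums[OF assms(2,3,4), where i = i and j = j]] by simp
  then have "(\<lambda>k. ?t (Suc k)) sums ((mseries a A - mseries a B) $ i $ j)"
    by (subst sums_Suc_iff) simp
  moreover have "(\<lambda>k. of_nat (Suc k) * \<rho> ^ k * opn (A - B)) sums (1 / (1 - \<rho>)\<^sup>2 * opn (A - B))"
    by (intro sums_mult2 geometric_deriv_sums) (use \<rho> assms(3) in simp)
  moreover have "cmod (?t (Suc k)) \<le> of_nat (Suc k) * \<rho> ^ k * opn (A - B)" for k
  proof -
    have "?t (Suc k) = a (Suc k) * (mpow A (Suc k) - mpow B (Suc k)) $ i $ j"
      by (simp add: right_diff_distrib)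
    moreover have "cmod (a (Suc k)) * cmod ((mpow A (Suc k) - mpow B (Suc k)) $ i $ j)
        \<le> 1 * (of_nat (Suc k) * \<rho> ^ k * opn (A - B))"
      using opn_mpow_diff[OF assms(1,2), of k] opn_entry[of "mpow A (Suc k) - mpow B (Suc k)" i j]
      by (intro mult_mono assms(4)) (auto simp del: mpow.simps)
    ultimately show ?thesis by (simp only: norm_mult)
  qed
  ultimately have "cmod ((mseries a A - mseries a B) $ i $ j) \<le> 1 / (1 - \<rho>)\<^sup>2 * opn (A - B)"
    by (rule norm_sums_le)
  then show ?thesis by simp
qed

section \<open>Holomorphic and analytic matrix families\<close>

definition hol_mat :: "complex set \<Rightarrow> (complex \<Rightarrow> 'n::finite cmat) \<Rightarrow> bool" where
  "hol_mat S W \<longleftrightarrow> (\<forall>i j. (\<lambda>z. W z $ i $ j) holomorphic_on S)"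

lemma hol_mat_subset: "hol_mat T W \<Longrightarrow> S \<subseteq> T \<Longrightarrow> hol_mat S W"
  unfolding hol_mat_def using holomorphic_on_subset by blast

lemma hol_mat_mult: "hol_mat S V \<Longrightarrow> hol_mat S W \<Longrightarrow> hol_mat S (\<lambda>z. V z ** W z)"
  unfolding hol_mat_def matrix_matrix_mult_def by (auto intro!: holomorphic_intros)

lemma hol_mat_simps:
  "hol_mat S (\<lambda>_. A)" "hol_mat S V \<Longrightarrow> hol_mat S W \<Longrightarrow> hol_mat S (\<lambda>z. V z + W z)"
  "hol_mat S V \<Longrightarrow> hol_mat S W \<Longrightarrow> hol_mat S (\<lambda>z. V z - W z)"
  "hol_mat S V \<Longrightarrow> hol_mat S (\<lambda>z. smul c (V z))"
  unfolding hol_mat_def by (auto intro!: holomorphic_intros)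

lemma hol_mat_mpow: "hol_mat S W \<Longrightarrow> hol_mat S (\<lambda>z. mpow (W z) k)"
  by (induction k) (auto intro: hol_mat_mult hol_mat_simps)

text \<open>A uniform limit of polynomials in \<open>W\<close>; the common bound
  \<open>\<rho>\<close> on all of \<open>S\<close> feeds the M-test.\<close>

lemma hol_mat_mseries:
  assumes S: "open S" and W: "hol_mat S W" and le: "\<And>z. z \<in> S \<Longrightarrow> opn (W z) \<le> \<rho>"
    and \<rho>: "\<rho> < 1" and a: "\<And>k. cmod (a k) \<le> 1"
  shows "hol_mat S (\<lambda>z. mseries a (W z))"
  unfolding hol_mat_def
proof (intro allI)
  fix i j
  let ?f = "\<lambda>n z. \<Sum>k<n. a k * mpow (W z) k $ i $ j"
  show "(\<lambda>z. mseries a (W z) $ i $ j) holomorphic_on S"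
  proof (cases "S = {}")
    case False
    then obtain z where "z \<in> S" by blast
    then have "0 \<le> \<rho>" using opn_nonneg[of "W z"] le[of z] by linarith
    then have summ: "summable (\<lambda>k. \<rho> ^ k)" using \<rho> by (intro summable_geometric) simp
    have "uniform_limit S (\<lambda>n z. \<Sum>k<n. a k * mpow (W z) k $ i $ j)
        (\<lambda>z. \<Sum>k. a k * mpow (W z) k $ i $ j) sequentially"
      by (rule Weierstrass_m_test[OF mseries_term_le summ]) (use le a in auto)
    then have lim: "uniform_limit S ?f (\<lambda>z. mseries a (W z) $ i $ j) sequentially"
      by (simp add: mseries_def)
    show ?thesis
    proof (rule holomorphic_uniform_sequence[OF S])
      show "?f n holomorphic_on S" for n
        using hol_mat_mpow[OF W] unfolding hol_mat_def by (auto intro!: holomorphic_intros)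
      show "\<exists>d>0. cball z d \<subseteq> S \<and> uniform_limit (cball z d) ?f (\<lambda>z. mseries a (W z) $ i $ j) sequentially"
        if "z \<in> S" for z
      proof -
        obtain d where "d > 0" "cball z d \<subseteq> S" using open_contains_cball_eq[OF S] \<open>z \<in> S\<close> by blast
        then show ?thesis using uniform_limit_on_subset[OF lim] by blast
      qed
    qed
  qed (simp add: holomorphic_on_def)
qed

definition analytic_mat :: "real set \<Rightarrow> real \<Rightarrow> (real \<Rightarrow> 'n::finite cmat) \<Rightarrow> bool" where
  "analytic_mat J s W \<longleftrightarrow> (\<forall>i j. analytic_within J s (\<lambda>t. W t $ i $ j))"

lemma analytic_matD: "analytic_mat J s W \<Longrightarrow> analytic_within J s (\<lambda>t. W t $ i $ j)"
  by (simp add: analytic_mat_def)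

lemma analytic_mat_simps [intro]:
  "analytic_mat J s (\<lambda>_. A)"
  "analytic_mat J s V \<Longrightarrow> analytic_mat J s W \<Longrightarrow> analytic_mat J s (\<lambda>t. V t + W t)"
  "analytic_mat J s V \<Longrightarrow> analytic_mat J s W \<Longrightarrow> analytic_mat J s (\<lambda>t. V t - W t)"
  "analytic_within J s f \<Longrightarrow> analytic_mat J s W \<Longrightarrow> analytic_mat J s (\<lambda>t. smul (f t) (W t))"
  "analytic_mat J s V \<Longrightarrow> analytic_mat J s (\<lambda>t. madj (V t))"
  unfolding analytic_mat_def by auto

lemma analytic_mat_mult [intro]:
  "analytic_mat J s V \<Longrightarrow> analytic_mat J s W \<Longrightarrow> analytic_mat J s (\<lambda>t. V t ** W t)"
  unfolding analytic_mat_def matrix_matrix_mult_def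
  by (auto intro!: analytic_within_sum analytic_within_mult)

lemma analytic_within_mtrace [intro]:
  "analytic_mat J s V \<Longrightarrow> analytic_within J s (\<lambda>t. mtrace (V t))"
  unfolding analytic_mat_def mtrace_def by auto

lemma analytic_mat_cong:
  assumes "eventually (\<lambda>t. V t = W t) (nhds_within s J)" "analytic_mat J s W"
  shows "analytic_mat J s V"
  unfolding analytic_mat_def
proof (intro allI)
  fix i j
  show "analytic_within J s (\<lambda>t. V t $ i $ j)"
    by (rule analytic_within_cong[OF eventually_mono[OF assms(1)] analytic_matD[OF assms(2)]]) simp
qed

lemma analytic_mat_tendsto:
  assumes "analytic_mat J s W" "s \<in> J"
  shows "(W \<longlongrightarrow> W s) (at s within J)"
  by (intro vec_tendstoI analytic_within_tendsto[OF analytic_matD[OF assms(1)] assms(2)])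

lemma analytic_matE:
  assumes "analytic_mat J s W"
  obtains r G where "r > 0" "hol_mat (ball (of_real s) r) G"
    "\<And>t. t \<in> J \<Longrightarrow> \<bar>t - s\<bar> < r \<Longrightarrow> W t = G (of_real t)"
proof -
  have "\<forall>ij. \<exists>p. fst p > 0 \<and> snd p holomorphic_on ball (of_real s) (fst p) \<and>
      (\<forall>t\<in>J. \<bar>t - s\<bar> < fst p \<longrightarrow> W t $ fst ij $ snd ij = snd p (of_real t))"
  proof
    fix ij
    from analytic_matD[OF assms] show "\<exists>p. fst p > 0 \<and> snd p holomorphic_on ball (of_real s) (fst p) \<and>
      (\<forall>t\<in>J. \<bar>t - s\<bar> < fst p \<longrightarrow> W t $ fst ij $ snd ij = snd p (of_real t))"
      by (rule analytic_withinE) (rule exI[of _ "(_, _)"], auto)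
  qed
  then obtain p where p: "\<forall>ij. fst (p ij) > 0 \<and> snd (p ij) holomorphic_on ball (of_real s) (fst (p ij)) \<and>
      (\<forall>t\<in>J. \<bar>t - s\<bar> < fst (p ij) \<longrightarrow> W t $ fst ij $ snd ij = snd (p ij) (of_real t))"
    by (rule choice[THEN exE])
  define r where "r i j = fst (p (i, j))" for i j
  define g where "g i j = snd (p (i, j))" for i j
  have r: "\<And>i j. r i j > 0"
    and g: "\<And>i j. g i j holomorphic_on ball (of_real s) (r i j)"
    and eq: "\<And>i j t. t \<in> J \<Longrightarrow> \<bar>t - s\<bar> < r i j \<Longrightarrow> W t $ i $ j = g i j (of_real t)"
    using p unfolding r_def g_def by (metis fst_conv snd_conv)+
  define R where "R = Min (range (\<lambda>(i, j). r i j))"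
  have R: "R \<le> r i j" for i j unfolding R_def by (rule Min_le) (auto intro: image_eqI[of _ _ "(i, j)"])
  show thesis
  proof (rule that[of R "\<lambda>z. \<chi> i j. g i j z"])
    show "R > 0" unfolding R_def using r by (subst Min_gr_iff) auto
    show "hol_mat (ball (of_real s) R) (\<lambda>z. \<chi> i j. g i j z)"
      unfolding hol_mat_def using holomorphic_on_subset[OF g subset_ball[OF R]] by simp
    show "W t = (\<chi> i j. g i j (of_real t))" if "t \<in> J" "\<bar>t - s\<bar> < R" for t
    proof -
      have "W t $ i $ j = g i j (of_real t)" for i j
        using eq[OF that(1)] that(2) R[of i j] by simp
      then show ?thesis by (simp add: vec_eq_iff)
    qed
  qed
qed

lemma opn_diff_le: "opn A \<le> opn B + CARD('n) * norm (A - B :: 'n::finite cmat)"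
  using opn_add[of B "A - B"] opn_le_norm[of "A - B"] by simp

lemma opn_tendsto_less:
  fixes W :: "'a \<Rightarrow> 'n::finite cmat"
  assumes W: "(W \<longlongrightarrow> L) F" and L: "opn L < \<rho>"
  shows "eventually (\<lambda>x. opn (W x) < \<rho>) F"
proof -
  have "((\<lambda>x. opn L + CARD('n) * norm (W x - L)) \<longlongrightarrow> opn L + CARD('n) * norm (L - L)) F"
    by (intro tendsto_intros W)
  then have "eventually (\<lambda>x. opn L + CARD('n) * norm (W x - L) < \<rho>) F"
    using L by (intro order_tendstoD(2)) auto
  then show ?thesis
    by eventually_elim (use opn_diff_le le_less_trans in blast)
qed

text \<open>Strict contraction at \<open>s\<close> alone suffices: by continuity the holomorphic
  extension satisfies a uniform bound \<open>\<rho> < 1\<close> on a small complex disc.\<close>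

lemma analytic_mat_mseries:
  fixes W :: "real \<Rightarrow> 'n::finite cmat"
  assumes W: "analytic_mat J s W" and s: "s \<in> J" "opn (W s) < 1" and a: "\<And>k. cmod (a k) \<le> 1"
  shows "analytic_mat J s (\<lambda>t. mseries a (W t))"
proof -
  obtain r G where r: "r > 0" and G: "hol_mat (ball (of_real s) r) G"
    and WG: "\<And>t. t \<in> J \<Longrightarrow> \<bar>t - s\<bar> < r \<Longrightarrow> W t = G (of_real t)"
    using W by (rule analytic_matE) blast
  obtain \<rho> where \<rho>: "opn (W s) < \<rho>" "\<rho> < 1" using s(2) dense by blast
  have "G (of_real s) = W s" using WG s r by simp
  have "(G \<longlongrightarrow> G (of_real s)) (at (of_real s))"
  proof (intro vec_tendstoI)
    fix i j
    have "continuous_on (ball (of_real s) r) (\<lambda>z. G z $ i $ j)"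
      using G unfolding hol_mat_def by (blast intro: holomorphic_on_imp_continuous_on)
    then show "((\<lambda>z. G z $ i $ j) \<longlongrightarrow> G (of_real s) $ i $ j) (at (of_real s))"
      using r by (simp add: continuous_on_eq_continuous_at isCont_def)
  qed
  from opn_tendsto_less[OF this] \<rho>(1) \<open>G (of_real s) = W s\<close>
  have "eventually (\<lambda>z. opn (G z) < \<rho>) (at (of_real s))" by simp
  then obtain d where d: "d > 0" "\<And>z. z \<noteq> of_real s \<Longrightarrow> dist z (of_real s) < d \<Longrightarrow> opn (G z) < \<rho>"
    unfolding eventually_at by blast
  define R where "R = min r d"
  have le: "opn (G z) \<le> \<rho>" if "z \<in> ball (of_real s) R" for z
    using d(2)[of z] \<rho>(1) \<open>G (of_real s) = W s\<close> that
    by (cases "z = of_real s") (auto simp: R_def dist_commute)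
  have "hol_mat (ball (of_real s) R) G"
    by (rule hol_mat_subset[OF G]) (simp add: R_def subset_ball)
  from hol_mat_mseries[OF open_ball this le \<rho>(2) a]
  have hol: "hol_mat (ball (of_real s) R) (\<lambda>z. mseries a (G z))" by simp
  show ?thesis
    unfolding analytic_mat_def
  proof (intro allI)
    fix i j
    show "analytic_within J s (\<lambda>t. mseries a (W t) $ i $ j)"
      by (rule analytic_withinI[of R "\<lambda>z. mseries a (G z) $ i $ j"])
        (use hol r d(1) in \<open>auto simp: hol_mat_def R_def WG\<close>)
  qed
qed

section \<open>Power series as functions of a positive matrix\<close>

lemma mpow_diag:
  assumes "unitary U"
  shows "mpow (U ** diagm d ** madj U) k = U ** diagm (\<lambda>i. d i ^ k) ** madj U"
proof (induction k)
  case 0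
  show ?case using assms by (simp add: unitary_mult)
next
  case (Suc k)
  have "mpow (U ** diagm d ** madj U) (Suc k) = U ** (diagm d ** (madj U ** U) ** diagm (\<lambda>i. d i ^ k)) ** madj U"
    by (simp add: Suc matrix_mul_assoc)
  then show ?case by (simp add: unitary_mult[OF assms])
qed

lemma diag_entry: "(U ** diagm d ** madj U) $ i $ j = (\<Sum>l\<in>UNIV. U $ i $ l * d l * cnj (U $ j $ l))"
  by (simp add: matrix_matrix_mult_def[of "U ** diagm d"] diagm_mult)

lemma mseries_diag:
  assumes U: "unitary U" and f: "\<And>l. (\<lambda>k. a k * d l ^ k) sums f l"
  shows "mseries a (U ** diagm d ** madj U) = U ** diagm f ** madj U"
proof -
  have "(\<lambda>k. a k * mpow (U ** diagm d ** madj U) k $ i $ j) sums (U ** diagm f ** madj U) $ i $ j" for i j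
  proof -
    have "(\<lambda>k. \<Sum>l\<in>UNIV. U $ i $ l * (a k * d l ^ k) * cnj (U $ j $ l)) sums
        (\<Sum>l\<in>UNIV. U $ i $ l * f l * cnj (U $ j $ l))"
      by (intro sums_sum sums_mult sums_mult2 f)
    then show ?thesis
      unfolding mpow_diag[OF U] diag_entry by (simp add: sum_distrib_left mult_ac)
  qed
  then show ?thesis by (simp add: vec_eq_iff mseries_def sums_iff)
qed

lemma diag_le_opn:
  assumes "unitary U" "A = U ** diagm d ** madj U"
  shows "cmod (d i) \<le> opn A"
proof -
  have "opn V \<le> 1" if "unitary V" for V :: "'a cmat"
    by (rule opn_leI) (simp add: norm_unitary[OF that])
  then have UU: "opn U \<le> 1" "opn (madj U) \<le> 1" using assms(1) unitary_madj by blast+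
  have "diagm d = madj U ** (A ** U)"
    unfolding assms(2) by (simp add: matrix_mul_assoc unitary_mult[OF assms(1)] unitary_cancel[OF assms(1)])
  then have "d i = (madj U ** (A ** U)) $ i $ i" by (subst (asm) eq_commute) (simp add: diagm_def)
  then have "cmod (d i) \<le> opn (madj U ** (A ** U))" by (simp only: opn_entry)
  also have "\<dots> \<le> opn (madj U) * opn (A ** U)" by (rule opn_mult)
  also have "\<dots> \<le> 1 * (opn A * opn U)"
    using UU opn_mult[of A U] opn_nonneg by (intro mult_mono) auto
  also have "\<dots> \<le> opn A"
    using UU opn_nonneg[of A] by (simp add: mult_left_le)
  finally show ?thesis .
qed

lemma one_minus_smul_diag:
  assumes "unitary U"
  shows "mat 1 - smul z (U ** diagm d ** madj U) = U ** diagm (\<lambda>i. 1 - z * d i) ** madj U"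
proof -
  have "diagm (\<lambda>i. 1 - z * d i) = mat 1 - smul z (diagm d)"
    by (simp add: vec_eq_iff diagm_def mat_def)
  then show ?thesis
    by (simp only: matrix_mul_diff_ldistrib matrix_mul_diff_rdistrib smul_mult matrix_mul_rid unitary_mult[OF assms])
qed

text \<open>Substituting \<open>W = 1 - C / K\<close> with \<open>K\<close> above the spectrum turns functions of a positive
  matrix into power series in a strict contraction.\<close>

lemma mseries_hfun:
  assumes C: "C \<in> metrics" and K: "K > 0" "opn (mat 1 - smul (of_real (1 / K)) C) < 1"
    and f: "\<And>x. 0 < x \<Longrightarrow> \<bar>1 - x / K\<bar> < 1 \<Longrightarrow> (\<lambda>k. a k * of_real (1 - x / K) ^ k) sums g x"
    and fg: "\<And>x. 0 < x \<Longrightarrow> f x = \<alpha> + \<beta> * g x"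
  shows "hfun f C = smul \<alpha> (mat 1) + smul \<beta> (mseries a (mat 1 - smul (of_real (1 / K)) C))"
proof -
  obtain U d where U: "unitary U" "C = U ** diagm (\<lambda>i. complex_of_real (d i)) ** madj U"
    and d: "\<And>i. d i > 0"
    using metrics_diagonalize[OF C] by blast
  have one: "mat 1 = U ** diagm (\<lambda>_. 1) ** madj U" using U(1) by (simp add: unitary_mult)
  have W: "mat 1 - smul (of_real (1 / K)) C = U ** diagm (\<lambda>i. complex_of_real (1 - d i / K)) ** madj U"
    unfolding U(2) using one_minus_smul_diag[OF U(1)] by simp
  have "\<bar>1 - d i / K\<bar> < 1" for i
    using diag_le_opn[OF U(1) W, of i] K(2) by (simp only: norm_of_real)
  then have "(\<lambda>k. a k * of_real (1 - d i / K) ^ k) sums g (d i)" for i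
    using d f by simp
  from mseries_diag[OF U(1) this]
  have "mseries a (mat 1 - smul (of_real (1 / K)) C) = U ** diagm (\<lambda>i. g (d i)) ** madj U"
    unfolding W by simp
  moreover have "diagm (\<lambda>i. f (d i)) = smul \<alpha> (diagm (\<lambda>_. 1)) + smul \<beta> (diagm (\<lambda>i. g (d i)))"
    unfolding diagm_simps(4,6) using fg d by simp
  ultimately show ?thesis
    unfolding hfun_eq[OF U] one by (simp add: matrix_add_ldistrib matrix_mul_add_rdistrib del: diagm_simps(4,6))
qed

text \<open>The eigenvalues of \<open>C\<close> lie between the smallest one, \<open>m > 0\<close>,
  and \<open>K = opn C + 1\<close>, so those of \<open>1 - C / K\<close> lie between 0 and
  \<open>1 - m / K\<close>. The added 1 makes \<open>K\<close> positive and strictly larger than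
  every eigenvalue.\<close>

lemma opn_one_minus_metric:
  assumes "C \<in> metrics"
  shows "opn (mat 1 - smul (of_real (1 / (opn C + 1))) C) < 1"
proof -
  define K where "K = opn C + 1"
  have K: "K > 0" using opn_nonneg[of C] by (simp add: K_def)
  obtain U d where U: "unitary U" "C = U ** diagm (\<lambda>i. complex_of_real (d i)) ** madj U"
    and d: "\<And>i. d i > 0"
    using metrics_diagonalize[OF assms] by blast
  have W: "mat 1 - smul (of_real (1 / K)) C = U ** diagm (\<lambda>i. complex_of_real (1 - d i / K)) ** madj U"
    unfolding U(2) using one_minus_smul_diag[OF U(1)] by simp
  define m where "m = Min (range d)"
  have m: "m > 0" "\<And>i. m \<le> d i" unfolding m_def using d by (auto simp: Min_gr_iff)
  have dK: "d i < K" for i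
    using diag_le_opn[OF U, of i] by (simp add: K_def)
  have "cmod (complex_of_real (1 - d i / K)) \<le> 1 - m / K" for i
    unfolding norm_of_real using m(2)[of i] dK[of i] K by (simp add: field_simps abs_le_iff)
  moreover have "0 \<le> 1 - m / K" using m(2)[of undefined] dK[of undefined] K by simp
  ultimately have "opn (mat 1 - smul (of_real (1 / K)) C) \<le> 1 - m / K"
    unfolding W by (intro opn_diag_le U(1)) auto
  also have "\<dots> < 1" using m(1) K by simp
  finally show ?thesis by (simp add: K_def)
qed

section \<open>The inverse square root\<close>

lemma gbinomial_minus_half_bound: "\<bar>(-1/2 :: real) gchoose k\<bar> \<le> 1"
proof (induction k)
  case (Suc k)
  \<comment> \<open>Passing from \<open>k\<close> to \<open>Suc k\<close> multiplies the coefficient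
    by a factor of modulus (k + 1/2) / (k + 1) < 1.\<close>
  have "of_nat (Suc k) * ((-1/2 :: real) gchoose (Suc k)) = (-1/2 - of_nat k) * ((-1/2) gchoose k)"
    using gbinomial_mult_1[of "-1/2 :: real" k] by (simp add: algebra_simps)
  then have "\<bar>of_nat (Suc k) * ((-1/2 :: real) gchoose (Suc k))\<bar> = (1/2 + of_nat k) * \<bar>(-1/2) gchoose k\<bar>"
    by (simp add: abs_mult)
  also have "\<dots> \<le> (1/2 + of_nat k) * 1" using Suc by (intro mult_left_mono) auto
  also have "\<dots> \<le> of_nat (Suc k)" by simp
  finally have "of_nat (Suc k) * \<bar>(-1/2 :: real) gchoose (Suc k)\<bar> \<le> of_nat (Suc k) * 1"
    by (simp add: abs_mult)
  then show ?case by (subst (asm) mult_le_cancel_left_pos) auto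
qed simp

lemma diag_metrics:
  assumes U: "unitary U" "A = U ** diagm (\<lambda>i. complex_of_real (d i)) ** madj U" and d: "\<And>i. d i > 0"
  shows "A \<in> metrics"
  unfolding metrics_def
proof (intro CollectI conjI allI impI)
  show "hermitian A" unfolding hermitian_def U(2) by (simp add: matrix_mul_assoc)
  fix \<mu> assume "is_eigenvalue A \<mu>"
  then obtain w where w: "w \<noteq> 0" "A *v w = \<mu> *s w" unfolding is_eigenvalue_def by blast
  define v where "v = madj U *v w"
  have "U *v v = w" by (simp add: v_def matrix_vector_mul_assoc unitary_mult U(1))
  then have "v \<noteq> 0" using w(1) by (metis matrix_vector_mult_0_right)
  then obtain i where i: "v $ i \<noteq> 0" by (auto simp: vec_eq_iff)
  have "diagm (\<lambda>i. complex_of_real (d i)) *v v = madj U *v (A *v w)"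
    unfolding U(2) v_def by (simp add: matrix_vector_mul_assoc matrix_mul_assoc unitary_mult U(1))
  also have "\<dots> = \<mu> *s v" by (simp add: w(2) v_def matrix_vector_mult_smult)
  finally have "of_real (d i) * v $ i = \<mu> * v $ i"
    by (metis diagm_vector_mult vector_smult_component)
  then show "\<exists>r>0. \<mu> = complex_of_real r" using i d[of i] by auto
qed

definition minv_sqrt :: "'n::finite cmat \<Rightarrow> 'n cmat" where
  "minv_sqrt C = hfun (\<lambda>x. of_real (x powr (-1/2))) C"

lemma analytic_mat_minv_sqrt:
  fixes C :: "real \<Rightarrow> 'n::finite cmat"
  assumes C: "analytic_mat J s C" and s: "s \<in> J" and pos: "eventually (\<lambda>t. C t \<in> metrics) (nhds_within s J)"
  shows "analytic_mat J s (\<lambda>t. minv_sqrt (C t))"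
proof -
  \<comment> \<open>Taken from \<open>C s\<close> and kept fixed, so that one and the same power
    series represents the inverse square root for all \<open>t\<close> near
    \<open>s\<close>.\<close>
  define K where "K = opn (C s) + 1"
  have K: "K > 0" using opn_nonneg[of "C s"] by (simp add: K_def)
  define W where "W t = mat 1 - smul (of_real (1 / K)) (C t)" for t
  \<comment> \<open>The binomial series expands (1 + z)^(-1/2) at \<open>z = - (1 - x / K)\<close>;
    the powers of -1 turn it into a series in \<open>1 - x / K\<close>.\<close>
  define a where "a k = complex_of_real (((-1/2) gchoose k) * (-1) ^ k)" for k
  have a: "cmod (a k) \<le> 1" for k
    unfolding a_def norm_of_real using gbinomial_minus_half_bound[of k] by (simp add: abs_mult)
  have W: "analytic_mat J s W" unfolding W_def by (intro analytic_mat_simps C) auto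
  have Ws: "opn (W s) < 1"
    unfolding W_def K_def using opn_one_minus_metric eventually_nhds_within_self[OF pos s] by blast
  have ev: "eventually (\<lambda>t. opn (W t) < 1) (nhds_within s J)"
    unfolding eventually_nhds_within_iff using opn_tendsto_less[OF analytic_mat_tendsto[OF W s] Ws] Ws by simp
  define \<beta> where "\<beta> = complex_of_real (K powr (-1/2))"
  have "analytic_mat J s (\<lambda>t. smul 0 (mat 1) + smul \<beta> (mseries a (W t)))"
    by (intro analytic_mat_simps analytic_mat_mseries[OF W s Ws a]) auto
  moreover have "eventually (\<lambda>t. minv_sqrt (C t) = smul 0 (mat 1) + smul \<beta> (mseries a (W t))) (nhds_within s J)"
    using pos ev
  proof eventually_elim
    case (elim t)
    show ?case unfolding minv_sqrt_def W_def
    proof (rule mseries_hfun[OF elim(1) K])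
      show "opn (mat 1 - smul (of_real (1 / K)) (C t)) < 1" using elim(2) by (simp add: W_def)
      show "(\<lambda>k. a k * of_real (1 - x / K) ^ k) sums of_real ((x / K) powr (-1/2))"
        if "0 < x" "\<bar>1 - x / K\<bar> < 1" for x
      proof -
        have "(\<lambda>k. ((-1/2) gchoose k) * (- (1 - x / K)) ^ k) sums (1 + (- (1 - x / K))) powr (-1/2)"
          by (rule gen_binomial_real) (use that in simp)
        then have "(\<lambda>k. ((-1/2) gchoose k) * (-1) ^ k * (1 - x / K) ^ k) sums (x / K) powr (-1/2)"
          by (simp only: power_minus[of "1 - x / K"] mult.assoc) simp
        then show ?thesis
          unfolding a_def of_real_power[symmetric] of_real_mult[symmetric] sums_of_real_iff .
      qed
      show "complex_of_real (x powr (-1/2)) = 0 + \<beta> * of_real ((x / K) powr (-1/2))" if "0 < x" for x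
      proof -
        have "x powr (-1/2) = K powr (-1/2) * (x / K) powr (-1/2)"
          using that K by (simp add: powr_mult[symmetric])
        then show ?thesis unfolding \<beta>_def by simp
      qed
    qed
  qed
  ultimately show ?thesis by (rule analytic_mat_cong[rotated])
qed

lemma minv_sqrt_props:
  assumes "C \<in> metrics"
  shows "hermitian (minv_sqrt C)" "minv_sqrt C ** minv_sqrt C ** C = mat 1"
    "minv_sqrt C ** C = C ** minv_sqrt C" "minv_sqrt C \<in> metrics"
proof -
  obtain U d where U: "unitary U" "C = U ** diagm (\<lambda>i. complex_of_real (d i)) ** madj U"
    and d: "\<And>i. d i > 0"
    using metrics_diagonalize[OF assms] by blast
  let ?d = "\<lambda>i. complex_of_real (d i powr (-1/2))"
  have D: "minv_sqrt C = U ** diagm ?d ** madj U"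
    unfolding minv_sqrt_def by (rule hfun_eq[OF U])
  show h: "hermitian (minv_sqrt C)"
    unfolding hermitian_def D by (simp add: matrix_mul_assoc)
  have "hermitian C" using assms by (simp add: metrics_def)
  then show "minv_sqrt C ** C = C ** minv_sqrt C"
    unfolding minv_sqrt_def by (intro hfun_commute[symmetric]) auto
  have "minv_sqrt C ** minv_sqrt C ** C =
      U ** (diagm ?d ** (madj U ** U) ** diagm ?d ** (madj U ** U) ** diagm (\<lambda>i. complex_of_real (d i))) ** madj U"
    unfolding D by (subst U(2)) (simp add: matrix_mul_assoc)
  also have "\<dots> = U ** diagm (\<lambda>i. ?d i * ?d i * of_real (d i)) ** madj U"
    by (simp add: unitary_mult[OF U(1)])
  also have "(\<lambda>i. ?d i * ?d i * of_real (d i)) = (\<lambda>_. 1)"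
  proof
    fix i
    have "d i powr (-1/2) * d i powr (-1/2) * d i = 1"
      using d[of i] by (simp only: powr_add[symmetric]) (simp add: powr_neg_one less_imp_neq[symmetric])
    then show "?d i * ?d i * of_real (d i) = 1" by (metis of_real_1 of_real_mult)
  qed
  finally show "minv_sqrt C ** minv_sqrt C ** C = mat 1" by (simp add: unitary_mult[OF U(1)])
  show "minv_sqrt C \<in> metrics"
    by (rule diag_metrics[OF U(1) D]) (simp add: d[THEN less_imp_neq, THEN not_sym])
qed

section \<open>Analyticity of the Ricci flow\<close>

text \<open>A box for the entries instead of a ball, because the Picard estimates apply scalar mean
  value inequalities to one entry at a time.\<close>

definition mbox :: "'n::finite cmat \<Rightarrow> real \<Rightarrow> 'n cmat set" where
  "mbox w \<delta> = {v. \<forall>i j. cmod ((v - w) $ i $ j) \<le> \<delta>}"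

text \<open>Picard iteration in a complex disc around \<open>s\<close>: the iterates are holomorphic and converge
  uniformly, and on the real points of the disc they converge to the given solution.\<close>

lemma analytic_mat_ode_solution:
  fixes f :: "real \<Rightarrow> 'n::finite cmat" and \<Phi> :: "'n cmat \<Rightarrow> 'n cmat"
  assumes J: "convex J" "s \<in> J" and \<delta>: "\<delta> > 0"
    and hol: "\<And>S W. open S \<Longrightarrow> hol_mat S W \<Longrightarrow> (\<And>z. z \<in> S \<Longrightarrow> W z \<in> mbox (f s) \<delta>) \<Longrightarrow> hol_mat S (\<lambda>z. \<Phi> (W z))"
    and bound: "\<And>w i j. w \<in> mbox (f s) \<delta> \<Longrightarrow> cmod (\<Phi> w $ i $ j) \<le> M"
    and lip: "\<And>v w i j \<epsilon>. v \<in> mbox (f s) \<delta> \<Longrightarrow> w \<in> mbox (f s) \<delta> \<Longrightarrow> v \<in> mbox w \<epsilon> \<Longrightarrow>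
        cmod ((\<Phi> v - \<Phi> w) $ i $ j) \<le> L * \<epsilon>"
    and f: "eventually (\<lambda>t. (f has_vector_derivative \<Phi> (f t)) (at t within J)) (nhds_within s J)"
  shows "analytic_mat J s f"
proof -
  have "eventually (\<lambda>t. f t \<in> mbox (f s) \<delta>) (nhds_within s J)"
  proof -
    have "(f has_vector_derivative \<Phi> (f s)) (at s within J)"
      using eventually_nhds_within_self[OF f J(2)] .
    then have "(f \<longlongrightarrow> f s) (at s within J)"
      using has_vector_derivative_continuous continuous_within by blast
    then have "eventually (\<lambda>t. dist (f t) (f s) < \<delta>) (at s within J)"
      using \<delta> by (rule tendstoD)
    then have "eventually (\<lambda>t. f t \<in> mbox (f s) \<delta>) (at s within J)"
    proof eventually_elim
      case (elim t)
      have "cmod ((f t - f s) $ i $ j) \<le> \<delta>" for i j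
        using Finite_Cartesian_Product.norm_nth_le[of "(f t - f s) $ i" j] elim
          Finite_Cartesian_Product.norm_nth_le[of "f t - f s" i] unfolding dist_norm by linarith
      then show ?case by (simp add: mbox_def)
    qed
    then show ?thesis using \<delta> by (simp add: eventually_nhds_within_iff mbox_def)
  qed
  with f have "eventually (\<lambda>t. (f has_vector_derivative \<Phi> (f t)) (at t within J) \<and> f t \<in> mbox (f s) \<delta>) (nhds_within s J)"
    by (rule eventually_conj)
  then obtain r0 where r0: "r0 > 0"
    and r0f: "\<And>t. t \<in> J \<Longrightarrow> \<bar>t - s\<bar> < r0 \<Longrightarrow> (f has_vector_derivative \<Phi> (f t)) (at t within J)"
    and r0b: "\<And>t. t \<in> J \<Longrightarrow> \<bar>t - s\<bar> < r0 \<Longrightarrow> f t \<in> mbox (f s) \<delta>"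
    unfolding eventually_nhds_within by blast
  \<comment> \<open>The maxima with 1 make both constants positive, so that they can be divided
    by.\<close>
  define M' where "M' = max M 1"
  define L' where "L' = max L 1"
  \<comment> \<open>Below \<open>r0\<close> the solution stays in the box,
    \<open>\<delta> / M'\<close> keeps the iterates in the box, and \<open>1 / (2 * L')\<close>
    makes each Picard step halve distances.\<close>
  define r where "r = min r0 (min (\<delta> / M') (1 / (2 * L')))"
  have M': "M' \<ge> 1" "M' \<ge> M" and L': "L' \<ge> 1" "L' \<ge> L" by (auto simp: M'_def L'_def)
  have r: "r > 0" "r \<le> r0" "M' * r \<le> \<delta>" "L' * r \<le> 1 / 2"
  proof -
    show "r > 0" using r0 \<delta> M' L' by (simp add: r_def)
    have "r \<le> \<delta> / M'" "r \<le> 1 / (2 * L')" by (simp_all add: r_def)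
    then show "M' * r \<le> \<delta>" "L' * r \<le> 1 / 2" using M' L' by (simp_all add: field_simps)
  qed (simp add: r_def)
  define z0 where "z0 = complex_of_real s"
  define B where "B = ball z0 r"
  have B: "open B" "convex B" "z0 \<in> B" using r by (simp_all add: B_def)
  have dist_B: "cmod (z - z0) \<le> r" if "z \<in> B" for z
    using that by (simp add: B_def dist_norm norm_minus_commute less_imp_le)
  \<comment> \<open>The integral from \<open>z0\<close>: on a convex disc every holomorphic function
    has a primitive, here normalised to vanish at \<open>z0\<close>.\<close>
  define prim where "prim g = (SOME h. (\<forall>z\<in>B. (h has_field_derivative g z) (at z)) \<and> h z0 = 0)"
    for g :: "complex \<Rightarrow> complex"
  have prim: "(prim g has_field_derivative g z) (at z)" "prim g z0 = 0"
    if g: "g holomorphic_on B" and "z \<in> B" for g z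
  proof -
    obtain h where h: "\<And>z. z \<in> B \<Longrightarrow> (h has_field_derivative g z) (at z within B)"
      using holomorphic_convex_primitive'[OF B(2,1) g] by blast
    have "\<forall>z\<in>B. ((\<lambda>z. h z - h z0) has_field_derivative g z) (at z)"
      using h B(1) by (auto intro!: derivative_eq_intros simp: at_within_open[OF _ B(1)])
    then have "\<exists>h. (\<forall>z\<in>B. (h has_field_derivative g z) (at z)) \<and> h z0 = 0"
      by (intro exI[of _ "\<lambda>z. h z - h z0"]) simp
    from someI_ex[OF this] show "(prim g has_field_derivative g z) (at z)" "prim g z0 = 0"
      using \<open>z \<in> B\<close> unfolding prim_def by blast+
  qed
  define T where "T W z = f s + (\<chi> i j. prim (\<lambda>z. \<Phi> (W z) $ i $ j) z)" for W z
  define X where "X n = (T ^^ n) (\<lambda>_. f s)" for n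
  have X0: "X 0 = (\<lambda>_. f s)" and XS: "X (Suc n) = T (X n)" for n
    by (simp_all add: X_def)
  have TI: "hol_mat B (T W) \<and> (\<forall>z\<in>B. T W z \<in> mbox (f s) \<delta>) \<and> T W z0 = f s"
      and TD: "\<And>z i j. z \<in> B \<Longrightarrow> ((\<lambda>z. T W z $ i $ j) has_field_derivative \<Phi> (W z) $ i $ j) (at z)"
    if W: "hol_mat B W" "\<forall>z\<in>B. W z \<in> mbox (f s) \<delta>" for W
  proof -
    have h: "(\<lambda>z. \<Phi> (W z) $ i $ j) holomorphic_on B" for i j
      using hol[OF B(1) W(1)] W(2) unfolding hol_mat_def by blast
    show TD: "((\<lambda>z. T W z $ i $ j) has_field_derivative \<Phi> (W z) $ i $ j) (at z)" if "z \<in> B" for z i j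
      unfolding T_def using prim(1)[OF h that] by (auto intro!: derivative_eq_intros)
    have 0: "T W z0 = f s" by (simp add: T_def vec_eq_iff prim(2)[OF h B(3)])
    have "cmod ((T W z - f s) $ i $ j) \<le> \<delta>" if "z \<in> B" for z i j
    proof -
      have "cmod (T W z $ i $ j - T W z0 $ i $ j) \<le> M' * cmod (z - z0)"
      proof (rule field_differentiable_bound[OF B(2)])
        show "((\<lambda>z. T W z $ i $ j) has_field_derivative \<Phi> (W z) $ i $ j) (at z within B)" if "z \<in> B" for z
          using TD[OF that] has_field_derivative_at_within by blast
        show "cmod (\<Phi> (W z) $ i $ j) \<le> M'" if "z \<in> B" for z
          using bound[of "W z" i j] W(2) that M'(2) by force
      qed (use B that in auto)
      also have "\<dots> \<le> M' * r" using dist_B[OF that] M' by (intro mult_left_mono) auto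
      finally show ?thesis using r(3) 0 by simp
    qed
    moreover have "hol_mat B (T W)"
      unfolding hol_mat_def holomorphic_on_open[OF B(1)] using TD by blast
    ultimately show "hol_mat B (T W) \<and> (\<forall>z\<in>B. T W z \<in> mbox (f s) \<delta>) \<and> T W z0 = f s"
      using 0 by (simp add: mbox_def)
  qed
  have XI: "hol_mat B (X n) \<and> (\<forall>z\<in>B. X n z \<in> mbox (f s) \<delta>) \<and> X n z0 = f s" for n
  proof (induction n)
    case 0
    show ?case using \<delta> by (simp add: X0 hol_mat_simps mbox_def)
  next
    case (Suc n)
    then show ?case using TI[of "X n"] by (simp add: XS)
  qed
  have XD: "((\<lambda>z. X (Suc n) z $ i $ j) has_field_derivative \<Phi> (X n z) $ i $ j) (at z)" if "z \<in> B" for n z i j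
    using TD[of "X n"] XI[of n] that by (simp add: XS)
  have half: "L * \<epsilon> * r' \<le> \<epsilon> / 2" if "\<epsilon> \<ge> 0" "0 \<le> r'" "r' \<le> r" for \<epsilon> r'
  proof -
    have "L * \<epsilon> * r' \<le> L' * \<epsilon> * r'" using L'(2) that by (intro mult_right_mono) auto
    also have "\<dots> \<le> L' * \<epsilon> * r" using L'(1) that by (intro mult_left_mono) auto
    also have "\<dots> = (L' * r) * \<epsilon>" by simp
    also have "\<dots> \<le> 1 / 2 * \<epsilon>" using r(4) that(1) by (rule mult_right_mono)
    finally show ?thesis by simp
  qed
  have Xstep: "X (Suc n) z \<in> mbox (X n z) (\<delta> * (1 / 2) ^ n)" if "z \<in> B" for n z
    using that
  proof (induction n arbitrary: z)
    case 0
    then show ?case using XI[of 1] by (simp add: X0)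
  next
    case (Suc n)
    let ?\<epsilon> = "\<delta> * (1 / 2) ^ n"
    have "cmod ((X (Suc (Suc n)) z - X (Suc n) z) $ i $ j) \<le> \<delta> * (1 / 2) ^ Suc n" for i j
    proof -
      let ?D = "\<lambda>z. X (Suc (Suc n)) z $ i $ j - X (Suc n) z $ i $ j"
      have "cmod (?D z - ?D z0) \<le> (L * ?\<epsilon>) * cmod (z - z0)"
      proof (rule field_differentiable_bound[OF B(2)])
        show "(?D has_field_derivative (\<Phi> (X (Suc n) z) $ i $ j - \<Phi> (X n z) $ i $ j)) (at z within B)" if "z \<in> B" for z
          by (rule DERIV_diff[OF XD XD, THEN has_field_derivative_at_within]) (fact that)+
        show "cmod (\<Phi> (X (Suc n) z) $ i $ j - \<Phi> (X n z) $ i $ j) \<le> L * ?\<epsilon>" if "z \<in> B" for z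
          using lip[of "X (Suc n) z" "X n z" ?\<epsilon> i j] XI that Suc.IH[OF that] by simp
      qed (use B Suc.prems in auto)
      also have "\<dots> \<le> ?\<epsilon> / 2"
        by (rule half) (use \<delta> dist_B[OF Suc.prems] in auto)
      finally show ?thesis using XI by simp
    qed
    then show ?case by (simp add: mbox_def)
  qed
  \<comment> \<open>The given solution is known at real times only, so it is compared with the
    iterates along the real segment from \<open>s\<close> to \<open>t\<close>, which lies in
    \<open>J\<close> by convexity.\<close>
  have Xf: "X n (of_real t) \<in> mbox (f t) (\<delta> * (1 / 2) ^ n)" if "t \<in> J" "\<bar>t - s\<bar> < r" for n t
    using that
  proof (induction n arbitrary: t)
    case 0
    have "f t \<in> mbox (f s) \<delta>" using r0b 0 r(2) by simp
    then show ?case by (simp add: X0 mbox_def norm_minus_commute)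
  next
    case (Suc n)
    let ?\<epsilon> = "\<delta> * (1 / 2) ^ n"
    let ?I = "J \<inter> ball s r"
    have I: "convex ?I" using J(1) by (simp add: convex_Int)
    have tI: "x \<in> ?I \<Longrightarrow> x \<in> J \<and> \<bar>x - s\<bar> < r \<and> of_real x \<in> B" for x
      by (auto simp: B_def z0_def dist_norm abs_minus_commute simp flip: of_real_diff)
    have sI: "s \<in> ?I" "t \<in> ?I" using J(2) r Suc.prems by (auto simp: dist_real_def)
    have "cmod ((X (Suc n) (of_real t) - f t) $ i $ j) \<le> \<delta> * (1 / 2) ^ Suc n" for i j
    proof -
      let ?D = "\<lambda>t. X (Suc n) (of_real t) $ i $ j - f t $ i $ j"
      let ?D' = "\<lambda>t. \<Phi> (X n (of_real t)) $ i $ j - \<Phi> (f t) $ i $ j"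
      \<comment> \<open>All iterates share the value of \<open>f\<close> at \<open>s\<close>, so the
        linear term of the mean value estimate drops out.\<close>
      have "?D' s = 0" using XI[of n] by (simp add: z0_def)
      have "norm (?D t - ?D s - (t - s) *\<^sub>R ?D' s) \<le> norm (t - s) * (L * ?\<epsilon>)"
      proof (rule vector_differentiable_bound_linearization[where S = ?I])
        show "(?D has_vector_derivative ?D' x) (at x within ?I)" if "x \<in> ?I" for x
        proof (rule has_vector_derivative_diff)
          show "((\<lambda>t. X (Suc n) (of_real t) $ i $ j) has_vector_derivative \<Phi> (X n (of_real x)) $ i $ j) (at x within ?I)"
            using XD tI[OF that] by (intro has_vector_derivative_real_field) auto
          have "(f has_vector_derivative \<Phi> (f x)) (at x within ?I)"
            using r0f[of x] tI[OF that] r(2) has_vector_derivative_within_subset[of f _ x J ?I] by auto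
          from bounded_linear.has_vector_derivative[OF bounded_linear_vec_nth bounded_linear.has_vector_derivative[OF bounded_linear_vec_nth this]]
          show "((\<lambda>t. f t $ i $ j) has_vector_derivative \<Phi> (f x) $ i $ j) (at x within ?I)" .
        qed
        show "closed_segment s t \<subseteq> ?I" using closed_segment_subset[OF sI I] .
        show "norm (?D' x - ?D' s) \<le> L * ?\<epsilon>" if "x \<in> ?I" for x
          unfolding \<open>?D' s = 0\<close>
          using lip[of "X n (of_real x)" "f x" ?\<epsilon> i j] XI[of n] tI[OF that] Suc.IH[of x] r0b[of x] r(2) by auto
      qed (use sI in auto)
      also have "norm (t - s) * (L * ?\<epsilon>) = L * ?\<epsilon> * \<bar>t - s\<bar>" by simp
      also have "\<dots> \<le> ?\<epsilon> / 2" by (rule half) (use \<delta> Suc.prems in auto)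
      finally show ?thesis using XI[of "Suc n"] \<open>?D' s = 0\<close> by (simp add: z0_def)
    qed
    then show ?case by (simp add: mbox_def)
  qed
  show ?thesis
    unfolding analytic_mat_def
  proof (intro allI)
    fix i j
    let ?d = "\<lambda>n z. X (Suc n) z $ i $ j - X n z $ i $ j"
    \<comment> \<open>The limit of the iterates, written as a telescoping series so that the
      geometric bound on successive differences gives uniform convergence.\<close>
    define g where "g z = f s $ i $ j + (\<Sum>n. ?d n z)" for z
    have "uniform_limit B (\<lambda>n z. \<Sum>k<n. ?d k z) (\<lambda>z. \<Sum>n. ?d n z) sequentially"
    proof (rule Weierstrass_m_test)
      show "cmod (?d n z) \<le> \<delta> * (1 / 2) ^ n" if "z \<in> B" for n z
        using Xstep[OF that, of n] by (simp add: mbox_def)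
      show "summable (\<lambda>n. \<delta> * (1 / 2) ^ n)" by (intro summable_mult summable_geometric) simp
    qed
    then have "uniform_limit B (\<lambda>n z. f s $ i $ j + (\<Sum>k<n. ?d k z)) g sequentially"
      unfolding g_def by (intro uniform_limit_add uniform_limit_const)
    moreover have "(\<lambda>n z. f s $ i $ j + (\<Sum>k<n. ?d k z)) = (\<lambda>n z. X n z $ i $ j)"
      using sum_lessThan_telescope[of "\<lambda>k. X k z $ i $ j" for z] by (simp add: fun_eq_iff X0)
    ultimately have lim: "uniform_limit B (\<lambda>n z. X n z $ i $ j) g sequentially" by simp
    have "g holomorphic_on B"
    proof (rule holomorphic_uniform_sequence[OF B(1)])
      show "(\<lambda>z. X n z $ i $ j) holomorphic_on B" for n using XI[of n] by (simp add: hol_mat_def)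
      show "\<exists>d>0. cball z d \<subseteq> B \<and> uniform_limit (cball z d) (\<lambda>n z. X n z $ i $ j) g sequentially" if "z \<in> B" for z
      proof -
        obtain d where "d > 0" "cball z d \<subseteq> B" using open_contains_cball_eq[OF B(1)] \<open>z \<in> B\<close> by blast
        then show ?thesis using uniform_limit_on_subset[OF lim] by blast
      qed
    qed
    then show "analytic_within J s (\<lambda>t. f t $ i $ j)"
      unfolding B_def z0_def
    proof (rule analytic_withinI[OF r(1)])
      fix t assume t: "t \<in> J" "\<bar>t - s\<bar> < r"
      have "of_real t \<in> B"
        using t by (simp add: B_def z0_def dist_norm abs_minus_commute flip: of_real_diff)
      from tendsto_uniform_limitI[OF lim this]
      have "(\<lambda>n. X n (of_real t) $ i $ j) \<longlonglongrightarrow> g (of_real t)" .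
      moreover have "(\<lambda>n. X n (of_real t) $ i $ j) \<longlonglongrightarrow> f t $ i $ j"
      proof (rule Lim_null_comparison[THEN LIM_zero_cancel])
        show "eventually (\<lambda>n. norm (X n (of_real t) $ i $ j - f t $ i $ j) \<le> \<delta> * (1 / 2) ^ n) sequentially"
          using Xf[OF t] by (simp add: mbox_def)
        show "(\<lambda>n. \<delta> * (1 / 2) ^ n) \<longlonglongrightarrow> 0"
          by (intro tendsto_mult_right_zero LIMSEQ_power_zero) simp
      qed
      ultimately show "f t $ i $ j = g (of_real t)" using LIMSEQ_unique by blast
    qed
  qed
qed

section \<open>The flow as an equation with holomorphic vector field\<close>

lemma mbox_opn:
  fixes v w :: "'n::finite cmat"
  assumes "v \<in> mbox w \<epsilon>"
  shows "opn (v - w) \<le> of_nat CARD('n) ^ 3 * \<epsilon>"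
proof -
  have "opn (v - w) \<le> CARD('n) * norm (v - w)" by (rule opn_le_norm)
  also have "\<dots> \<le> CARD('n) * (\<Sum>i\<in>(UNIV::'n set). \<Sum>j\<in>(UNIV::'n set). \<epsilon>)"
    using assms unfolding mbox_def
    by (intro mult_left_mono order_trans[OF norm_le_entries] sum_mono) auto
  finally show ?thesis by (simp add: power3_eq_cube mult.assoc)
qed

text \<open>That the identity lies in the kernel of \<open>lap\<close> is what later removes the
  constant \<open>ln K\<close> from the logarithm.\<close>

lemma lap_simps:
  "lap x y (A + B) = lap x y A + lap x y B" "lap x y (A - B) = lap x y A - lap x y B"
  "lap x y (smul z A) = smul z (lap x y A)" "lap x y (mat 1) = 0"
  by (simp_all add: lap_def comm_def matrix_add_ldistrib matrix_mul_add_rdistrib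
      matrix_mul_diff_ldistrib matrix_mul_diff_rdistrib smul_add smul_diff)

lemma hol_mat_lap: "hol_mat S W \<Longrightarrow> hol_mat S (\<lambda>z. lap x y (W z))"
  unfolding lap_def comm_def by (intro hol_mat_simps hol_mat_mult)

lemma lap_entry_bound:
  fixes x y :: "'n::finite cmat"
  obtains \<Lambda> where "\<Lambda> \<ge> 0" "\<And>E \<epsilon> i j. (\<And>i j. cmod (E $ i $ j) \<le> \<epsilon>) \<Longrightarrow> cmod (lap x y E $ i $ j) \<le> \<Lambda> * \<epsilon>"
proof -
  have "linear (lap x y)"
    by (intro linearI) (simp_all add: lap_simps flip: smul_of_real)
  then obtain K where K: "K > 0" "\<And>E. norm (lap x y E) \<le> norm E * K"
    using bounded_linear.pos_bounded linear_conv_bounded_linear by blast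
  show thesis
  proof (rule that)
    fix E :: "'n cmat" and \<epsilon> i j assume E: "\<And>i j. cmod (E $ i $ j) \<le> \<epsilon>"
    have "cmod (lap x y E $ i $ j) \<le> norm (lap x y E)"
      using Finite_Cartesian_Product.norm_nth_le[of "lap x y E $ i" j]
          Finite_Cartesian_Product.norm_nth_le[of "lap x y E" i] by linarith
    also have "\<dots> \<le> norm E * K" by (rule K)
    also have "\<dots> \<le> (\<Sum>i\<in>(UNIV::'n set). \<Sum>j\<in>(UNIV::'n set). \<epsilon>) * K"
      using E K(1) by (intro mult_right_mono order_trans[OF norm_le_entries] sum_mono) auto
    also have "\<dots> = (of_nat CARD('n) * of_nat CARD('n) * K) * \<epsilon>" by simp
    finally show "cmod (lap x y E $ i $ j) \<le> (of_nat CARD('n) * of_nat CARD('n) * K) * \<epsilon>" .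
  qed (use K in simp)
qed

text \<open>The scalar identity is ln x = ln K + ln (1 - w) with w = 1 - x / K. The coefficient of
  degree 0 is \<open>- 1 / 0\<close>, which is 0, as the series of ln (1 - w) requires.\<close>

lemma mlog_mseries:
  fixes C :: "'n::finite cmat"
  assumes C: "C \<in> metrics" and K: "K > 0" "opn (mat 1 - smul (of_real (1 / K)) C) < 1"
  shows "mlog C = smul (of_real (ln K)) (mat 1)
      + smul 1 (mseries (\<lambda>k. - 1 / of_nat k) (mat 1 - smul (of_real (1 / K)) C))"
  unfolding mlog_def
proof (rule mseries_hfun[OF assms])
  show "(\<lambda>k. - 1 / of_nat k * of_real (1 - x / K) ^ k) sums complex_of_real (ln (x / K))"
    if "0 < x" "\<bar>1 - x / K\<bar> < 1" for x
  proof -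
    have "(\<lambda>k. - ((- (- (1 - x / K))) ^ k) / of_nat k) sums ln (1 + (- (1 - x / K)))"
      by (rule ln_series') (use that in simp)
    then have "(\<lambda>k. complex_of_real (- ((1 - x / K) ^ k) / of_nat k)) sums of_real (ln (x / K))"
      unfolding sums_of_real_iff by simp
    then show ?thesis by simp
  qed
  show "complex_of_real (ln x) = of_real (ln K) + 1 * of_real (ln (x / K))" if "0 < x" for x
    using that K(1) by (simp add: ln_div)
qed

text \<open>For \<open>W = 1 - c / K\<close> the flow reads \<open>W' = \<Phi> W\<close>, where
  \<open>\<Phi>\<close> is \<open>lap\<close> of a power series divided by \<open>K\<close>. Unlike
  \<open>mlog\<close>, this expression has the right meaning for every strict contraction, hermitian
  or not, and so for the Picard iterates at complex times.\<close>

lemma analytic_mat_ricci_flow: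
  fixes c :: "real \<Rightarrow> 'n::finite cmat"
  assumes J: "convex J" "s \<in> J" and P: "\<And>t. t \<in> J \<Longrightarrow> c t \<in> metrics"
    and flow: "\<And>t. t \<in> J \<Longrightarrow> (c has_vector_derivative (- lap x y (mlog (c t)))) (at t within J)"
  shows "analytic_mat J s c"
proof -
  define K where "K = opn (c s) + 1"
  have K: "K > 0" using opn_nonneg[of "c s"] by (simp add: K_def)
  define W where "W t = mat 1 - smul (of_real (1 / K)) (c t)" for t
  have Ws: "opn (W s) < 1"
    unfolding W_def K_def using opn_one_minus_metric[OF P[OF J(2)]] .
  define a where "a = (\<lambda>k. - 1 / complex_of_nat k)"
  have a: "cmod (a k) \<le> 1" for k
    by (cases k) (simp_all add: a_def norm_divide del: of_nat_Suc)
  define \<Phi> where "\<Phi> w = smul (of_real (1 / K)) (lap x y (mseries a w))" for w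
  define \<rho> where "\<rho> = (opn (W s) + 1) / 2"
  have \<rho>: "opn (W s) < \<rho>" "\<rho> < 1" using Ws by (simp_all add: \<rho>_def)
  define N where "N = of_nat CARD('n) ^ 3 + (1::real)"
  have N: "N > 0" by (simp add: N_def add_pos_pos)
  \<comment> \<open>Entries within \<open>\<delta>\<close> change the operator norm by at most n^3 *
    \<delta>, one factor n from \<open>opn_le_norm\<close> and n^2 from the number of entries. So
    the whole box around \<open>W s\<close> has operator norm at most
    \<open>\<rho> < 1\<close>.\<close>
  define \<delta> where "\<delta> = (\<rho> - opn (W s)) / N"
  have \<delta>: "\<delta> > 0" using \<rho> N by (simp add: \<delta>_def)
  have box: "opn w \<le> \<rho>" if "w \<in> mbox (W s) \<delta>" for w
  proof -
    have "opn w \<le> opn (w - W s) + opn (W s)" using opn_add[of "w - W s" "W s"] by simp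
    also have "opn (w - W s) \<le> of_nat CARD('n) ^ 3 * \<delta>" by (rule mbox_opn[OF that])
    also have "\<dots> \<le> N * \<delta>" using \<delta> by (simp add: N_def)
    also have "\<dots> = \<rho> - opn (W s)" using N by (simp add: \<delta>_def)
    finally show ?thesis by simp
  qed
  obtain \<Lambda> where \<Lambda>: "\<Lambda> \<ge> 0"
    "\<And>E \<epsilon> i j. (\<And>i j. cmod (E $ i $ j) \<le> \<epsilon>) \<Longrightarrow> cmod (lap x y E $ i $ j) \<le> \<Lambda> * \<epsilon>"
    using lap_entry_bound by blast
  have W: "analytic_mat J s W"
  proof (rule analytic_mat_ode_solution[OF J \<delta>, where \<Phi> = \<Phi>])
    show "hol_mat S (\<lambda>z. \<Phi> (V z))" if "open S" "hol_mat S V" "\<And>z. z \<in> S \<Longrightarrow> V z \<in> mbox (W s) \<delta>" for S V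
      unfolding \<Phi>_def
      by (intro hol_mat_simps hol_mat_lap hol_mat_mseries[OF that(1,2) _ \<rho>(2) a] box that(3))
    show "cmod (\<Phi> w $ i $ j) \<le> 1 / K * (\<Lambda> * (1 / (1 - \<rho>)))" if "w \<in> mbox (W s) \<delta>" for w i j
    proof -
      have "cmod (lap x y (mseries a w) $ i $ j) \<le> \<Lambda> * (1 / (1 - \<rho>))"
        by (rule \<Lambda>(2)) (rule mseries_entry_le[OF box[OF that] \<rho>(2) a])
      then show ?thesis
        using K unfolding \<Phi>_def smul_nth norm_mult norm_of_real by (intro mult_mono) auto
    qed
    show "cmod ((\<Phi> v - \<Phi> w) $ i $ j) \<le> 1 / K * (\<Lambda> * (N / (1 - \<rho>)\<^sup>2)) * \<epsilon>"
      if v: "v \<in> mbox (W s) \<delta>" and w: "w \<in> mbox (W s) \<delta>" and vw: "v \<in> mbox w \<epsilon>" for v w i j \<epsilon>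
    proof -
      have "0 \<le> \<epsilon>" using vw norm_ge_zero order_trans unfolding mbox_def by blast
      have "cmod ((mseries a v - mseries a w) $ i $ j) \<le> N / (1 - \<rho>)\<^sup>2 * \<epsilon>" for i j
      proof -
        have "cmod ((mseries a v - mseries a w) $ i $ j) \<le> opn (v - w) / (1 - \<rho>)\<^sup>2"
          by (rule mseries_lipschitz[OF box[OF v] box[OF w] \<rho>(2) a])
        also have "\<dots> \<le> (N * \<epsilon>) / (1 - \<rho>)\<^sup>2"
        proof (rule divide_right_mono)
          show "opn (v - w) \<le> N * \<epsilon>"
            using mbox_opn[OF vw] \<open>0 \<le> \<epsilon>\<close> by (simp add: N_def ring_distribs)
        qed simp
        finally show ?thesis by simp
      qed
      then have "cmod (lap x y (mseries a v - mseries a w) $ i $ j) \<le> \<Lambda> * (N / (1 - \<rho>)\<^sup>2 * \<epsilon>)"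
        by (rule \<Lambda>(2))
      moreover have "\<Phi> v - \<Phi> w = smul (of_real (1 / K)) (lap x y (mseries a v - mseries a w))"
        by (simp add: \<Phi>_def lap_simps smul_diff)
      ultimately have "cmod ((\<Phi> v - \<Phi> w) $ i $ j) \<le> 1 / K * (\<Lambda> * (N / (1 - \<rho>)\<^sup>2 * \<epsilon>))"
        using K by (simp only: smul_nth norm_mult norm_of_real) (intro mult_mono, auto)
      then show ?thesis by (simp add: mult.assoc)
    qed
    have "(W \<longlongrightarrow> W s) (at s within J)"
    proof -
      have "(c \<longlongrightarrow> c s) (at s within J)"
        using has_vector_derivative_continuous[OF flow[OF J(2)]] by (simp add: continuous_within)
      then show ?thesis
        unfolding W_def smul_of_real by (intro tendsto_intros)
    qed
    from opn_tendsto_less[OF this Ws] Ws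
    have "eventually (\<lambda>t. opn (W t) < 1) (nhds_within s J)"
      by (simp add: eventually_nhds_within_iff)
    with eventually_nhds_within_in
    show "eventually (\<lambda>t. (W has_vector_derivative \<Phi> (W t)) (at t within J)) (nhds_within s J)"
    proof eventually_elim
      case (elim t)
      have "lap x y (mlog (c t)) = lap x y (mseries a (W t))"
        using mlog_mseries[OF P[OF elim(1)] K, folded W_def a_def, OF elim(2)]
        by (simp add: lap_simps)
      then have "\<Phi> (W t) = - ((1 / K) *\<^sub>R (- lap x y (mlog (c t))))"
        unfolding \<Phi>_def smul_of_real by simp
      moreover have "(W has_vector_derivative (0 - (1 / K) *\<^sub>R (- lap x y (mlog (c t))))) (at t within J)"
        unfolding W_def smul_of_real
        by (intro has_vector_derivative_diff has_vector_derivative_const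
            bounded_linear.has_vector_derivative[OF bounded_linear_scaleR_right] flow elim(1))
      ultimately show ?case by simp
    qed
  qed
  have "c = (\<lambda>t. smul (of_real K) (mat 1) - smul (of_real K) (W t))"
    using K by (simp add: W_def fun_eq_iff smul_diff)
  moreover have "analytic_mat J s (\<lambda>t. smul (of_real K) (mat 1) - smul (of_real K) (W t))"
    using W by (intro analytic_mat_simps analytic_within_const) auto
  ultimately show ?thesis by simp
qed

section \<open>Local splitting of spectral projections\<close>

text \<open>The common exponent is the least order of vanishing among the members that are not
  identically zero near \<open>s\<close>; a member attaining it supplies \<open>i0\<close>.\<close>

lemma analytic_family_factor:
  fixes f :: "'i::finite \<Rightarrow> real \<Rightarrow> complex"
  assumes f: "\<And>i. analytic_within J s (f i)"
  obtains "eventually (\<lambda>t. \<forall>i. f i t = 0) (nhds_within s J)"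
  | k g i0 where "\<And>i. analytic_within J s (g i)" "g i0 s \<noteq> 0"
      "eventually (\<lambda>t. \<forall>i. f i t = of_real (t - s) ^ k * g i t) (nhds_within s J)"
proof -
  define Z where "Z i \<longleftrightarrow> eventually (\<lambda>t. f i t = 0) (nhds_within s J)" for i
  have "\<exists>p. \<not> Z i \<longrightarrow> analytic_within J s (snd p) \<and> snd p s \<noteq> 0 \<and>
      eventually (\<lambda>t. f i t = of_real (t - s) ^ fst p * snd p t) (nhds_within s J)" for i
    using f[of i]
  proof (cases rule: analytic_within_factor)
    case (2 k g)
    then show ?thesis by (intro exI[of _ "(k, g)"]) simp
  qed (simp add: Z_def)
  then have "\<forall>i. \<exists>p. \<not> Z i \<longrightarrow> analytic_within J s (snd p) \<and> snd p s \<noteq> 0 \<and>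
      eventually (\<lambda>t. f i t = of_real (t - s) ^ fst p * snd p t) (nhds_within s J)" by blast
  then obtain p where p: "\<forall>i. \<not> Z i \<longrightarrow> analytic_within J s (snd (p i)) \<and> snd (p i) s \<noteq> 0 \<and>
      eventually (\<lambda>t. f i t = of_real (t - s) ^ fst (p i) * snd (p i) t) (nhds_within s J)"
    by (rule choice[THEN exE])
  show thesis
  proof (cases "\<forall>i. Z i")
    case True
    then show thesis by (intro that(1)) (simp add: Z_def eventually_all_finite)
  next
    case False
    define k where "k = Min ((\<lambda>i. fst (p i)) ` {i. \<not> Z i})"
    have "k \<in> (\<lambda>i. fst (p i)) ` {i. \<not> Z i}"
      unfolding k_def using False by (intro Min_in) auto
    then obtain i0 where i0: "\<not> Z i0" "fst (p i0) = k" by auto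
    have k: "k \<le> fst (p i)" if "\<not> Z i" for i unfolding k_def using that by (intro Min_le) auto
    define g where "g i t = (if Z i then 0 else of_real (t - s) ^ (fst (p i) - k) * snd (p i) t)" for i t
    show thesis
    proof (rule that(2)[of g i0 k])
      show "analytic_within J s (g i)" for i
      proof (cases "Z i")
        case False
        have "analytic_within J s (\<lambda>t. (of_real t - of_real s) ^ (fst (p i) - k) * snd (p i) t)"
          using p False by (intro analytic_within_mult analytic_within_power analytic_within_diff
              analytic_within_of_real analytic_within_const) simp
        then show ?thesis using False by (simp add: g_def[abs_def])
      qed (simp add: g_def[abs_def])
      show "g i0 s \<noteq> 0" using p i0 by (simp add: g_def)
      have "eventually (\<lambda>t. f i t = of_real (t - s) ^ k * g i t) (nhds_within s J)" for i
      proof (cases "Z i")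
        case True
        then show ?thesis by (simp add: g_def Z_def)
      next
        case False
        with p have "eventually (\<lambda>t. f i t = of_real (t - s) ^ fst (p i) * snd (p i) t) (nhds_within s J)" by blast
        then show ?thesis
        proof eventually_elim
          case (elim t)
          then show ?case using False k[OF False]
            by (simp add: g_def mult.assoc[symmetric] flip: power_add)
        qed
      qed
      then show "eventually (\<lambda>t. \<forall>i. f i t = of_real (t - s) ^ k * g i t) (nhds_within s J)"
        by (simp add: eventually_all_finite)
    qed
  qed
qed

lemma analytic_mat_factor:
  fixes V :: "real \<Rightarrow> 'n::finite cmat"
  assumes "analytic_mat J s V"
  obtains "eventually (\<lambda>t. V t = 0) (nhds_within s J)"
  | k W where "analytic_mat J s W" "W s \<noteq> 0"
      "eventually (\<lambda>t. V t = smul (of_real (t - s) ^ k) (W t)) (nhds_within s J)"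
proof -
  have "\<And>ij. analytic_within J s (\<lambda>t. V t $ fst ij $ snd ij)" using assms by (simp add: analytic_mat_def)
  then show thesis
  proof (rule analytic_family_factor)
    assume 1: "eventually (\<lambda>t. \<forall>ij. V t $ fst ij $ snd ij = 0) (nhds_within s J)"
    show thesis
      by (rule that(1)) (use 1 in eventually_elim, simp add: vec_eq_iff)
  next
    fix k g ij
    assume 2: "\<And>ij. analytic_within J s (g ij)" "g ij s \<noteq> 0"
      "eventually (\<lambda>t. \<forall>ij. V t $ fst ij $ snd ij = of_real (t - s) ^ k * g ij t) (nhds_within s J)"
    show thesis
    proof (rule that(2)[of "\<lambda>t. \<chi> i j. g (i, j) t" k])
      show "analytic_mat J s (\<lambda>t. \<chi> i j. g (i, j) t)" using 2(1) by (simp add: analytic_mat_def)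
      show "(\<chi> i j. g (i, j) s) \<noteq> 0"
      proof
        assume "(\<chi> i j. g (i, j) s) = 0"
        then have "(\<chi> i j. g (i, j) s) $ fst ij $ snd ij = 0" by (simp only: zero_index)
        then show False using 2(2) by simp
      qed
      show "eventually (\<lambda>t. V t = smul (of_real (t - s) ^ k) (\<chi> i j. g (i, j) t)) (nhds_within s J)"
        using 2(3) by eventually_elim (simp add: vec_eq_iff)
    qed
  qed
qed

text \<open>Identities obtained after division by a power of \<open>t - s\<close> hold only for
  \<open>t\<close> different from \<open>s\<close>; continuity at the limit point \<open>s\<close>
  adds the missing point.\<close>

lemma analytic_mat_eqI:
  assumes "analytic_mat J s V" "analytic_mat J s W" "s \<in> J" "s islimpt J"
    and "eventually (\<lambda>t. V t = W t) (at s within J)"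
  shows "eventually (\<lambda>t. V t = W t) (nhds_within s J)"
proof -
  have "(V \<longlongrightarrow> W s) (at s within J)"
    using tendsto_cong[OF assms(5)] analytic_mat_tendsto[OF assms(2,3)] by simp
  then have "V s = W s"
    using tendsto_unique analytic_mat_tendsto[OF assms(1,3)] assms(4) trivial_limit_within by blast
  then show ?thesis using assms(5) by (simp add: eventually_nhds_within_iff)
qed

section \<open>Spectral projections through the functional calculus\<close>

lemma conj_diag_mult:
  assumes "unitary U"
  shows "U ** diagm a ** madj U ** (U ** diagm b ** madj U) = U ** diagm (\<lambda>i. a i * b i) ** madj U"
proof -
  have "U ** diagm a ** madj U ** (U ** diagm b ** madj U) = U ** (diagm a ** (madj U ** U) ** diagm b) ** madj U"
    by (simp add: matrix_mul_assoc del: diagm_simps(3))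
  then show ?thesis by (simp add: unitary_mult[OF assms])
qed

lemma conj_diag_shift:
  assumes "unitary U"
  shows "U ** diagm d ** madj U - smul z (mat 1) = U ** diagm (\<lambda>i. d i - z) ** madj U"
proof -
  have "diagm (\<lambda>i. d i - z) = diagm d - smul z (mat 1)"
    by (simp add: vec_eq_iff diagm_def mat_def)
  then show ?thesis
    by (simp only: matrix_mul_diff_ldistrib matrix_mul_diff_rdistrib smul_mult matrix_mul_rid unitary_mult[OF assms])
qed

lemma hfun_mult:
  assumes "hermitian B"
  shows "hfun f B ** hfun g B = hfun (\<lambda>x. f x * g x) B"
proof -
  obtain U d where U: "unitary U" "B = U ** diagm (\<lambda>i. complex_of_real (d i)) ** madj U"
    using hermitian_diagonalize[OF assms] by blast
  show ?thesis unfolding hfun_eq[OF U] by (rule conj_diag_mult[OF U(1)])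
qed

lemma hfun_id:
  assumes "hermitian B"
  shows "hfun complex_of_real B = B"
proof -
  obtain U d where U: "unitary U" "B = U ** diagm (\<lambda>i. complex_of_real (d i)) ** madj U"
    using hermitian_diagonalize[OF assms] by blast
  show ?thesis unfolding hfun_eq[OF U] by (rule U(2)[symmetric])
qed

lemma madj_hfun:
  assumes "hermitian B"
  shows "madj (hfun f B) = hfun (\<lambda>x. cnj (f x)) B"
proof -
  obtain U d where U: "unitary U" "B = U ** diagm (\<lambda>i. complex_of_real (d i)) ** madj U"
    using hermitian_diagonalize[OF assms] by blast
  show ?thesis unfolding hfun_eq[OF U] by (simp add: matrix_mul_assoc)
qed

lemma mtrace_diag: "unitary U \<Longrightarrow> mtrace (U ** diagm d ** madj U) = (\<Sum>i\<in>UNIV. d i)"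
  by (subst mtrace_mult_commute) (simp add: matrix_mul_assoc unitary_mult, simp add: mtrace_def diagm_def)

lemma hproj_hfun_indicator: "hermitian B \<Longrightarrow> hproj (hfun (\<lambda>x. if R x then 1 else 0) B)"
  by (simp add: hproj_def hfun_mult madj_hfun if_distrib cong: if_cong)

text \<open>The matrix \<open>M (M\<^sup>2)\<^sup>-\<^sup>1\<^sup>/\<^sup>2\<close> is the sign of \<open>M\<close>.\<close>

lemma hfun_step_eq:
  fixes B :: "'n::finite cmat"
  assumes B: "hermitian B" and M: "M = B - smul (of_real \<beta>) (mat 1)" and C: "M ** M \<in> metrics"
  shows "hfun (\<lambda>x. if x > \<beta> then 1 else 0) B = smul (1/2) (mat 1 + M ** minv_sqrt (M ** M))"
proof -
  obtain U d where U: "unitary U" "B = U ** diagm (\<lambda>i. complex_of_real (d i)) ** madj U"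
    using hermitian_diagonalize[OF B] by blast
  note conj = conj_diag_mult[OF U(1)]
  have M': "M = U ** diagm (\<lambda>i. complex_of_real (d i - \<beta>)) ** madj U"
    unfolding M U(2) conj_diag_shift[OF U(1)] by simp
  have MM: "M ** M = U ** diagm (\<lambda>i. complex_of_real ((d i - \<beta>)\<^sup>2)) ** madj U"
    unfolding M' conj by (simp add: power2_eq_square)
  \<comment> \<open>Positivity of \<open>M ** M\<close> means exactly that \<open>\<beta>\<close> is
    not an eigenvalue of \<open>B\<close>.\<close>
  have nz: "d i \<noteq> \<beta>" for i
    using is_eigenvalue_diag[OF U(1) MM, of i] C unfolding metrics_def by fastforce
  have D: "minv_sqrt (M ** M) = U ** diagm (\<lambda>i. of_real (((d i - \<beta>)\<^sup>2) powr (-1/2))) ** madj U"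
    unfolding minv_sqrt_def by (rule hfun_eq[OF U(1) MM])
  have half: "smul (1/2) (mat 1 + U ** diagm a ** madj U) = U ** diagm (\<lambda>i. (1 + a i) / 2) ** madj U" for a
  proof -
    have "diagm (\<lambda>i. (1 + a i) / 2) = smul (1/2) (mat 1 + diagm a)"
      by (simp add: vec_eq_iff diagm_def mat_def)
    then show ?thesis
      by (simp only: matrix_add_ldistrib matrix_mul_add_rdistrib smul_mult matrix_mul_rid unitary_mult[OF U(1)])
  qed
  have "(if d i > \<beta> then 1 else 0) =
      (1 + complex_of_real (d i - \<beta>) * of_real (((d i - \<beta>)\<^sup>2) powr (-1/2))) / 2" for i
  proof -
    have "((d i - \<beta>)\<^sup>2) powr (-1/2) = inverse \<bar>d i - \<beta>\<bar>"
      using nz[of i] by (simp add: powr_minus powr_half_sqrt)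
    then have "(d i - \<beta>) * ((d i - \<beta>)\<^sup>2) powr (-1/2) = (if d i > \<beta> then 1 else -1)"
      using nz[of i] by (auto simp: abs_if field_simps)
    then have "complex_of_real (d i - \<beta>) * of_real (((d i - \<beta>)\<^sup>2) powr (-1/2)) = of_real (if d i > \<beta> then 1 else -1)"
      by (simp only: of_real_mult[symmetric])
    then show ?thesis by simp
  qed
  then show ?thesis unfolding hfun_eq[OF U] D by (subst (1) M') (simp only: conj half)
qed

text \<open>The eigenvalues sum to 0 and are not all 0, so some are positive. Half the smallest
  positive one serves as \<open>\<beta>\<close>, and the step function selects exactly the positive
  eigenvalues. The last trace is their sum; being non-zero, it will show that the projection is
  neither 0 nor the whole of \<open>Q\<close>.\<close>

lemma traceless_hermitian_gap:
  fixes B :: "'n::finite cmat"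
  assumes B: "hermitian B" "mtrace B = 0" "B \<noteq> 0"
  obtains \<beta> where "\<beta> > 0"
    "(B - smul (of_real \<beta>) (mat 1)) ** (B - smul (of_real \<beta>) (mat 1)) \<in> metrics"
    "mtrace (B ** hfun (\<lambda>x. if x > \<beta> then 1 else 0) B) \<noteq> 0"
proof -
  obtain U d where U: "unitary U" "B = U ** diagm (\<lambda>i. complex_of_real (d i)) ** madj U"
    using hermitian_diagonalize[OF B(1)] by blast
  have "complex_of_real (\<Sum>i\<in>UNIV. d i) = 0"
    using B(2) unfolding U(2) mtrace_diag[OF U(1)] by simp
  then have sum: "(\<Sum>i\<in>UNIV. d i) = 0" by (simp only: of_real_eq_0_iff)
  have "\<exists>i. d i > 0"
  proof (rule ccontr)
    assume "\<not> (\<exists>i. d i > 0)"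
    then have "\<forall>i. d i = 0"
      using sum_nonneg_eq_0_iff[of UNIV "\<lambda>i. - d i"] sum by (simp add: sum_negf not_less)
    then have "diagm (\<lambda>i. complex_of_real (d i)) = 0" by (simp add: diagm_def vec_eq_iff)
    then show False using B(3) U(2) by simp
  qed
  then obtain i0 where i0: "d i0 > 0" by blast
  define m where "m = Min (d ` {i. d i > 0})"
  have "m \<in> d ` {i. d i > 0}" unfolding m_def using i0 by (intro Min_in) auto
  then have m: "m > 0" by auto
  have m_le: "m \<le> d i" if "d i > 0" for i unfolding m_def using that by (intro Min_le) auto
  define \<beta> where "\<beta> = m / 2"
  have \<beta>: "\<beta> > 0" "\<And>i. d i > 0 \<Longrightarrow> d i > \<beta>" "\<And>i. d i \<noteq> \<beta>"
  proof -
    show "\<beta> > 0" using m by (simp add: \<beta>_def)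
    show "d i > \<beta>" if "d i > 0" for i using m m_le[OF that] by (simp add: \<beta>_def)
    then show "d i \<noteq> \<beta>" for i using \<open>\<beta> > 0\<close> by (cases "d i > 0") force+
  qed
  note conj = conj_diag_mult[OF U(1)]
  have M': "B - smul (of_real \<beta>) (mat 1) = U ** diagm (\<lambda>i. complex_of_real (d i - \<beta>)) ** madj U"
    unfolding U(2) conj_diag_shift[OF U(1)] by simp
  show thesis
  proof (rule that[OF \<beta>(1)])
    have "(B - smul (of_real \<beta>) (mat 1)) ** (B - smul (of_real \<beta>) (mat 1))
        = U ** diagm (\<lambda>i. complex_of_real ((d i - \<beta>)\<^sup>2)) ** madj U"
      unfolding M' conj by (simp add: power2_eq_square)
    from diag_metrics[OF U(1) this]
    show "(B - smul (of_real \<beta>) (mat 1)) ** (B - smul (of_real \<beta>) (mat 1)) \<in> metrics"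
      using \<beta>(3) by simp
    have "B ** hfun (\<lambda>x. if x > \<beta> then 1 else 0) B =
        U ** diagm (\<lambda>i. complex_of_real (if d i > \<beta> then d i else 0)) ** madj U"
      unfolding hfun_eq[OF U] by (subst (1) U(2)) (simp add: conj if_distrib cong: if_cong)
    then have "mtrace (B ** hfun (\<lambda>x. if x > \<beta> then 1 else 0) B) = of_real (\<Sum>i\<in>UNIV. if d i > \<beta> then d i else 0)"
      by (simp add: mtrace_diag[OF U(1)])
    moreover have "(\<Sum>i\<in>UNIV. if d i > \<beta> then d i else 0) > 0"
      by (rule sum_pos2[of _ i0]) (use i0 \<beta> in auto)
    ultimately show "mtrace (B ** hfun (\<lambda>x. if x > \<beta> then 1 else 0) B) \<noteq> 0"
      by (simp only: of_real_eq_0_iff)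
  qed
qed

text \<open>Among hermitian matrices positivity is an open condition:
  \<open>opn (1 - C / K) < 1\<close> is open, holds at the limit, and forces every eigenvalue of
  \<open>C\<close> to be positive.\<close>

lemma eventually_metrics:
  fixes C :: "'a \<Rightarrow> 'n::finite cmat"
  assumes lim: "(C \<longlongrightarrow> L) F" and L: "L \<in> metrics" and herm: "eventually (\<lambda>x. hermitian (C x)) F"
  shows "eventually (\<lambda>x. C x \<in> metrics) F"
proof -
  define K where "K = opn L + 1"
  have K: "K > 0" using opn_nonneg[of L] by (simp add: K_def)
  have "((\<lambda>x. mat 1 - smul (of_real (1 / K)) (C x)) \<longlongrightarrow> mat 1 - smul (of_real (1 / K)) L) F"
    unfolding smul_of_real by (intro tendsto_intros lim)
  from opn_tendsto_less[OF this opn_one_minus_metric[OF L, folded K_def]] herm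
  show ?thesis
  proof eventually_elim
    case (elim x)
    obtain U d where U: "unitary U" "C x = U ** diagm (\<lambda>i. complex_of_real (d i)) ** madj U"
      using hermitian_diagonalize[OF elim(2)] by blast
    have "mat 1 - smul (of_real (1 / K)) (C x) = U ** diagm (\<lambda>i. complex_of_real (1 - d i / K)) ** madj U"
      unfolding U(2) using one_minus_smul_diag[OF U(1)] by simp
    from diag_le_opn[OF U(1) this] elim(1) have "\<bar>1 - d i / K\<bar> < 1" for i
      unfolding norm_of_real using le_less_trans by blast
    then have "d i > 0" for i using K by (simp add: abs_less_iff zero_less_divide_iff)
    then show ?case using diag_metrics[OF U] by blast
  qed
qed

text \<open>The step function is discontinuous, but no eigenvalue of \<open>B s\<close> sits at its
  jump. This persists near \<open>s\<close>, where the projection is given by an analytic formula in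
  the inverse square root.\<close>

lemma analytic_mat_hfun_step:
  fixes B :: "real \<Rightarrow> 'n::finite cmat"
  assumes B: "analytic_mat J s B" and s: "s \<in> J"
    and herm: "eventually (\<lambda>t. hermitian (B t)) (nhds_within s J)"
    and gap: "(B s - smul (of_real \<beta>) (mat 1)) ** (B s - smul (of_real \<beta>) (mat 1)) \<in> metrics"
  shows "analytic_mat J s (\<lambda>t. hfun (\<lambda>x. if x > \<beta> then 1 else 0) (B t))"
proof -
  define M where "M t = B t - smul (of_real \<beta>) (mat 1)" for t
  have M: "analytic_mat J s M" unfolding M_def by (intro analytic_mat_simps B) auto
  have MM: "analytic_mat J s (\<lambda>t. M t ** M t)" by (intro analytic_mat_mult M)
  have "eventually (\<lambda>t. hermitian (M t ** M t)) (nhds_within s J)"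
    using herm by eventually_elim (simp add: hermitian_def M_def)
  then have "eventually (\<lambda>t. M t ** M t \<in> metrics) (at s within J)"
    using gap eventually_within_nhds_within
    by (intro eventually_metrics[OF analytic_mat_tendsto[OF MM s]]) (auto simp: M_def)
  then have pos: "eventually (\<lambda>t. M t ** M t \<in> metrics) (nhds_within s J)"
    using gap by (simp add: eventually_nhds_within_iff M_def)
  have "analytic_mat J s (\<lambda>t. smul (1/2) (mat 1 + M t ** minv_sqrt (M t ** M t)))"
    by (intro analytic_mat_simps analytic_mat_mult M analytic_mat_minv_sqrt[OF MM s pos]) auto
  moreover have "eventually (\<lambda>t. hfun (\<lambda>x. if x > \<beta> then 1 else 0) (B t)
      = smul (1/2) (mat 1 + M t ** minv_sqrt (M t ** M t))) (nhds_within s J)"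
    using herm pos by eventually_elim (rule hfun_step_eq, auto simp: M_def)
  ultimately show ?thesis by (rule analytic_mat_cong[rotated])
qed

text \<open>The eigenvalue of \<open>A\<close> on the range of an eigenprojection \<open>P\<close>.\<close>

definition proj_ev :: "'n::finite cmat \<Rightarrow> 'n cmat \<Rightarrow> complex" where
  "proj_ev A P = mtrace (A ** P) / mtrace P"

text \<open>The members are functions of \<open>t\<close>, and their identities hold near
  \<open>s\<close>. Eigenvalues of different members may coincide, in particular at
  \<open>s\<close>, so at a single time the ranges need not be full eigenspaces. The condition
  \<open>P s \<noteq> 0\<close> keeps the eigenvalue \<open>proj_ev\<close> analytic at
  \<open>s\<close>.\<close>

definition spectral_split ::
  "real set \<Rightarrow> real \<Rightarrow> (real \<Rightarrow> 'n::finite cmat) \<Rightarrow> (real \<Rightarrow> 'n cmat) \<Rightarrow> (real \<Rightarrow> 'n cmat) set \<Rightarrow> bool" where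
  "spectral_split J s A Q F \<longleftrightarrow> finite F \<and>
     (\<forall>P\<in>F. analytic_mat J s P \<and> P s \<noteq> 0 \<and>
        eventually (\<lambda>t. hproj (P t) \<and> A t ** P t = smul (proj_ev (A t) (P t)) (P t)) (nhds_within s J)) \<and>
     (\<forall>P\<in>F. \<forall>P'\<in>F. P \<noteq> P' \<longrightarrow> eventually (\<lambda>t. P t ** P' t = 0) (nhds_within s J)) \<and>
     eventually (\<lambda>t. (\<Sum>P\<in>F. P t) = Q t) (nhds_within s J)"

lemma mtrace_hproj_nonzero: "hproj P \<Longrightarrow> P \<noteq> 0 \<Longrightarrow> mtrace P \<noteq> 0"
  using mtrace_hproj_ge_1[of P] by auto

lemma orthogonal_sum_absorb:
  fixes p :: "'i \<Rightarrow> 'n::finite cmat"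
  assumes "\<And>i. i \<in> F \<Longrightarrow> p i ** p i = p i" "\<And>i j. i \<in> F \<Longrightarrow> j \<in> F \<Longrightarrow> i \<noteq> j \<Longrightarrow> p i ** p j = 0"
    and "finite F" "i \<in> F"
  shows "sum p F ** p i = p i" "p i ** sum p F = p i"
proof -
  have "sum p F ** p i = (\<Sum>j\<in>F. if j = i then p i else 0)"
    unfolding matrix_mul_sum_left using assms by (intro sum.cong) auto
  then show "sum p F ** p i = p i" using assms by simp
  have "p i ** sum p F = (\<Sum>j\<in>F. if j = i then p i else 0)"
    unfolding matrix_mul_sum_right using assms by (intro sum.cong) auto
  then show "p i ** sum p F = p i" using assms by simp
qed

lemma spectral_splitD:
  assumes "spectral_split J s A Q F"
  shows "finite F" "\<And>P. P \<in> F \<Longrightarrow> analytic_mat J s P" "\<And>P. P \<in> F \<Longrightarrow> P s \<noteq> 0"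
    "eventually (\<lambda>t. (\<forall>P\<in>F. hproj (P t) \<and> A t ** P t = smul (proj_ev (A t) (P t)) (P t) \<and>
        Q t ** P t = P t \<and> P t ** Q t = P t) \<and>
      (\<forall>P\<in>F. \<forall>P'\<in>F. P \<noteq> P' \<longrightarrow> P t ** P' t = 0) \<and> (\<Sum>P\<in>F. P t) = Q t) (nhds_within s J)"
proof -
  show F: "finite F" using assms by (simp add: spectral_split_def)
  have "eventually (\<lambda>t. \<forall>P\<in>F. hproj (P t) \<and> A t ** P t = smul (proj_ev (A t) (P t)) (P t)) (nhds_within s J)"
    "eventually (\<lambda>t. \<forall>P\<in>F. \<forall>P'\<in>F. P \<noteq> P' \<longrightarrow> P t ** P' t = 0) (nhds_within s J)"
    "eventually (\<lambda>t. (\<Sum>P\<in>F. P t) = Q t) (nhds_within s J)"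
    using assms F unfolding spectral_split_def by (simp_all add: eventually_ball_finite_distrib)
  then show "eventually (\<lambda>t. (\<forall>P\<in>F. hproj (P t) \<and> A t ** P t = smul (proj_ev (A t) (P t)) (P t) \<and>
        Q t ** P t = P t \<and> P t ** Q t = P t) \<and>
      (\<forall>P\<in>F. \<forall>P'\<in>F. P \<noteq> P' \<longrightarrow> P t ** P' t = 0) \<and> (\<Sum>P\<in>F. P t) = Q t) (nhds_within s J)"
  proof eventually_elim
    case (elim t)
    have "(\<Sum>P\<in>F. P t) ** P t = P t" "P t ** (\<Sum>P\<in>F. P t) = P t" if "P \<in> F" for P
      using orthogonal_sum_absorb[where p = "\<lambda>P. P t", OF _ _ F that] elim(1,2)
      unfolding hproj_def by blast+
    with elim show ?case by simp
  qed
qed (use assms in \<open>auto simp: spectral_split_def\<close>)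

text \<open>Members of \<open>F1\<close> absorb \<open>P\<close> and members of \<open>F2\<close>
  absorb \<open>R\<close>, so \<open>P ** R = 0\<close> makes them mutually orthogonal. A common
  member would be orthogonal to itself, hence zero at \<open>s\<close>; this gives
  disjointness.\<close>

lemma spectral_split_union:
  assumes F1: "spectral_split J s A P F1" and F2: "spectral_split J s A R F2" and s: "s \<in> J"
    and PR: "eventually (\<lambda>t. P t ** R t = 0 \<and> R t ** P t = 0 \<and> P t + R t = Q t) (nhds_within s J)"
  shows "spectral_split J s A Q (F1 \<union> F2)"
proof -
  have orth: "eventually (\<lambda>t. \<forall>P1\<in>F1. \<forall>P2\<in>F2. P1 t ** P2 t = 0 \<and> P2 t ** P1 t = 0) (nhds_within s J)"
    using spectral_splitD(4)[OF F1] spectral_splitD(4)[OF F2] PR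
  proof eventually_elim
    case (elim t)
    show ?case
    proof (intro ballI conjI)
      fix P1 P2 assume P12: "P1 \<in> F1" "P2 \<in> F2"
      have "P t ** P1 t = P1 t" "P1 t ** P t = P1 t"
        using conjunct1[OF elim(1), rule_format, OF P12(1)] by simp_all
      moreover have "R t ** P2 t = P2 t" "P2 t ** R t = P2 t"
        using conjunct1[OF elim(2), rule_format, OF P12(2)] by simp_all
      moreover have "P1 t ** (P t ** R t) ** P2 t = (P1 t ** P t) ** (R t ** P2 t)"
          "P2 t ** (R t ** P t) ** P1 t = (P2 t ** R t) ** (P t ** P1 t)"
        by (simp_all only: matrix_mul_assoc)
      ultimately have "P1 t ** P2 t = P1 t ** (P t ** R t) ** P2 t" "P2 t ** P1 t = P2 t ** (R t ** P t) ** P1 t"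
        by simp_all
      with elim(3) show "P1 t ** P2 t = 0" "P2 t ** P1 t = 0" by simp_all
    qed
  qed
  have disj: "F1 \<inter> F2 = {}"
  proof (rule ccontr)
    assume "F1 \<inter> F2 \<noteq> {}"
    then obtain P' where P': "P' \<in> F1" "P' \<in> F2" by blast
    have "P' s ** P' s = 0" using eventually_nhds_within_self[OF orth s] P' by blast
    moreover have "P' s ** P' s = P' s"
      using eventually_nhds_within_self[OF spectral_splitD(4)[OF F1] s] P' by (simp add: hproj_def)
    ultimately show False using spectral_splitD(3)[OF F1] P' by simp
  qed
  have fin: "finite F1" "finite F2" using spectral_splitD(1) F1 F2 by blast+
  have sum: "eventually (\<lambda>t. (\<Sum>P\<in>F1 \<union> F2. P t) = Q t) (nhds_within s J)"
    using spectral_splitD(4)[OF F1] spectral_splitD(4)[OF F2] PR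
    by eventually_elim (simp add: sum.union_disjoint[OF fin disj])
  have orth': "eventually (\<lambda>t. P1 t ** P2 t = 0) (nhds_within s J)"
    if "P1 \<in> F1 \<union> F2" "P2 \<in> F1 \<union> F2" "P1 \<noteq> P2" for P1 P2
    using spectral_splitD(4)[OF F1] spectral_splitD(4)[OF F2] orth
  proof eventually_elim
    case (elim t)
    then show ?case using that by blast
  qed
  have "spectral_split J s A Q (F1 \<union> F2) \<longleftrightarrow>
      (\<forall>P\<in>F1 \<union> F2. analytic_mat J s P \<and> P s \<noteq> 0 \<and>
        eventually (\<lambda>t. hproj (P t) \<and> A t ** P t = smul (proj_ev (A t) (P t)) (P t)) (nhds_within s J))"
    using fin sum orth' by (simp add: spectral_split_def)
  then show ?thesis using F1 F2 by (auto simp: spectral_split_def)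
qed

lemma mat_1_nonzero: "mat 1 \<noteq> (0 :: 'n::finite cmat)"
  by (simp add: vec_eq_iff mat_def)

text \<open>If \<open>A\<close> is not scalar on the range of \<open>Q\<close>, its traceless part there is \<open>(t - s)\<^sup>k W t\<close> with
  \<open>W s\<close> hermitian, traceless and non-zero. Such a \<open>W s\<close> has eigenvalues of both signs, so a spectral
  projection of \<open>W\<close> splits \<open>Q\<close> into two projections of smaller rank.\<close>

lemma local_spectral_split:
  fixes A Q :: "real \<Rightarrow> 'n::finite cmat"
  assumes s: "s \<in> J" "s islimpt J"
    and A: "analytic_mat J s A" "eventually (\<lambda>t. hermitian (A t)) (nhds_within s J)"
    and Q: "analytic_mat J s Q" "eventually (\<lambda>t. hproj (Q t)) (nhds_within s J)"
      "eventually (\<lambda>t. A t ** Q t = Q t ** A t) (nhds_within s J)" "Re (mtrace (Q s)) < of_nat N"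
  shows "\<exists>F. spectral_split J s A Q F"
  using Q
proof (induction N arbitrary: Q)
  case 0
  then show ?case using mtrace_hproj_nonneg[OF eventually_nhds_within_self[OF 0(2) s(1)]] by simp
next
  case (Suc N)
  note Q = Suc.prems
  show ?case
  proof (cases "Q s = 0")
    case True
    \<comment> \<open>A non-zero projection has trace at least 1, so a trace tending to 0 forces
      \<open>Q t = 0\<close> near \<open>s\<close>.\<close>
    have "((\<lambda>t. Re (mtrace (Q t))) \<longlongrightarrow> Re (mtrace (Q s))) (at s within J)"
      by (intro tendsto_Re analytic_within_tendsto analytic_within_mtrace Q s)
    then have "eventually (\<lambda>t. Re (mtrace (Q t)) < 1) (at s within J)"
      by (rule order_tendstoD(2)) (simp add: True)
    then have "eventually (\<lambda>t. Q t = 0) (at s within J)"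
      using eventually_within_nhds_within[OF Q(2)] by eventually_elim (use mtrace_hproj_ge_1 in force)
    then have "eventually (\<lambda>t. Q t = 0) (nhds_within s J)"
      using True by (simp add: eventually_nhds_within_iff)
    then have "eventually (\<lambda>t. 0 = Q t) (nhds_within s J)" by eventually_elim simp
    then show ?thesis by (intro exI[of _ "{}"]) (simp add: spectral_split_def)
  next
    case False
    have Qs: "hproj (Q s)" using eventually_nhds_within_self[OF Q(2) s(1)] .
    have trQ: "mtrace (Q s) \<noteq> 0" using mtrace_hproj_nonzero[OF Qs False] .
    define \<mu> where "\<mu> t = proj_ev (A t) (Q t)" for t
    have \<mu>: "analytic_within J s \<mu>"
      unfolding \<mu>_def proj_ev_def
      by (intro analytic_within_divide analytic_within_mtrace analytic_mat_mult A(1) Q(1) trQ s)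
    define V where "V t = A t ** Q t - smul (\<mu> t) (Q t)" for t
    have V: "analytic_mat J s V"
      unfolding V_def by (intro analytic_mat_simps analytic_mat_mult A(1) Q(1) \<mu>)
    have trQ': "eventually (\<lambda>t. mtrace (Q t) \<noteq> 0) (nhds_within s J)"
      by (intro analytic_within_eventually_nonzero analytic_within_mtrace Q(1) s trQ)
    from V show ?thesis
    proof (rule analytic_mat_factor)
      assume V0: "eventually (\<lambda>t. V t = 0) (nhds_within s J)"
      have "eventually (\<lambda>t. hproj (Q t) \<and> A t ** Q t = smul (proj_ev (A t) (Q t)) (Q t)) (nhds_within s J)"
        using V0 Q(2) by eventually_elim (simp add: V_def \<mu>_def)
      then show ?thesis
        using Q(1) False by (intro exI[of _ "{Q}"]) (simp add: spectral_split_def)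
    next
      fix k W assume W: "analytic_mat J s W" "W s \<noteq> 0"
        and VW: "eventually (\<lambda>t. V t = smul (of_real (t - s) ^ k) (W t)) (nhds_within s J)"
      \<comment> \<open>For \<open>t\<close> different from \<open>s\<close>, the properties of
        \<open>V\<close> pass to \<open>W\<close> because the quotient is a real scalar. The
        vanishing trace is phrased as a matrix equation so that \<open>analytic_mat_eqI\<close>
        extends it to \<open>s\<close> too.\<close>
      have Wprops: "eventually (\<lambda>t. madj (W t) = W t \<and> smul (mtrace (W t)) (mat 1 :: 'n cmat) = 0 \<and>
          Q t ** W t = W t \<and> W t ** Q t = W t \<and> A t ** W t = W t ** A t) (at s within J)"
        using eventually_within_nhds_within[OF VW] eventually_within_nhds_within[OF A(2)]
          eventually_within_nhds_within[OF Q(2)] eventually_within_nhds_within[OF Q(3)]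
          eventually_within_nhds_within[OF trQ'] eventually_neq_at_within[of s s J]
      proof eventually_elim
        case (elim t)
        define r where "r = inverse (complex_of_real (t - s) ^ k)"
        have W_eq: "W t = smul r (V t)" using elim(6) by (simp add: r_def elim(1))
        have r: "cnj r = r" by (simp add: r_def)
        have a: "madj (A t) = A t" and q: "madj (Q t) = Q t" "Q t ** Q t = Q t"
          using elim(2,3) by (simp_all add: hermitian_def hproj_def)
        have qa: "Q t ** A t = A t ** Q t" using elim(4) by simp
        have m: "cnj (\<mu> t) = \<mu> t"
        proof -
          have "cnj (mtrace (A t ** Q t)) = mtrace (A t ** Q t)"
            by (simp only: mtrace_simps(6)[symmetric] madj_mult a q qa)
          moreover have "cnj (mtrace (Q t)) = mtrace (Q t)"
            by (simp only: mtrace_simps(6)[symmetric] q)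
          ultimately show ?thesis by (simp add: \<mu>_def proj_ev_def)
        qed
        have aqq: "A t ** Q t ** Q t = A t ** Q t" "Q t ** (A t ** Q t) = A t ** Q t"
        proof -
          show "A t ** Q t ** Q t = A t ** Q t" by (simp only: matrix_mul_assoc[symmetric] q)
          then show "Q t ** (A t ** Q t) = A t ** Q t" by (simp only: matrix_mul_assoc qa)
        qed
        have "madj (V t) = V t" by (simp add: V_def a q qa m)
        moreover have "mtrace (V t) = 0"
          using elim(5) by (simp add: V_def \<mu>_def proj_ev_def)
        moreover have "Q t ** V t = V t" "V t ** Q t = V t"
          by (simp_all add: V_def matrix_mul_diff_ldistrib matrix_mul_diff_rdistrib q aqq)
        moreover have "A t ** V t = V t ** A t"
          unfolding V_def matrix_mul_diff_ldistrib matrix_mul_diff_rdistrib smul_mult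
          by (simp add: qa flip: matrix_mul_assoc)
        ultimately show ?case by (simp add: W_eq r)
      qed
      have Wherm: "eventually (\<lambda>t. hermitian (W t)) (nhds_within s J)"
        unfolding hermitian_def
        by (rule analytic_mat_eqI[OF analytic_mat_simps(5)[OF W(1)] W(1) s])
          (use Wprops in eventually_elim, simp)
      have Wtr: "eventually (\<lambda>t. smul (mtrace (W t)) (mat 1 :: 'n cmat) = 0) (nhds_within s J)"
        by (rule analytic_mat_eqI[OF analytic_mat_simps(4)[OF analytic_within_mtrace[OF W(1)] analytic_mat_simps(1)]
              analytic_mat_simps(1) s])
          (use Wprops in eventually_elim, simp)
      have QW: "eventually (\<lambda>t. Q t ** W t = W t) (nhds_within s J)"
        by (rule analytic_mat_eqI[OF analytic_mat_mult[OF Q(1) W(1)] W(1) s])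
          (use Wprops in eventually_elim, simp)
      have WQ: "eventually (\<lambda>t. W t ** Q t = W t) (nhds_within s J)"
        by (rule analytic_mat_eqI[OF analytic_mat_mult[OF W(1) Q(1)] W(1) s])
          (use Wprops in eventually_elim, simp)
      have AW: "eventually (\<lambda>t. A t ** W t = W t ** A t) (nhds_within s J)"
        by (rule analytic_mat_eqI[OF analytic_mat_mult[OF A(1) W(1)] analytic_mat_mult[OF W(1) A(1)] s])
          (use Wprops in eventually_elim, simp)
      have Ws: "hermitian (W s)" "mtrace (W s) = 0"
        using eventually_nhds_within_self[OF Wherm s(1)] eventually_nhds_within_self[OF Wtr s(1)]
        by (auto simp: smul_eq_0_iff mat_1_nonzero)
      obtain \<beta> where \<beta>: "\<beta> > 0"
        "(W s - smul (of_real \<beta>) (mat 1)) ** (W s - smul (of_real \<beta>) (mat 1)) \<in> metrics"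
        "mtrace (W s ** hfun (\<lambda>x. if x > \<beta> then 1 else 0) (W s)) \<noteq> 0"
        using traceless_hermitian_gap[OF Ws W(2)] by blast
      define P where "P t = hfun (\<lambda>x. if x > \<beta> then 1 else 0) (W t)" for t
      have P: "analytic_mat J s P"
        unfolding P_def by (rule analytic_mat_hfun_step[OF W(1) s(1) Wherm \<beta>(2)])
      have Pprops: "eventually (\<lambda>t. hproj (P t) \<and> A t ** P t = P t ** A t \<and> Q t ** P t = P t \<and> P t ** Q t = P t)
          (nhds_within s J)"
        using Wherm QW WQ AW
      proof eventually_elim
        case (elim t)
        \<comment> \<open>The reciprocal on the selected part of the spectrum, where
          \<open>x > \<beta> > 0\<close>. The factorisation \<open>P t = W t ** G\<close> places the
          range of \<open>P t\<close> inside that of \<open>Q t\<close>.\<close>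
        define G where "G = hfun (\<lambda>x. if x > \<beta> then of_real (1 / x) else 0) (W t)"
        have "(\<lambda>x. complex_of_real x * (if x > \<beta> then of_real (1 / x) else 0)) = (\<lambda>x. if x > \<beta> then 1 else 0)"
          using \<beta>(1) by (auto simp: fun_eq_iff simp flip: of_real_mult)
        then have WG: "W t ** G = P t"
          unfolding G_def P_def using hfun_mult[OF elim(1), of complex_of_real] by (simp add: hfun_id[OF elim(1)])
        have "Q t ** P t = P t" using elim(2) by (simp add: matrix_mul_assoc flip: WG)
        moreover have "Q t ** P t = P t ** Q t"
          unfolding P_def by (rule hfun_commute[OF elim(1)]) (simp add: elim)
        moreover have "A t ** P t = P t ** A t"
          unfolding P_def by (rule hfun_commute[OF elim(1)]) (simp add: elim)
        ultimately show ?case using hproj_hfun_indicator[OF elim(1)] by (simp add: P_def)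
      qed
      define R where "R t = Q t - P t" for t
      have R: "analytic_mat J s R" unfolding R_def by (intro analytic_mat_simps Q(1) P)
      have Rprops: "eventually (\<lambda>t. hproj (R t) \<and> A t ** R t = R t ** A t \<and>
          P t ** R t = 0 \<and> R t ** P t = 0 \<and> P t + R t = Q t) (nhds_within s J)"
        using Pprops Q(2,3)
        by eventually_elim
          (simp add: R_def hproj_def matrix_mul_diff_ldistrib matrix_mul_diff_rdistrib)
      note Ps = eventually_nhds_within_self[OF Pprops s(1)] and Rs = eventually_nhds_within_self[OF Rprops s(1)]
      have Ps0: "P s \<noteq> 0" using \<beta>(3) by (auto simp: P_def)
      \<comment> \<open>If \<open>P s\<close> were all of \<open>Q s\<close>, the trace of
        \<open>W s ** P s\<close> would be that of \<open>W s\<close>, which is 0.\<close>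
      have Rs0: "R s \<noteq> 0"
      proof
        assume "R s = 0"
        then have "W s ** P s = W s"
          using eventually_nhds_within_self[OF WQ s(1)] by (simp add: R_def)
        then show False using \<beta>(3) Ws(2) by (simp add: P_def)
      qed
      have "mtrace (P s) + mtrace (R s) = mtrace (Q s)" by (simp add: R_def)
      then have tr: "Re (mtrace (P s)) + Re (mtrace (R s)) = Re (mtrace (Q s))"
        by (simp flip: plus_complex.sel(1))
      then have "Re (mtrace (P s)) < of_nat N" "Re (mtrace (R s)) < of_nat N"
        using mtrace_hproj_ge_1[of "P s"] mtrace_hproj_ge_1[of "R s"] Ps Rs Ps0 Rs0 Q(4) by auto
      then obtain F1 F2 where "spectral_split J s A P F1" "spectral_split J s A R F2"
        using Suc.IH[OF P eventually_mono[OF Pprops] eventually_mono[OF Pprops]]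
          Suc.IH[OF R eventually_mono[OF Rprops] eventually_mono[OF Rprops]] by blast
      then have "spectral_split J s A Q (F1 \<union> F2)"
        by (rule spectral_split_union[OF _ _ s(1)]) (use Rprops in eventually_elim, simp)
      then show ?thesis by blast
    qed
  qed
qed

section \<open>Analytic continuation and normalisation\<close>

lemma islimpt_atLeast: "(t0::real) \<le> s \<Longrightarrow> s islimpt {t0..}"
  unfolding islimpt_approachable
proof (intro allI impI)
  fix r :: real assume "t0 \<le> s" "r > 0"
  then show "\<exists>x\<in>{t0..}. x \<noteq> s \<and> dist x s < r"
    by (intro bexI[of _ "s + r / 2"]) (auto simp: dist_real_def)
qed

text \<open>By the dichotomy, having zero germ is a locally constant property of the base point,
  hence constant on a connected set.\<close>

lemma analytic_within_identity:
  assumes S: "connected S" "S \<subseteq> J" and J: "\<And>s. s \<in> S \<Longrightarrow> s islimpt J"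
    and f: "\<And>s. s \<in> S \<Longrightarrow> analytic_within J s f"
    and a: "a \<in> S" "eventually (\<lambda>t. f t = 0) (nhds_within a J)" and b: "b \<in> S"
  shows "eventually (\<lambda>t. f t = 0) (nhds_within b J)"
proof -
  let ?Z = "\<lambda>s. eventually (\<lambda>t. f t = 0) (nhds_within s J)"
  show ?thesis
  proof (rule connected_induction_simple[OF S(1) a(1) b, of ?Z])
    show "?Z a" by (rule a(2))
    fix c assume c: "c \<in> S"
    have "\<exists>r>0. (\<forall>x\<in>S. \<bar>x - c\<bar> < r \<longrightarrow> ?Z x) \<or> (\<forall>x\<in>S. \<bar>x - c\<bar> < r \<longrightarrow> \<not> ?Z x)"
      using analytic_within_dichotomy[OF f[OF c] subsetD[OF S(2) c]]
    proof (elim disjE)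
      assume "?Z c"
      then have "eventually ?Z (nhds_within c J)" by (rule eventually_eventually_nhds_within)
      then show ?thesis using S(2) unfolding eventually_nhds_within by blast
    next
      assume nz: "eventually (\<lambda>t. f t \<noteq> 0) (at c within J)"
      then obtain r where r: "r > 0" "\<And>x. x \<in> J \<Longrightarrow> x \<noteq> c \<Longrightarrow> \<bar>x - c\<bar> < r \<Longrightarrow> f x \<noteq> 0"
        unfolding eventually_at dist_real_def by blast
      have "\<not> ?Z x" if x: "x \<in> S" "\<bar>x - c\<bar> < r" for x
      proof (cases "x = c")
        case True
        have "at c within J \<noteq> bot" using J[OF c] by (simp add: trivial_limit_within)
        then show ?thesis
          using eventually_conj[OF nz eventually_within_nhds_within[of "\<lambda>t. f t = 0" c J]] True
            eventually_False[of "at c within J"] by auto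
      next
        case False
        then have "f x \<noteq> 0" using r(2) x S(2) by blast
        then show ?thesis using eventually_nhds_within_self[of "\<lambda>t. f t = 0" x J] x S(2) by blast
      qed
      then show ?thesis using r(1) by blast
    qed
    then obtain r where r: "r > 0"
      "(\<forall>x\<in>S. \<bar>x - c\<bar> < r \<longrightarrow> ?Z x) \<or> (\<forall>x\<in>S. \<bar>x - c\<bar> < r \<longrightarrow> \<not> ?Z x)" by blast
    show "\<exists>T. openin (top_of_set S) T \<and> c \<in> T \<and> (\<forall>x\<in>T. \<forall>y\<in>T. ?Z x \<longrightarrow> ?Z y)"
      using r c by (intro exI[of _ "S \<inter> ball c r"])
        (auto simp: openin_open dist_real_def abs_minus_commute)
  qed
qed

lemma analytic_mat_identity:
  assumes V: "\<And>s. s \<ge> t0 \<Longrightarrow> analytic_mat {t0..} s V"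
    and a: "a \<ge> t0" "eventually (\<lambda>t. V t = 0) (nhds_within a {t0..})" and b: "b \<ge> t0"
  shows "V b = 0"
proof -
  have "V b $ i $ j = 0" for i j
  proof -
    have "eventually (\<lambda>t. V t $ i $ j = 0) (nhds_within b {t0..})"
    proof (rule analytic_within_identity[where S = "{t0..}" and a = a])
      show "eventually (\<lambda>t. V t $ i $ j = 0) (nhds_within a {t0..})"
        using a(2) by eventually_elim simp
    qed (use a b V islimpt_atLeast in \<open>auto simp: analytic_mat_def\<close>)
    then show ?thesis using b eventually_nhds_within_self[of "\<lambda>t. V t $ i $ j = 0" b "{t0..}"] by simp
  qed
  then show ?thesis by (simp add: vec_eq_iff)
qed

text \<open>Germs have no zero divisors. The vanishing member may depend on \<open>t\<close> in the
  assumption; in the conclusion a single one works throughout a neighbourhood.\<close>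

lemma analytic_within_prod_eq_0:
  assumes "finite F" "\<And>f. f \<in> F \<Longrightarrow> analytic_within J s (h f)" "s \<in> J" "s islimpt J"
    and "eventually (\<lambda>t. \<exists>f\<in>F. h f t = 0) (nhds_within s J)"
  shows "\<exists>f\<in>F. eventually (\<lambda>t. h f t = 0) (nhds_within s J)"
proof (rule ccontr)
  assume "\<not> ?thesis"
  then have "\<forall>f\<in>F. eventually (\<lambda>t. h f t \<noteq> 0) (at s within J)"
    using analytic_within_dichotomy[OF assms(2,3)] by blast
  then have "eventually (\<lambda>t. \<forall>f\<in>F. h f t \<noteq> 0) (at s within J)"
    using assms(1) by (simp add: eventually_ball_finite)
  then have "eventually (\<lambda>_. False) (at s within J)"
    using eventually_within_nhds_within[OF assms(5)] by eventually_elim blast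
  then show False using assms(4) by (simp add: trivial_limit_within eventually_False)
qed

text \<open>A branch continued up to a point \<open>x\<close> near \<open>a\<close> coincides around \<open>x\<close> with one of the finitely many
  branches available near \<open>a\<close>, and that one continues it past \<open>a\<close>.\<close>

lemma analytic_branch_continuation:
  fixes Z :: "real \<Rightarrow> complex set"
  assumes loc: "\<And>s. s \<ge> t0 \<Longrightarrow> \<exists>F. finite F \<and> (\<forall>f\<in>F. analytic_within {t0..} s f) \<and>
      eventually (\<lambda>t. Z t = (\<lambda>f. f t) ` F) (nhds_within s {t0..})"
    and h: "analytic_within {t0..} t0 h" "eventually (\<lambda>t. h t \<in> Z t) (nhds_within t0 {t0..})"
  obtains g where "\<And>s. s \<ge> t0 \<Longrightarrow> analytic_within {t0..} s g" "\<And>t. t \<ge> t0 \<Longrightarrow> g t \<in> Z t"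
    "eventually (\<lambda>t. g t = h t) (nhds_within t0 {t0..})"
proof -
  let ?J = "{t0..}"
  \<comment> \<open>\<open>g\<close> is a partial continuation of \<open>h\<close>, defined up to
    but not including \<open>T\<close>.\<close>
  define good where "good T g \<longleftrightarrow> T > t0 \<and> (\<forall>s. t0 \<le> s \<and> s < T \<longrightarrow> analytic_within ?J s g \<and> g s \<in> Z s) \<and>
      eventually (\<lambda>t. g t = h t) (nhds_within t0 ?J)" for T g
  have unique: "g t = g' t" if "good T g" "good T' g'" "t0 \<le> t" "t < T" "t < T'" for T T' g g' t
  proof -
    have "eventually (\<lambda>t. g t - g' t = 0) (nhds_within t ?J)"
    proof (rule analytic_within_identity[where S = "{t0..t}" and a = t0])
      show "analytic_within ?J s (\<lambda>t. g t - g' t)" if "s \<in> {t0..t}" for s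
        using that \<open>good T g\<close> \<open>good T' g'\<close> \<open>t < T\<close> \<open>t < T'\<close>
        by (intro analytic_within_diff) (auto simp: good_def)
      have "eventually (\<lambda>t. g t = h t) (nhds_within t0 ?J)" "eventually (\<lambda>t. g' t = h t) (nhds_within t0 ?J)"
        using \<open>good T g\<close> \<open>good T' g'\<close> by (simp_all add: good_def)
      then show "eventually (\<lambda>t. g t - g' t = 0) (nhds_within t0 ?J)" by eventually_elim simp
    qed (use that islimpt_atLeast in auto)
    then show ?thesis
      using eventually_nhds_within_self[of "\<lambda>t. g t - g' t = 0" t ?J] that(3) by simp
  qed
  have loc': "\<exists>r>0. \<exists>F. finite F \<and> (\<forall>t\<ge>t0. \<bar>t - s\<bar> < r \<longrightarrow> (\<forall>f\<in>F. analytic_within ?J t f) \<and> Z t = (\<lambda>f. f t) ` F)"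
    if s: "s \<ge> t0" for s
  proof -
    obtain F where F: "finite F" "\<forall>f\<in>F. analytic_within ?J s f"
      "eventually (\<lambda>t. Z t = (\<lambda>f. f t) ` F) (nhds_within s ?J)" using loc[OF s] by blast
    have "eventually (\<lambda>t. \<forall>f\<in>F. analytic_within ?J t f) (nhds_within s ?J)"
      using F(1,2) by (simp add: eventually_ball_finite analytic_within_eventually)
    with F(3) have "eventually (\<lambda>t. (\<forall>f\<in>F. analytic_within ?J t f) \<and> Z t = (\<lambda>f. f t) ` F) (nhds_within s ?J)"
      by eventually_elim simp
    then obtain r where "r > 0" "\<forall>t\<in>?J. \<bar>t - s\<bar> < r \<longrightarrow> (\<forall>f\<in>F. analytic_within ?J t f) \<and> Z t = (\<lambda>f. f t) ` F"
      unfolding eventually_nhds_within by blast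
    then show ?thesis using F(1) by (intro exI[of _ r] conjI exI[of _ F]) auto
  qed
  let ?P = "\<lambda>t. \<exists>T>t. \<exists>g. good T g"
  have "?P t0"
  proof -
    have "eventually (\<lambda>t. analytic_within ?J t h \<and> h t \<in> Z t) (nhds_within t0 ?J)"
      using analytic_within_eventually[OF h(1)] h(2) by eventually_elim simp
    then obtain r where r: "r > 0" "\<And>t. t \<ge> t0 \<Longrightarrow> \<bar>t - t0\<bar> < r \<Longrightarrow> analytic_within ?J t h \<and> h t \<in> Z t"
      unfolding eventually_nhds_within by (metis atLeast_iff)
    then have "good (t0 + r) h" by (auto simp: good_def)
    then show ?thesis using r(1) by (intro exI[of _ "t0 + r"]) auto
  qed
  have all: "?P t" if "t \<ge> t0" for t
  proof (rule connected_induction_simple[of ?J t0 t ?P])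
    show "connected ?J" "t0 \<in> ?J" "t \<in> ?J" using that by auto
    show "?P t0" by fact
    fix a assume "a \<in> ?J"
    then obtain r F where r: "r > 0" and F: "finite F"
      "\<And>t. t \<ge> t0 \<Longrightarrow> \<bar>t - a\<bar> < r \<Longrightarrow> (\<forall>f\<in>F. analytic_within ?J t f) \<and> Z t = (\<lambda>f. f t) ` F"
      using loc'[of a] by auto
    have step: "?P y" if x: "x \<ge> t0" "\<bar>x - a\<bar> < r" "?P x" and y: "y \<ge> t0" "\<bar>y - a\<bar> < r" for x y
    proof -
      obtain T g where T: "T > x" "good T g" using x(3) by blast
      have ana: "analytic_within ?J s g" "g s \<in> Z s" if "t0 \<le> s" "s < T" for s
        using T(2) that by (auto simp: good_def)
      have "\<exists>f\<in>F. eventually (\<lambda>t. g t - f t = 0) (nhds_within x ?J)"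
      proof (rule analytic_within_prod_eq_0[OF F(1)])
        show "analytic_within ?J x (\<lambda>t. g t - f t)" if "f \<in> F" for f
          using that ana(1)[OF x(1) T(1)] F(2)[OF x(1,2)] by (intro analytic_within_diff) auto
        have gZ: "g t \<in> Z t" "Z t = (\<lambda>f. f t) ` F" if "t \<in> ?J" "\<bar>t - x\<bar> < min (T - x) (r - \<bar>x - a\<bar>)" for t
          using that ana(2)[of t] F(2)[of t] by auto
        then have "eventually (\<lambda>t. g t \<in> Z t \<and> Z t = (\<lambda>f. f t) ` F) (nhds_within x ?J)"
          unfolding eventually_nhds_within using T(1) x(2)
          by (intro exI[of _ "min (T - x) (r - \<bar>x - a\<bar>)"] conjI ballI impI gZ) simp_all
        then show "eventually (\<lambda>t. \<exists>f\<in>F. g t - f t = 0) (nhds_within x ?J)"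
          by eventually_elim auto
      qed (use x islimpt_atLeast in auto)
      then obtain f where f: "f \<in> F" and eq: "eventually (\<lambda>t. g t = f t) (nhds_within x ?J)" by auto
      \<comment> \<open>Glueing at \<open>x\<close>, where \<open>g\<close> and \<open>f\<close>
        have the same germ, so that the result is analytic there as well.\<close>
      define G where "G t = (if t \<le> x then g t else f t)" for t
      have "analytic_within ?J s G \<and> G s \<in> Z s" if s: "t0 \<le> s" "s < a + r" for s
      proof -
        consider "s < x" | "s = x" | "x < s" by linarith
        then show ?thesis
        proof cases
          case 1
          then have "eventually (\<lambda>t. G t = g t) (nhds_within s ?J)"
            unfolding eventually_nhds_within by (intro exI[of _ "x - s"]) (auto simp: G_def)
          then show ?thesis using analytic_within_cong ana[of s] s 1 T(1) by (simp add: G_def)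
        next
          case 2
          have "eventually (\<lambda>t. G t = f t) (nhds_within x ?J)"
            using eq by eventually_elim (simp add: G_def)
          then show ?thesis using analytic_within_cong F(2)[OF x(1,2)] f 2 ana(2)[OF x(1) T(1)]
            by (auto simp: G_def)
        next
          case 3
          then have "eventually (\<lambda>t. G t = f t) (nhds_within s ?J)"
            unfolding eventually_nhds_within by (intro exI[of _ "s - x"]) (auto simp: G_def)
          moreover have "\<bar>s - a\<bar> < r" using 3 s x(2) by linarith
          ultimately show ?thesis using analytic_within_cong F(2)[OF s(1)] f 3
            by (auto simp: G_def)
        qed
      qed
      moreover have "eventually (\<lambda>t. G t = h t) (nhds_within t0 ?J)"
      proof (cases "x = t0")
        case True
        have "eventually (\<lambda>t. g t = h t) (nhds_within t0 ?J)" using T(2) by (simp add: good_def)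
        with eq[unfolded True] show ?thesis by eventually_elim (simp add: G_def)
      next
        case False
        have "eventually (\<lambda>t. g t = h t) (nhds_within t0 ?J)" using T(2) by (simp add: good_def)
        moreover have "eventually (\<lambda>t. G t = g t) (nhds_within t0 ?J)"
          unfolding eventually_nhds_within using False x(1)
          by (intro exI[of _ "x - t0"]) (auto simp: G_def)
        ultimately show ?thesis by eventually_elim simp
      qed
      ultimately have "good (a + r) G" using y by (auto simp: good_def)
      then show ?thesis using y(2) by (intro exI[of _ "a + r"]) auto
    qed
    show "\<exists>T. openin (top_of_set ?J) T \<and> a \<in> T \<and> (\<forall>x\<in>T. \<forall>y\<in>T. ?P x \<longrightarrow> ?P y)"
    proof (intro exI[of _ "?J \<inter> ball a r"] conjI ballI impI)
      show "openin (top_of_set ?J) (?J \<inter> ball a r)" by (rule openin_open_Int) simp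
      show "a \<in> ?J \<inter> ball a r" using r \<open>a \<in> ?J\<close> by simp
      fix x y assume "x \<in> ?J \<inter> ball a r" "y \<in> ?J \<inter> ball a r" and P: "?P x"
      then have xy: "x \<ge> t0" "\<bar>x - a\<bar> < r" "y \<ge> t0" "\<bar>y - a\<bar> < r"
        by (simp_all add: dist_real_def abs_minus_commute)
      show "?P y" by (rule step[OF xy(1,2) P xy(3,4)])
    qed
  qed
  \<comment> \<open>At each \<open>t\<close> the value of some continuation reaching beyond
    \<open>t\<close>; by uniqueness the choice does not matter.\<close>
  define G where "G t = (SOME g. \<exists>T>t. good T g) t" for t
  have G: "G t = g t" if "good T g" "t0 \<le> t" "t < T" for T g t
  proof -
    have "\<exists>T>t. good T (SOME g. \<exists>T>t. good T g)"
      using that by (intro someI_ex[of "\<lambda>g. \<exists>T>t. good T g"]) blast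
    then show ?thesis unfolding G_def using unique that by blast
  qed
  have near: "eventually (\<lambda>t. G t = g t) (nhds_within s ?J)" if "good T g" "t0 \<le> s" "s < T" for T g s
    unfolding eventually_nhds_within using that G[OF that(1)] by (intro exI[of _ "T - s"]) auto
  show thesis
  proof (rule that)
    fix s assume "s \<ge> t0"
    then obtain T g where T: "s < T" "good T g" using all by blast
    then show "analytic_within ?J s G" "G s \<in> Z s"
      using analytic_within_cong[OF near[OF T(2) \<open>s \<ge> t0\<close> T(1)]] G[OF T(2) \<open>s \<ge> t0\<close> T(1)] \<open>s \<ge> t0\<close>
      by (auto simp: good_def)
  next
    obtain T g where T: "t0 < T" "good T g" using all[of t0] by blast
    have "eventually (\<lambda>t. g t = h t) (nhds_within t0 ?J)" using T(2) by (simp add: good_def)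
    with near[OF T(2) order_refl T(1)] show "eventually (\<lambda>t. G t = h t) (nhds_within t0 ?J)"
      by eventually_elim simp
  qed
qed

section \<open>Analytic vector functions and removable singularities\<close>

definition analytic_vec :: "real set \<Rightarrow> real \<Rightarrow> (real \<Rightarrow> complex^'n::finite) \<Rightarrow> bool" where
  "analytic_vec J s v \<longleftrightarrow> (\<forall>i. analytic_within J s (\<lambda>t. v t $ i))"

lemma analytic_vec_mult: "analytic_mat J s A \<Longrightarrow> analytic_vec J s v \<Longrightarrow> analytic_vec J s (\<lambda>t. A t *v v t)"
  unfolding analytic_vec_def analytic_mat_def matrix_vector_mult_def
  by (auto intro!: analytic_within_sum analytic_within_mult)

lemma analytic_vec_simps:
  "analytic_vec J s (\<lambda>_. x)"
  "analytic_vec J s v \<Longrightarrow> analytic_vec J s w \<Longrightarrow> analytic_vec J s (\<lambda>t. v t - w t)"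
  "analytic_within J s f \<Longrightarrow> analytic_vec J s v \<Longrightarrow> analytic_vec J s (\<lambda>t. f t *s v t)"
  unfolding analytic_vec_def by auto

lemma analytic_within_cdot:
  "analytic_vec J s v \<Longrightarrow> analytic_vec J s w \<Longrightarrow> analytic_within J s (\<lambda>t. cdot (v t) (w t))"
  unfolding analytic_vec_def cdot_def
  by (intro analytic_within_sum analytic_within_mult analytic_within_cnj) auto

lemma analytic_mat_outer:
  "analytic_vec J s v \<Longrightarrow> analytic_vec J s w \<Longrightarrow> analytic_mat J s (\<lambda>t. outer (v t) (w t))"
  unfolding analytic_vec_def analytic_mat_def outer_def
  by (auto intro!: analytic_within_mult analytic_within_cnj)

lemma analytic_vec_limit_eq:
  assumes "analytic_vec J s v" "analytic_vec J s w" "s \<in> J" "s islimpt J"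
    "eventually (\<lambda>t. v t = w t) (at s within J)"
  shows "v s = w s"
proof -
  have lim: "(v \<longlongrightarrow> v s) (at s within J)" "(w \<longlongrightarrow> w s) (at s within J)"
    using assms(1-3) unfolding analytic_vec_def by (auto intro!: vec_tendstoI analytic_within_tendsto)
  then have "(v \<longlongrightarrow> w s) (at s within J)" using tendsto_cong[OF assms(5)] by simp
  then show ?thesis using tendsto_unique lim(1) assms(4) trivial_limit_within by blast
qed

text \<open>Reduced to matrices through \<open>outer v v\<close>, whose trace is the squared norm of
  \<open>v\<close>.\<close>

lemma analytic_vec_identity:
  assumes v: "\<And>s. s \<ge> t0 \<Longrightarrow> analytic_vec {t0..} s v"
    and a: "a \<ge> t0" "eventually (\<lambda>t. v t = 0) (nhds_within a {t0..})" and b: "b \<ge> t0"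
  shows "v b = 0"
proof -
  have "outer (v b) (v b) = 0"
    by (rule analytic_mat_identity[where V = "\<lambda>t. outer (v t) (v t)", OF _ a(1) _ b])
      (use v a(2) in \<open>auto intro: analytic_mat_outer elim: eventually_mono\<close>)
  then have "mtrace (outer (v b) (v b)) = 0" by simp
  then show ?thesis by (simp add: mtrace_outer cdot_self)
qed

text \<open>Local extensions \<open>k\<close> vary with \<open>s\<close>. Defining the value at
  every point as a limit produces one function that agrees with each of them.\<close>

lemma removable_extension:
  assumes loc: "\<And>s. s \<in> J \<Longrightarrow> s islimpt J \<and> (\<exists>k. analytic_within J s k \<and> eventually (\<lambda>t. q t = k t) (at s within J))"
    and s: "s \<in> J"
  shows "analytic_within J s (\<lambda>t. Lim (at t within J) q)"
    and "eventually (\<lambda>t. Lim (at t within J) q = q t) (at s within J)"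
proof -
  obtain k where k: "analytic_within J s k" "eventually (\<lambda>t. q t = k t) (at s within J)"
    using loc[OF s] by blast
  have Lim: "Lim (at t within J) q = k t"
    if "t \<in> J" "analytic_within J t k" "eventually (\<lambda>t. q t = k t) (at t within J)" for t
  proof (rule tendsto_Lim)
    show "\<not> trivial_limit (at t within J)" using loc[OF that(1)] by (simp add: trivial_limit_within)
    show "(q \<longlongrightarrow> k t) (at t within J)"
      using tendsto_cong[OF that(3)] analytic_within_tendsto[OF that(2,1)] by simp
  qed
  obtain r where r: "r > 0" "\<And>t. t \<in> J \<Longrightarrow> t \<noteq> s \<Longrightarrow> \<bar>t - s\<bar> < r \<Longrightarrow> q t = k t"
    using k(2) unfolding eventually_at dist_real_def by blast
  have "eventually (\<lambda>t. q t = k t) (at t within J)" if "t \<in> J" "\<bar>t - s\<bar> < r" for t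
  proof (cases "t = s")
    case False
    have "q x = k x" if "x \<in> J" "\<bar>x - t\<bar> < min \<bar>t - s\<bar> (r - \<bar>t - s\<bar>)" for x
      by (rule r(2)) (use that in auto)
    moreover have "min \<bar>t - s\<bar> (r - \<bar>t - s\<bar>) > 0" using False that by simp
    ultimately show ?thesis unfolding eventually_at dist_real_def by blast
  qed (use k in simp)
  then have "eventually (\<lambda>t. t \<in> J \<longrightarrow> eventually (\<lambda>t. q t = k t) (at t within J)) (nhds_within s J)"
    unfolding eventually_nhds_within using r(1) by blast
  moreover have "eventually (\<lambda>t. t \<in> J) (nhds_within s J)" by (rule eventually_nhds_within_in)
  ultimately have ev: "eventually (\<lambda>t. Lim (at t within J) q = k t) (nhds_within s J)"
    using analytic_within_eventually[OF k(1)]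
  proof eventually_elim
    case (elim t)
    show ?case by (rule Lim) (use elim in auto)
  qed
  then show "analytic_within J s (\<lambda>t. Lim (at t within J) q)"
    by (rule analytic_within_cong) (rule k(1))
  show "eventually (\<lambda>t. Lim (at t within J) q = q t) (at s within J)"
    using eventually_within_nhds_within[OF ev] k(2) by eventually_elim simp
qed

text \<open>Only germs that do not vanish can be factored; vanishing near any \<open>s\<close> would
  propagate to \<open>t0\<close> by the identity theorem.\<close>

lemma analytic_vec_factor:
  fixes v :: "real \<Rightarrow> complex^'n::finite"
  assumes v: "\<And>s. s \<ge> t0 \<Longrightarrow> analytic_vec {t0..} s v" and s: "s \<ge> t0"
    and nz: "\<not> eventually (\<lambda>t. v t = 0) (nhds_within t0 {t0..})"
  obtains k h where "analytic_vec {t0..} s h" "h s \<noteq> 0"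
    "eventually (\<lambda>t. v t = of_real (t - s) ^ k *s h t) (nhds_within s {t0..})"
proof -
  have "\<And>i. analytic_within {t0..} s (\<lambda>t. v t $ i)" using v[OF s] by (simp add: analytic_vec_def)
  then show thesis
  proof (rule analytic_family_factor)
    assume 0: "eventually (\<lambda>t. \<forall>i. v t $ i = 0) (nhds_within s {t0..})"
    have 1: "eventually (\<lambda>t. v t = 0) (nhds_within s {t0..})"
      using 0 by eventually_elim (simp add: vec_eq_iff)
    have "v t = 0" if "t \<ge> t0" for t by (rule analytic_vec_identity[OF v s 1 that])
    then have "eventually (\<lambda>t. v t = 0) (nhds_within t0 {t0..})"
      using eventually_nhds_within_in by (rule eventually_mono[rotated]) auto
    with nz show thesis by blast
  next
    fix k g i0
    assume g: "\<And>i. analytic_within {t0..} s (g i)" "g i0 s \<noteq> 0"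
      "eventually (\<lambda>t. \<forall>i. v t $ i = of_real (t - s) ^ k * g i t) (nhds_within s {t0..})"
    show thesis
    proof (rule that[of "\<lambda>t. \<chi> i. g i t" k])
      show "analytic_vec {t0..} s (\<lambda>t. \<chi> i. g i t)" using g(1) by (simp add: analytic_vec_def)
      show "(\<chi> i. g i s) \<noteq> 0" using g(2) by (auto simp: vec_eq_iff)
      show "eventually (\<lambda>t. v t = of_real (t - s) ^ k *s (\<chi> i. g i t)) (nhds_within s {t0..})"
        using g(3) by eventually_elim (simp add: vec_eq_iff)
    qed
  qed
qed

text \<open>The norm of an analytic vector function is not analytic where it vanishes to odd order, but up
  to a sign it is. Dividing by an analytic branch of \<open>\<plusminus>norm\<close> leaves removable singularities.\<close>

lemma analytic_unit_direction:
  fixes v :: "real \<Rightarrow> complex^'n::finite"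
  assumes v: "\<And>s. s \<ge> t0 \<Longrightarrow> analytic_vec {t0..} s v"
    and nz: "\<not> eventually (\<lambda>t. v t = 0) (nhds_within t0 {t0..})"
  obtains e where "\<And>s. s \<ge> t0 \<Longrightarrow> analytic_vec {t0..} s e" "\<And>s. s \<ge> t0 \<Longrightarrow> norm (e s) = 1"
    "\<And>s. s \<ge> t0 \<Longrightarrow> eventually (\<lambda>t. \<exists>z. e t = z *s v t) (at s within {t0..})"
proof -
  let ?J = "{t0..}"
  have loc: "\<exists>k h \<nu>. analytic_vec ?J s h \<and> analytic_within ?J s \<nu> \<and> \<nu> s \<noteq> 0 \<and>
      eventually (\<lambda>t. v t = of_real (t - s) ^ k *s h t \<and> \<nu> t = of_real (norm (h t)) \<and> \<nu> t \<noteq> 0) (nhds_within s ?J)"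
    if s: "s \<ge> t0" for s
  proof -
    obtain k h where h: "analytic_vec ?J s h" "h s \<noteq> 0"
      "eventually (\<lambda>t. v t = of_real (t - s) ^ k *s h t) (nhds_within s ?J)"
      using analytic_vec_factor[OF v s nz] by blast
    \<comment> \<open>The norm of the cofactor \<open>h\<close> is the square root of an analytic
      function that is positive at \<open>s\<close>, so the norm itself is analytic there.\<close>
    have eq: "csqrt (cdot (h t) (h t)) = of_real (norm (h t))" for t
      by (simp add: cdot_self real_sqrt_abs csqrt_of_real_nonneg del: of_real_power)
    have \<nu>: "analytic_within ?J s (\<lambda>t. csqrt (cdot (h t) (h t)))"
    proof (rule analytic_within_csqrt)
      show "cdot (h s) (h s) \<notin> \<real>\<^sub>\<le>\<^sub>0" using h(2) by (simp add: cdot_self del: of_real_power)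
    qed (use h s analytic_within_cdot in auto)
    have "csqrt (cdot (h s) (h s)) \<noteq> 0" using h(2) eq by simp
    moreover have "eventually (\<lambda>t. csqrt (cdot (h t) (h t)) \<noteq> 0) (nhds_within s ?J)"
      by (rule analytic_within_eventually_nonzero[OF \<nu>]) (use s calculation in auto)
    with h(3) have "eventually (\<lambda>t. v t = of_real (t - s) ^ k *s h t \<and>
        csqrt (cdot (h t) (h t)) = of_real (norm (h t)) \<and> csqrt (cdot (h t) (h t)) \<noteq> 0) (nhds_within s ?J)"
      by eventually_elim (simp only: eq simp_thms)
    ultimately show ?thesis using h(1) \<nu>
      by (intro exI[of _ k] exI[of _ h] exI[of _ "\<lambda>t. csqrt (cdot (h t) (h t))"]) simp
  qed
  \<comment> \<open>Locally these two values are \<open>(t - s) ^ k * \<nu> t\<close> and its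
    negative, an analytic pair even where the norm of \<open>v\<close> has a corner. Continuation
    inside \<open>Z\<close> selects the sign globally.\<close>
  define Z where "Z t = {z. z\<^sup>2 = (complex_of_real (norm (v t)))\<^sup>2}" for t
  have norm_v: "complex_of_real (norm (v t)) ^ 2 = (of_real (t - s) ^ k * \<nu> t) ^ 2"
    if "v t = of_real (t - s) ^ k *s h t \<and> \<nu> t = of_real (norm (h t)) \<and> \<nu> t \<noteq> 0" for t s k h \<nu>
  proof -
    have "norm (v t) = \<bar>t - s\<bar> ^ k * norm (h t)"
      using that by (simp add: norm_vec_smult norm_power flip: of_real_diff)
    then have "(norm (v t))\<^sup>2 = ((t - s) ^ k * norm (h t))\<^sup>2"
      by (simp add: power_mult_distrib power_even_abs flip: power_mult)
    then have "complex_of_real ((norm (v t))\<^sup>2) = of_real (((t - s) ^ k * norm (h t))\<^sup>2)" by simp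
    then show ?thesis using that by simp
  qed
  have locZ: "\<exists>F. finite F \<and> (\<forall>f\<in>F. analytic_within ?J s f) \<and> eventually (\<lambda>t. Z t = (\<lambda>f. f t) ` F) (nhds_within s ?J)"
    if s: "s \<ge> t0" for s
  proof -
    obtain k h \<nu> where l: "analytic_within ?J s \<nu>"
      "eventually (\<lambda>t. v t = of_real (t - s) ^ k *s h t \<and> \<nu> t = of_real (norm (h t)) \<and> \<nu> t \<noteq> 0) (nhds_within s ?J)"
      using loc[OF s] by blast
    let ?f = "\<lambda>t. (of_real t - of_real s) ^ k * \<nu> t"
    have f: "analytic_within ?J s ?f"
      by (intro analytic_within_mult analytic_within_power analytic_within_diff l(1)) auto
    have "eventually (\<lambda>t. Z t = (\<lambda>f. f t) ` {?f, \<lambda>t. - ?f t}) (nhds_within s ?J)"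
      using l(2)
    proof eventually_elim
      case (elim t)
      show ?case unfolding Z_def norm_v[where k = k and h = h and \<nu> = \<nu> and s = s, OF elim] power2_eq_iff by auto
    qed
    then show ?thesis using f by (intro exI[of _ "{?f, \<lambda>t. - ?f t}"]) auto
  qed
  obtain h0 where h0: "analytic_within ?J t0 h0" "eventually (\<lambda>t. h0 t \<in> Z t) (nhds_within t0 ?J)"
  proof -
    obtain F where F: "\<forall>f\<in>F. analytic_within ?J t0 f" "eventually (\<lambda>t. Z t = (\<lambda>f. f t) ` F) (nhds_within t0 ?J)"
      using locZ[OF order_refl] by (elim exE conjE)
    have "Z t0 \<noteq> {}" by (auto simp: Z_def)
    moreover have "Z t0 = (\<lambda>f. f t0) ` F" using eventually_nhds_within_self[OF F(2)] by simp
    ultimately obtain f where "f \<in> F" by blast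
    show thesis
    proof (rule that)
      show "analytic_within ?J t0 f" using F(1) \<open>f \<in> F\<close> by (rule bspec)
      show "eventually (\<lambda>t. f t \<in> Z t) (nhds_within t0 ?J)"
        using F(2) by eventually_elim (simp add: \<open>f \<in> F\<close>)
    qed
  qed
  have "\<exists>\<phi>. (\<forall>s\<ge>t0. analytic_within ?J s \<phi>) \<and> (\<forall>t\<ge>t0. \<phi> t \<in> Z t)"
  proof (rule analytic_branch_continuation[OF locZ h0])
    fix g assume "\<And>s. s \<ge> t0 \<Longrightarrow> analytic_within ?J s g" "\<And>t. t \<ge> t0 \<Longrightarrow> g t \<in> Z t"
    then show ?thesis by (intro exI[of _ g] conjI allI impI)
  qed
  then obtain \<phi> where \<phi>: "\<And>s. s \<ge> t0 \<Longrightarrow> analytic_within ?J s \<phi>" "\<And>t. t \<ge> t0 \<Longrightarrow> \<phi> t \<in> Z t"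
    by blast
  define q where "q i t = v t $ i / \<phi> t" for i t
  have punct: "\<exists>w. analytic_vec ?J s w \<and> eventually (\<lambda>t. \<phi> t \<noteq> 0 \<and> v t = \<phi> t *s w t) (at s within ?J)" if s: "s \<ge> t0" for s
  proof -
    obtain k h \<nu> where l: "analytic_vec ?J s h" "analytic_within ?J s \<nu>" "\<nu> s \<noteq> 0"
      "eventually (\<lambda>t. v t = of_real (t - s) ^ k *s h t \<and> \<nu> t = of_real (norm (h t)) \<and> \<nu> t \<noteq> 0) (nhds_within s ?J)"
      using loc[OF s] by blast
    let ?f = "\<lambda>t. (of_real t - of_real s) ^ k * \<nu> t"
    have f: "analytic_within ?J s ?f"
      by (intro analytic_within_mult analytic_within_power analytic_within_diff l(2)) auto
    have "eventually (\<lambda>t. \<exists>c\<in>{1, -1}. \<phi> t - c * ?f t = 0) (nhds_within s ?J)"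
      using l(4) eventually_nhds_within_in
    proof eventually_elim
      case (elim t)
      have "\<phi> t ^ 2 = (of_real (t - s) ^ k * \<nu> t) ^ 2"
        using \<phi>(2)[of t] elim(2) unfolding Z_def norm_v[where k = k and h = h and \<nu> = \<nu> and s = s, OF elim(1)] by simp
      then have "\<phi> t = ?f t \<or> \<phi> t = - ?f t" by (simp add: power2_eq_iff)
      then show ?case by auto
    qed
    \<comment> \<open>The sign could a priori change with \<open>t\<close>; the absence of zero
      divisors fixes it near \<open>s\<close>. The quotient of \<open>v\<close> by
      \<open>\<phi>\<close> is then \<open>h\<close> divided by \<open>c * \<nu>\<close>, and
      \<open>1 / c = c\<close> for a sign.\<close>
    then have "\<exists>c\<in>{1, -1}. eventually (\<lambda>t. \<phi> t - c * ?f t = 0) (nhds_within s ?J)"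
      by (intro analytic_within_prod_eq_0)
        (use s islimpt_atLeast in \<open>auto intro!: analytic_within_diff[OF \<phi>(1)] analytic_within_mult[OF analytic_within_const f]\<close>)
    then obtain c where c: "c = 1 \<or> c = -1" "eventually (\<lambda>t. \<phi> t - c * ?f t = 0) (nhds_within s ?J)" by blast
    have "analytic_vec ?J s (\<lambda>t. (c / \<nu> t) *s h t)"
      by (intro analytic_vec_simps(3) analytic_within_divide l) (use s in auto)
    moreover have "eventually (\<lambda>t. \<phi> t \<noteq> 0 \<and> v t = \<phi> t *s ((c / \<nu> t) *s h t)) (at s within ?J)"
      using eventually_within_nhds_within[OF c(2)] eventually_within_nhds_within[OF l(4)] eventually_neq_at_within[of s s ?J]
    proof eventually_elim
      case (elim t)
      have "\<phi> t = c * (of_real (t - s) ^ k * \<nu> t)" using elim(1) by simp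
      then show ?case using elim(2,3) c(1) by (auto simp: vec_eq_iff)
    qed
    ultimately show ?thesis by blast
  qed
  have q: "\<exists>k. analytic_within ?J s k \<and> eventually (\<lambda>t. q i t = k t) (at s within ?J)" if s: "s \<ge> t0" for s i
  proof -
    obtain w where w: "analytic_vec ?J s w" "eventually (\<lambda>t. \<phi> t \<noteq> 0 \<and> v t = \<phi> t *s w t) (at s within ?J)"
      using punct[OF s] by blast
    have "eventually (\<lambda>t. q i t = w t $ i) (at s within ?J)"
      using w(2) by eventually_elim (simp add: q_def)
    then show ?thesis using w(1) unfolding analytic_vec_def by blast
  qed
  define e where "e t = (\<chi> i. Lim (at t within ?J) (q i))" for t
  have ext: "analytic_within ?J s (\<lambda>t. Lim (at t within ?J) (q i))"
    "eventually (\<lambda>t. Lim (at t within ?J) (q i) = q i t) (at s within ?J)" if "s \<ge> t0" for s i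
    using removable_extension[where J = ?J and q = "q i" and s = s] q that islimpt_atLeast by auto
  have e: "analytic_vec ?J s e" if "s \<ge> t0" for s
    using ext(1)[OF that] by (simp add: analytic_vec_def e_def)
  have ev: "eventually (\<lambda>t. e t = (1 / \<phi> t) *s v t \<and> norm (e t) = 1) (at s within ?J)" if s: "s \<ge> t0" for s
  proof -
    have "eventually (\<lambda>t. \<forall>i. Lim (at t within ?J) (q i) = q i t) (at s within ?J)"
      using ext(2)[OF s] by (simp add: eventually_all_finite)
    moreover have "eventually (\<lambda>t. \<phi> t \<noteq> 0) (at s within ?J)"
      using punct[OF s] by (auto elim: eventually_mono)
    moreover have "eventually (\<lambda>t. t \<in> ?J) (at s within ?J)"
      by (simp add: eventually_at_filter)
    ultimately show ?thesis
    proof eventually_elim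
      case (elim t)
      have e_eq: "e t = (1 / \<phi> t) *s v t" using elim(1) by (simp add: vec_eq_iff e_def q_def)
      have "(\<phi> t)\<^sup>2 = (complex_of_real (norm (v t)))\<^sup>2" using \<phi>(2)[of t] elim(3) by (simp add: Z_def)
      then have "cmod (\<phi> t) = norm (v t)" by (auto simp: power2_eq_iff)
      moreover from this have "v t \<noteq> 0" using elim(2) by (metis norm_eq_zero)
      ultimately have "norm (e t) = 1" by (simp add: e_eq norm_vec_smult norm_divide)
      with e_eq show ?case by simp
    qed
  qed
  show thesis
  proof (rule that[of e])
    fix s assume s: "s \<ge> t0"
    show "analytic_vec ?J s e" by (rule e[OF s])
    show "eventually (\<lambda>t. \<exists>z. e t = z *s v t) (at s within ?J)"
      using ev[OF s] by eventually_elim blast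
    have "(e \<longlongrightarrow> e s) (at s within ?J)"
      using e[OF s] s unfolding analytic_vec_def by (auto intro!: vec_tendstoI analytic_within_tendsto)
    then have "((\<lambda>t. norm (e t)) \<longlongrightarrow> norm (e s)) (at s within ?J)" by (rule tendsto_norm)
    moreover have "((\<lambda>t. norm (e t)) \<longlongrightarrow> 1) (at s within ?J)"
      by (rule tendsto_eventually) (use ev[OF s] in eventually_elim, blast)
    ultimately show "norm (e s) = 1"
      using tendsto_unique islimpt_atLeast[OF s] trivial_limit_within by blast
  qed
qed

section \<open>Analytic orthonormal eigenbases\<close>

lemma proj_ev_real:
  assumes "hermitian A" "hproj P"
  shows "cnj (proj_ev A P) = proj_ev A P"
proof -
  have "cnj (mtrace (A ** P)) = mtrace (P ** A)"
    using assms by (simp add: hermitian_def hproj_def flip: mtrace_simps(6))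
  moreover have "cnj (mtrace P) = mtrace P"
    using assms(2) by (simp add: hproj_def flip: mtrace_simps(6))
  ultimately show ?thesis by (simp add: proj_ev_def mtrace_mult_commute[of P A])
qed

definition eigenvalues_on :: "'n::finite cmat \<Rightarrow> 'n cmat \<Rightarrow> complex set" where
  "eigenvalues_on A Q = {\<mu>. \<exists>w. w \<noteq> 0 \<and> Q *v w = w \<and> A *v w = \<mu> *s w}"

lemma sum_vector_mult: "(\<Sum>i\<in>I. A i) *v w = (\<Sum>i\<in>I. A i *v (w :: complex^'n::finite))"
  by (induction I rule: infinite_finite_induct) (simp_all add: matrix_vector_mult_add_rdistrib)

text \<open>An eigenvector in the range of \<open>Q\<close> has a non-zero component
  \<open>p i *v w\<close>. Taking adjoints of \<open>A ** p i\<close>, with real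
  \<open>proj_ev\<close>, lets \<open>p i\<close> act on the eigenvalue equation from the left, and
  the component identifies the eigenvalue.\<close>

lemma eigenvalues_on_split:
  fixes p :: "'i \<Rightarrow> 'n::finite cmat"
  assumes A: "hermitian A" and F: "finite F" "(\<Sum>i\<in>F. p i) = Q"
    and p: "\<And>i. i \<in> F \<Longrightarrow> hproj (p i) \<and> p i \<noteq> 0 \<and> A ** p i = smul (proj_ev A (p i)) (p i) \<and> Q ** p i = p i"
  shows "eigenvalues_on A Q = (\<lambda>i. proj_ev A (p i)) ` F"
proof (intro equalityI subsetI)
  fix \<mu> assume "\<mu> \<in> eigenvalues_on A Q"
  then obtain w where w: "w \<noteq> 0" "Q *v w = w" "A *v w = \<mu> *s w" by (auto simp: eigenvalues_on_def)
  have "(\<Sum>i\<in>F. p i *v w) = w" using w(2) F(2) by (simp flip: sum_vector_mult)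
  then obtain i where i: "i \<in> F" "p i *v w \<noteq> 0" using w(1) by (metis sum.neutral)
  have "p i ** A = madj (A ** p i)"
    using A p[OF i(1)] unfolding madj_mult hermitian_def hproj_def by simp
  also have "\<dots> = smul (proj_ev A (p i)) (p i)"
    using p[OF i(1)] proj_ev_real[OF A, of "p i"] by (simp add: hproj_def)
  finally have "p i ** A = smul (proj_ev A (p i)) (p i)" .
  then have "p i *v (A *v w) = proj_ev A (p i) *s (p i *v w)"
    by (simp add: matrix_vector_mul_assoc)
  then have "\<mu> *s (p i *v w) = proj_ev A (p i) *s (p i *v w)"
    by (simp add: w(3) matrix_vector_mult_smult)
  moreover obtain j where "(p i *v w) $ j \<noteq> 0" using i(2) by (auto simp: vec_eq_iff)
  ultimately have "\<mu> = proj_ev A (p i)"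
    by (metis mult_right_cancel vector_smult_component)
  then show "\<mu> \<in> (\<lambda>i. proj_ev A (p i)) ` F" using i(1) by blast
next
  fix \<mu> assume "\<mu> \<in> (\<lambda>i. proj_ev A (p i)) ` F"
  then obtain i where i: "i \<in> F" "\<mu> = proj_ev A (p i)" by blast
  obtain w where w: "p i *v w \<noteq> 0" using p[OF i(1)] by (metis matrix_eq matrix_vector_mult_0)
  have "Q *v (p i *v w) = p i *v w" "A *v (p i *v w) = \<mu> *s (p i *v w)"
    using p[OF i(1)] i(2) by (simp_all add: matrix_vector_mul_assoc)
  then show "\<mu> \<in> eigenvalues_on A Q" using w by (auto simp: eigenvalues_on_def)
qed

lemma spectral_split_nonzero:
  assumes F: "spectral_split J s A Q F" and s: "s \<in> J" and P: "P \<in> F"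
  shows "mtrace (P s) \<noteq> 0" "eventually (\<lambda>t. P t \<noteq> 0) (nhds_within s J)"
proof -
  have "hproj (P s)" using eventually_nhds_within_self[OF spectral_splitD(4)[OF F] s] P by simp
  then show tr: "mtrace (P s) \<noteq> 0" using mtrace_hproj_nonzero spectral_splitD(3)[OF F P] by blast
  have "eventually (\<lambda>t. mtrace (P t) \<noteq> 0) (nhds_within s J)"
    by (intro analytic_within_eventually_nonzero analytic_within_mtrace spectral_splitD(2)[OF F P] s tr)
  then show "eventually (\<lambda>t. P t \<noteq> 0) (nhds_within s J)" by eventually_elim auto
qed

lemma analytic_within_proj_ev:
  assumes "spectral_split J s A Q F" "s \<in> J" "P \<in> F" "analytic_mat J s A"
  shows "analytic_within J s (\<lambda>t. proj_ev (A t) (P t))"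
  unfolding proj_ev_def
  by (intro analytic_within_divide analytic_within_mtrace analytic_mat_mult assms
      spectral_splitD(2)[OF assms(1,3)] spectral_split_nonzero(1)[OF assms(1-3)])

lemma eigenvalues_on_locally_analytic:
  fixes A :: "real \<Rightarrow> 'n::finite cmat"
  assumes s: "s \<in> J" and A: "eventually (\<lambda>t. hermitian (A t)) (nhds_within s J)"
    and F: "spectral_split J s A Q F"
  shows "eventually (\<lambda>t. eigenvalues_on (A t) (Q t) = (\<lambda>P. proj_ev (A t) (P t)) ` F) (nhds_within s J)"
proof -
  have "eventually (\<lambda>t. \<forall>P\<in>F. P t \<noteq> 0) (nhds_within s J)"
    using spectral_splitD(1)[OF F] spectral_split_nonzero(2)[OF F s] by (simp add: eventually_ball_finite)
  with A spectral_splitD(4)[OF F] show ?thesis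
  proof eventually_elim
    case (elim t)
    show ?case
      by (rule eigenvalues_on_split[OF elim(1) spectral_splitD(1)[OF F]]) (use elim in auto)
  qed
qed

text \<open>\<open>R\<close> is the product of the matrices \<open>A - g i\<close>. Describing it by
  its effect on eigenmatrices \<open>p\<close> makes the order of the factors irrelevant, so the
  product can be taken over a set.\<close>

lemma scalar_shift_product:
  fixes A Q :: "real \<Rightarrow> 'n::finite cmat"
  assumes F: "finite F" and A: "\<And>s. s \<in> S \<Longrightarrow> analytic_mat J s A"
    and g: "\<And>i s. i \<in> F \<Longrightarrow> s \<in> S \<Longrightarrow> analytic_within J s (g i)"
    and AQ: "\<And>t. t \<in> S \<Longrightarrow> A t ** Q t = Q t ** A t"
  shows "\<exists>R. (\<forall>s\<in>S. analytic_mat J s R \<and> Q s ** R s = R s ** Q s) \<and>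
      (\<forall>t p \<nu>. A t ** p = smul \<nu> p \<longrightarrow> R t ** p = smul (\<Prod>i\<in>F. \<nu> - g i t) p)"
  using F g
proof (induction F)
  case empty
  show ?case by (intro exI[of _ "\<lambda>_. mat 1"]) auto
next
  case (insert i F)
  then obtain R where R: "\<And>s. s \<in> S \<Longrightarrow> analytic_mat J s R" "\<And>s. s \<in> S \<Longrightarrow> Q s ** R s = R s ** Q s"
    "\<And>t p \<nu>. A t ** p = smul \<nu> p \<Longrightarrow> R t ** p = smul (\<Prod>i\<in>F. \<nu> - g i t) p" by auto
  show ?case
  proof (intro exI[of _ "\<lambda>t. (A t - smul (g i t) (mat 1)) ** R t"] conjI ballI allI impI)
    fix s assume s: "s \<in> S"
    show "analytic_mat J s (\<lambda>t. (A t - smul (g i t) (mat 1)) ** R t)"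
      by (intro analytic_mat_mult analytic_mat_simps A R(1) insert.prems s) auto
    have "Q s ** (A s ** R s) = A s ** R s ** Q s"
    proof -
      have "Q s ** (A s ** R s) = A s ** (Q s ** R s)"
        using AQ[OF s] by (simp add: matrix_mul_assoc)
      then show ?thesis by (simp add: R(2)[OF s] matrix_mul_assoc)
    qed
    then show "Q s ** ((A s - smul (g i s) (mat 1)) ** R s) = (A s - smul (g i s) (mat 1)) ** R s ** Q s"
      by (simp add: matrix_mul_diff_ldistrib matrix_mul_diff_rdistrib R(2)[OF s])
  next
    fix t p \<nu> assume p: "A t ** p = smul \<nu> p"
    have "(A t - smul (g i t) (mat 1)) ** R t ** p = (A t - smul (g i t) (mat 1)) ** smul (\<Prod>i\<in>F. \<nu> - g i t) p"
      by (simp only: matrix_mul_assoc[symmetric] R(3)[OF p])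
    also have "\<dots> = smul (\<Prod>i\<in>insert i F. \<nu> - g i t) p"
      using insert.hyps by (simp add: matrix_mul_diff_rdistrib p mult.commute ring_distribs flip: smul_diff(2))
    finally show "(A t - smul (g i t) (mat 1)) ** R t ** p = smul (\<Prod>i\<in>insert i F. \<nu> - g i t) p" .
  qed
qed

text \<open>With \<open>g\<^sub>j\<close> the continued eigenvalues and \<open>g\<close> one of them, the product of all \<open>A - g\<^sub>j\<close>
  with \<open>g\<^sub>j\<close> different from \<open>g\<close> maps the range of \<open>Q\<close> into the eigenspace of \<open>g\<close>.\<close>

lemma analytic_eigenvector:
  fixes A Q :: "real \<Rightarrow> 'n::finite cmat"
  assumes A: "\<And>s. s \<ge> t0 \<Longrightarrow> analytic_mat {t0..} s A" "\<And>t. t \<ge> t0 \<Longrightarrow> hermitian (A t)"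
    and Q: "\<And>s. s \<ge> t0 \<Longrightarrow> analytic_mat {t0..} s Q" "\<And>t. t \<ge> t0 \<Longrightarrow> hproj (Q t)"
    and AQ: "\<And>t. t \<ge> t0 \<Longrightarrow> A t ** Q t = Q t ** A t" and nz: "Q t0 \<noteq> 0"
  shows "\<exists>e ev. \<forall>s\<ge>t0. analytic_vec {t0..} s e \<and> analytic_within {t0..} s ev \<and>
      norm (e s) = 1 \<and> Q s *v e s = e s \<and> A s *v e s = ev s *s e s"
proof -
  let ?J = "{t0..}"
  have near: "eventually (\<lambda>t. hermitian (A t)) (nhds_within s ?J)" "eventually (\<lambda>t. hproj (Q t)) (nhds_within s ?J)"
    "eventually (\<lambda>t. A t ** Q t = Q t ** A t) (nhds_within s ?J)" for s
    by (rule eventually_mono[OF eventually_nhds_within_in], simp add: A Q AQ)+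
  have split: "\<exists>F. spectral_split ?J s A Q F" if s: "s \<ge> t0" for s
  proof -
    obtain N where "Re (mtrace (Q s)) < of_nat N" using reals_Archimedean2 by blast
    then show ?thesis
      using s by (intro local_spectral_split[OF _ islimpt_atLeast[OF s] A(1)[OF s] near(1) Q(1)[OF s] near(2,3)]) auto
  qed
  define Z where "Z t = eigenvalues_on (A t) (Q t)" for t
  have loc: "\<exists>F. finite F \<and> (\<forall>f\<in>F. analytic_within ?J s f) \<and> eventually (\<lambda>t. Z t = (\<lambda>f. f t) ` F) (nhds_within s ?J)"
    if s: "s \<ge> t0" for s
  proof -
    obtain F where F: "spectral_split ?J s A Q F" using split[OF s] by blast
    have "eventually (\<lambda>t. Z t = (\<lambda>f. f t) ` ((\<lambda>P t. proj_ev (A t) (P t)) ` F)) (nhds_within s ?J)"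
      using eigenvalues_on_locally_analytic[OF _ near(1) F] s
      unfolding image_image Z_def by simp
    then show ?thesis
      using spectral_splitD(1)[OF F] analytic_within_proj_ev[OF F _ _ A(1)[OF s]] s
      by (intro exI[of _ "(\<lambda>P t. proj_ev (A t) (P t)) ` F"]) simp
  qed
  obtain F where F: "spectral_split ?J t0 A Q F" using split[OF order_refl] by blast
  have "t0 \<in> ?J" by simp
  note F0 = eventually_nhds_within_self[OF spectral_splitD(4)[OF F] this]
  have "F \<noteq> {}" using F0 nz by auto
  then obtain P1 where P1: "P1 \<in> F" by blast
  have "\<exists>g. (\<forall>s\<ge>t0. analytic_within ?J s g) \<and> eventually (\<lambda>t. g t = proj_ev (A t) (P t)) (nhds_within t0 ?J)"
    if P: "P \<in> F" for P
  proof (rule analytic_branch_continuation[OF loc])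
    show "analytic_within ?J t0 (\<lambda>t. proj_ev (A t) (P t))"
      by (rule analytic_within_proj_ev[OF F _ P A(1)]) auto
    show "eventually (\<lambda>t. proj_ev (A t) (P t) \<in> Z t) (nhds_within t0 ?J)"
      using eigenvalues_on_locally_analytic[OF _ near(1) F] unfolding Z_def
      by (rule eventually_mono) (use P in auto)
    fix g assume "\<And>s. t0 \<le> s \<Longrightarrow> analytic_within ?J s g"
      "eventually (\<lambda>t. g t = proj_ev (A t) (P t)) (nhds_within t0 ?J)"
    then show ?thesis by (intro exI[of _ g] conjI allI impI)
  qed
  then have "\<forall>P\<in>F. \<exists>g. (\<forall>s\<ge>t0. analytic_within ?J s g) \<and>
      eventually (\<lambda>t. g t = proj_ev (A t) (P t)) (nhds_within t0 ?J)" by blast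
  from bchoice[OF this] obtain g where
    g: "\<And>P s. P \<in> F \<Longrightarrow> s \<ge> t0 \<Longrightarrow> analytic_within ?J s (g P)" and
    g_ev: "\<And>P. P \<in> F \<Longrightarrow> eventually (\<lambda>t. g P t = proj_ev (A t) (P t)) (nhds_within t0 ?J)" by blast
  \<comment> \<open>Branches with the same germ as \<open>g P1\<close> are left out: their factors
    would annihilate the eigenspace that is to be kept.\<close>
  define F' where "F' = {P \<in> F. \<not> eventually (\<lambda>t. g P1 t - g P t = 0) (nhds_within t0 ?J)}"
  have F': "finite F'" "F' \<subseteq> F" using spectral_splitD(1)[OF F] by (auto simp: F'_def)
  have "\<exists>R. (\<forall>s\<in>?J. analytic_mat ?J s R \<and> Q s ** R s = R s ** Q s) \<and>
      (\<forall>t p \<nu>. A t ** p = smul \<nu> p \<longrightarrow> R t ** p = smul (\<Prod>P\<in>F'. \<nu> - g P t) p)"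
    by (rule scalar_shift_product[OF F'(1)]) (use F' A(1) g AQ in auto)
  then obtain R where R: "\<And>s. s \<ge> t0 \<Longrightarrow> analytic_mat ?J s R" "\<And>s. s \<ge> t0 \<Longrightarrow> Q s ** R s = R s ** Q s"
    and Rp: "\<And>t p \<nu>. A t ** p = smul \<nu> p \<Longrightarrow> R t ** p = smul (\<Prod>P\<in>F'. \<nu> - g P t) p"
    by auto
  define c where "c P t = (\<Prod>P'\<in>F'. g P t - g P' t)" for P t
  have RP: "eventually (\<lambda>t. (\<forall>P\<in>F. A t ** P t = smul (g P t) (P t) \<and> R t ** P t = smul (c P t) (P t)) \<and>
      R t ** Q t = (\<Sum>P\<in>F. smul (c P t) (P t))) (nhds_within t0 ?J)"
  proof -
    have "eventually (\<lambda>t. \<forall>P\<in>F. g P t = proj_ev (A t) (P t)) (nhds_within t0 ?J)"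
      using spectral_splitD(1)[OF F] g_ev by (simp add: eventually_ball_finite)
    with spectral_splitD(4)[OF F] show ?thesis
    proof eventually_elim
      case (elim t)
      then have AP: "A t ** P t = smul (g P t) (P t)" if "P \<in> F" for P using that by simp
      then have RP: "R t ** P t = smul (c P t) (P t)" if "P \<in> F" for P
        using Rp that by (simp add: c_def)
      have "R t ** Q t = (\<Sum>P\<in>F. R t ** P t)"
        using elim(1) by (simp flip: matrix_mul_sum_right)
      also have "\<dots> = (\<Sum>P\<in>F. smul (c P t) (P t))" using RP by simp
      finally show ?case using AP RP by blast
    qed
  qed
  \<comment> \<open>The splitting into projections is available near \<open>t0\<close> only. The
    resulting identity involves globally analytic functions and therefore holds on the whole
    half-line.\<close>
  have ARQ: "A t ** (R t ** Q t) = smul (g P1 t) (R t ** Q t)" if t: "t \<ge> t0" for t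
  proof -
    define V where "V t = A t ** (R t ** Q t) - smul (g P1 t) (R t ** Q t)" for t
    have "V t = 0"
    proof (rule analytic_mat_identity[OF _ order_refl _ t])
      show "analytic_mat ?J s V" if "s \<ge> t0" for s
        unfolding V_def by (intro analytic_mat_simps analytic_mat_mult A(1) R(1) Q(1) g P1 that)
      have "eventually (\<lambda>t. \<forall>P\<in>F - F'. g P1 t - g P t = 0) (nhds_within t0 ?J)"
        using spectral_splitD(1)[OF F] by (simp add: eventually_ball_finite F'_def)
      with RP show "eventually (\<lambda>t. V t = 0) (nhds_within t0 ?J)"
      proof eventually_elim
        case (elim t)
        have "V t = (\<Sum>P\<in>F. smul (c P t) (A t ** P t) - smul (g P1 t) (smul (c P t) (P t)))"
          using elim(1) by (simp add: V_def matrix_mul_sum_right smul_sum sum_subtractf)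
        also have "\<dots> = (\<Sum>P\<in>F. 0)"
        proof (rule sum.cong[OF refl])
          fix P assume P: "P \<in> F"
          have "c P t * (g P t - g P1 t) = 0"
          proof (cases "P \<in> F'")
            case True
            then have "c P t = 0" unfolding c_def using F'(1) by (intro prod_zero) auto
            then show ?thesis by simp
          next
            case False
            then show ?thesis using elim(2) P by simp
          qed
          moreover have "smul (c P t) (A t ** P t) - smul (g P1 t) (smul (c P t) (P t)) = smul (c P t * (g P t - g P1 t)) (P t)"
            using elim(1) P by (simp add: algebra_simps smul_diff)
          ultimately show "smul (c P t) (A t ** P t) - smul (g P1 t) (smul (c P t) (P t)) = 0"
            by (simp only: smul_simps)
        qed
        finally show "V t = 0" by simp
      qed
    qed
    then show ?thesis by (simp add: V_def)
  qed
  obtain v where v: "P1 t0 *v v \<noteq> 0"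
    using spectral_splitD(3)[OF F P1] by (metis matrix_eq matrix_vector_mult_0)
  define f where "f t = (R t ** Q t) *v v" for t
  have f: "analytic_vec ?J s f" if "s \<ge> t0" for s
    unfolding f_def by (intro analytic_vec_mult analytic_mat_mult R(1) Q(1) that analytic_vec_simps(1))
  have Qf: "Q t *v f t = f t" if "t \<ge> t0" for t
  proof -
    have "Q t ** (R t ** Q t) = R t ** (Q t ** Q t)"
      by (simp add: matrix_mul_assoc R(2)[OF that])
    then show ?thesis using Q(2)[OF that] by (simp add: f_def matrix_vector_mul_assoc hproj_def)
  qed
  have Af: "A t *v f t = g P1 t *s f t" if "t \<ge> t0" for t
    using ARQ[OF that] by (simp add: f_def matrix_vector_mul_assoc)
  \<comment> \<open>The \<open>P1\<close> component of \<open>f\<close> is the scalar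
    \<open>c P1\<close> times \<open>P1 t *v v\<close>. If \<open>f\<close> vanished near
    \<open>t0\<close>, some factor \<open>g P1 - g P\<close> with \<open>P\<close> in
    \<open>F'\<close> would have zero germ, contrary to the choice of \<open>F'\<close>.\<close>
  have f_nz: "\<not> eventually (\<lambda>t. f t = 0) (nhds_within t0 ?J)"
  proof
    assume f0: "eventually (\<lambda>t. f t = 0) (nhds_within t0 ?J)"
    obtain i where i: "(P1 t0 *v v) $ i \<noteq> 0" using v by (auto simp: vec_eq_iff)
    have "analytic_vec ?J t0 (\<lambda>t. P1 t *v v)"
      by (intro analytic_vec_mult spectral_splitD(2)[OF F P1] analytic_vec_simps(1))
    then have "eventually (\<lambda>t. (P1 t *v v) $ i \<noteq> 0) (nhds_within t0 ?J)"
      using i by (intro analytic_within_eventually_nonzero) (auto simp: analytic_vec_def)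
    with f0 RP spectral_splitD(4)[OF F]
    have "eventually (\<lambda>t. \<exists>P\<in>F'. g P1 t - g P t = 0) (nhds_within t0 ?J)"
    proof eventually_elim
      case (elim t)
      have "P1 t ** (R t ** Q t) = (\<Sum>P\<in>F. smul (c P t) (P1 t ** P t))"
        using elim(2) by (simp add: matrix_mul_sum_right)
      also have "\<dots> = (\<Sum>P\<in>F. if P = P1 then smul (c P1 t) (P1 t) else 0)"
        using elim(3) P1 by (intro sum.cong) (auto simp: hproj_def)
      finally have "P1 t ** (R t ** Q t) = smul (c P1 t) (P1 t)"
        using P1 spectral_splitD(1)[OF F] by simp
      then have "P1 t *v f t = c P1 t *s (P1 t *v v)"
        by (simp add: f_def matrix_vector_mul_assoc)
      then have "c P1 t *s (P1 t *v v) = 0" using elim(1) by simp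
      then have "c P1 t * (P1 t *v v) $ i = 0" by (metis vector_smult_component zero_index)
      then have "c P1 t = 0" using elim(4) by simp
      then show ?case unfolding c_def using F'(1) by simp
    qed
    then have "\<exists>P\<in>F'. eventually (\<lambda>t. g P1 t - g P t = 0) (nhds_within t0 ?J)"
      using F' P1 g islimpt_atLeast by (intro analytic_within_prod_eq_0) auto
    then show False by (auto simp: F'_def)
  qed
  have "\<exists>e. (\<forall>s\<ge>t0. analytic_vec ?J s e) \<and> (\<forall>s\<ge>t0. norm (e s) = 1) \<and>
      (\<forall>s\<ge>t0. eventually (\<lambda>t. \<exists>z. e t = z *s f t) (at s within ?J))"
  proof (rule analytic_unit_direction[OF f f_nz])
    fix e assume "\<And>s. s \<ge> t0 \<Longrightarrow> analytic_vec ?J s e" "\<And>s. s \<ge> t0 \<Longrightarrow> norm (e s) = 1"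
      "\<And>s. s \<ge> t0 \<Longrightarrow> eventually (\<lambda>t. \<exists>z. e t = z *s f t) (at s within ?J)"
    then show ?thesis by (intro exI[of _ e] conjI allI impI)
  qed
  then obtain e where e: "\<And>s. s \<ge> t0 \<Longrightarrow> analytic_vec ?J s e" "\<And>s. s \<ge> t0 \<Longrightarrow> norm (e s) = 1"
      "\<And>s. s \<ge> t0 \<Longrightarrow> eventually (\<lambda>t. \<exists>z. e t = z *s f t) (at s within ?J)" by blast
  \<comment> \<open>Where \<open>e\<close> is a multiple of \<open>f\<close> it inherits both
    equations; at the possible exceptional point \<open>s\<close> they follow by continuity.\<close>
  have "Q s *v e s = e s \<and> A s *v e s = g P1 s *s e s" if s: "s \<ge> t0" for s
  proof -
    have "eventually (\<lambda>t. t \<in> ?J) (at s within ?J)" by (simp add: eventually_at_filter)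
    with e(3)[OF s] have "eventually (\<lambda>t. Q t *v e t = e t \<and> A t *v e t = g P1 t *s e t) (at s within ?J)"
    proof eventually_elim
      case (elim t)
      then obtain z where "e t = z *s f t" by blast
      then show ?case using Qf[of t] Af[of t] elim(2)
        by (simp add: matrix_vector_mult_smult vector_smult_assoc mult.commute)
    qed
    then show ?thesis
      using s by (auto intro!: analytic_vec_limit_eq[of ?J s "\<lambda>t. Q t *v e t" e]
          analytic_vec_limit_eq[of ?J s "\<lambda>t. A t *v e t" "\<lambda>t. g P1 t *s e t"] analytic_vec_mult A(1) Q(1) e(1)
          analytic_vec_simps(3) g P1 islimpt_atLeast elim: eventually_mono)
  qed
  then show ?thesis using e g[OF P1] by (intro exI[of _ e] exI[of _ "g P1"]) simp
qed

lemma hermitian_eigenvalue_real: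
  assumes "hermitian A" "A *v e = r *s e" "norm e = 1"
  shows "cnj r = r"
proof -
  have "cdot (A *v e) e = cdot e (A *v e)" using assms(1) by (simp add: cdot_adj hermitian_def)
  then show ?thesis using assms(2,3) by (simp add: cdot_smult cdot_self)
qed

text \<open>Induction on the trace of \<open>Q\<close> at \<open>t0\<close> alone: if
  \<open>Q t0 = 0\<close>, then \<open>Q\<close> vanishes near \<open>t0\<close> because of its
  small trace, and everywhere by the identity theorem. Eigenvalues of \<open>A\<close> are real, so
  \<open>A\<close> commutes with \<open>outer b b\<close> and hence with the remaining
  projection.\<close>

lemma analytic_orthonormal_eigenbasis:
  fixes A Q :: "real \<Rightarrow> 'n::finite cmat"
  assumes A: "\<And>s. s \<ge> t0 \<Longrightarrow> analytic_mat {t0..} s A" "\<And>t. t \<ge> t0 \<Longrightarrow> hermitian (A t)"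
    and Q: "\<And>s. s \<ge> t0 \<Longrightarrow> analytic_mat {t0..} s Q" "\<And>t. t \<ge> t0 \<Longrightarrow> hproj (Q t)"
      "\<And>t. t \<ge> t0 \<Longrightarrow> A t ** Q t = Q t ** A t" "Re (mtrace (Q t0)) < of_nat N"
  shows "\<exists>n e ev. (\<forall>k<n. \<forall>s\<ge>t0. analytic_vec {t0..} s (e k) \<and> analytic_within {t0..} s (ev k)) \<and>
      (\<forall>t\<ge>t0. orthonormal_fam n (\<lambda>k. e k t) \<and> Q t = (\<Sum>k<n. outer (e k t) (e k t)) \<and>
        (\<forall>k<n. A t *v e k t = ev k t *s e k t))"
  using Q
proof (induction N arbitrary: Q)
  case 0
  then show ?case using mtrace_hproj_nonneg[of "Q t0"] by simp
next
  case (Suc N)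
  let ?J = "{t0..}"
  note Q = Suc.prems
  show ?case
  proof (cases "Q t0 = 0")
    case True
    have "((\<lambda>t. Re (mtrace (Q t))) \<longlongrightarrow> Re (mtrace (Q t0))) (at t0 within ?J)"
      by (intro tendsto_Re analytic_within_tendsto analytic_within_mtrace Q) auto
    then have "eventually (\<lambda>t. Re (mtrace (Q t)) < 1) (at t0 within ?J)"
      by (rule order_tendstoD(2)) (simp add: True)
    moreover have "eventually (\<lambda>t. t \<in> ?J) (at t0 within ?J)" by (simp add: eventually_at_filter)
    ultimately have "eventually (\<lambda>t. Q t = 0) (at t0 within ?J)"
      by eventually_elim (use mtrace_hproj_ge_1 Q(2) in force)
    then have near0: "eventually (\<lambda>t. Q t = 0) (nhds_within t0 ?J)"
      using True by (simp add: eventually_nhds_within_iff)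
    have "Q t = 0" if "t \<ge> t0" for t
      by (rule analytic_mat_identity[OF Q(1) order_refl near0 that])
    then show ?thesis by (intro exI[of _ 0]) (simp add: orthonormal_fam_def)
  next
    case False
    have "\<exists>b r. \<forall>s\<ge>t0. analytic_vec ?J s b \<and> analytic_within ?J s r \<and>
        norm (b s) = 1 \<and> Q s *v b s = b s \<and> A s *v b s = r s *s b s"
      by (rule analytic_eigenvector[OF A Q(1-3) False])
    then obtain b r where b: "\<And>s. s \<ge> t0 \<Longrightarrow> analytic_vec ?J s b" "\<And>s. s \<ge> t0 \<Longrightarrow> analytic_within ?J s r"
        "\<And>s. s \<ge> t0 \<Longrightarrow> norm (b s) = 1" "\<And>s. s \<ge> t0 \<Longrightarrow> Q s *v b s = b s"
        "\<And>s. s \<ge> t0 \<Longrightarrow> A s *v b s = r s *s b s" by blast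
    define Q' where "Q' t = Q t - outer (b t) (b t)" for t
    have "\<exists>n e ev. (\<forall>k<n. \<forall>s\<ge>t0. analytic_vec ?J s (e k) \<and> analytic_within ?J s (ev k)) \<and>
      (\<forall>t\<ge>t0. orthonormal_fam n (\<lambda>k. e k t) \<and> Q' t = (\<Sum>k<n. outer (e k t) (e k t)) \<and>
        (\<forall>k<n. A t *v e k t = ev k t *s e k t))"
    proof (rule Suc.IH)
      show "analytic_mat ?J s Q'" if "s \<ge> t0" for s
        unfolding Q'_def by (intro analytic_mat_simps analytic_mat_outer Q(1) b(1) that)
      show "hproj (Q' t)" if "t \<ge> t0" for t
        unfolding Q'_def by (rule hproj_diff_outer[OF Q(2)[OF that] b(4,3)[OF that]])
      show "A t ** Q' t = Q' t ** A t" if "t \<ge> t0" for t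
        using Q(3)[OF that] b(5)[OF that] hermitianD[OF A(2)[OF that]]
          hermitian_eigenvalue_real[OF A(2)[OF that] b(5)[OF that] b(3)[OF that]]
        by (simp add: Q'_def matrix_mul_diff_ldistrib matrix_mul_diff_rdistrib matrix_mul_outer outer_matrix_mul outer_smult)
      show "Re (mtrace (Q' t0)) < of_nat N"
        using Q(4) mtrace_outer_unit[OF b(3)[OF order_refl]] by (simp add: Q'_def)
    qed
    then obtain n e ev where e: "\<And>k s. k < n \<Longrightarrow> s \<ge> t0 \<Longrightarrow> analytic_vec ?J s (e k) \<and> analytic_within ?J s (ev k)"
      "\<And>t. t \<ge> t0 \<Longrightarrow> orthonormal_fam n (\<lambda>k. e k t)" "\<And>t. t \<ge> t0 \<Longrightarrow> Q' t = (\<Sum>k<n. outer (e k t) (e k t))"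
      "\<And>k t. k < n \<Longrightarrow> t \<ge> t0 \<Longrightarrow> A t *v e k t = ev k t *s e k t" by blast
    show ?thesis
    proof (intro exI[of _ "Suc n"] exI[of _ "e(n := b)"] exI[of _ "ev(n := r)"] conjI allI impI)
      fix t assume t: "t \<ge> t0"
      have upd: "(\<lambda>k. (e(n := b)) k t) = (\<lambda>k. e k t)(n := b t)" by auto
      note ext = orthonormal_fam_extend[OF e(2)[OF t] e(3)[OF t, unfolded Q'_def] b(3,4)[OF t]]
      show "orthonormal_fam (Suc n) (\<lambda>k. (e(n := b)) k t)" unfolding upd by (rule ext(1))
      show "Q t = (\<Sum>k<Suc n. outer ((e(n := b)) k t) ((e(n := b)) k t))"
      proof -
        have "(e(n := b)) k t = ((\<lambda>k. e k t)(n := b t)) k" for k by simp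
        with ext(2) show ?thesis by (simp only:)
      qed
      fix k assume "k < Suc n"
      then show "A t *v (e(n := b)) k t = (ev(n := r)) k t *s (e(n := b)) k t"
        using e(4)[OF _ t] b(5)[OF t] by (auto simp: less_Suc_eq)
    next
      fix k s assume "k < Suc n" "s \<ge> t0"
      then show "analytic_vec ?J s ((e(n := b)) k)" "analytic_within ?J s ((ev(n := r)) k)"
        using e(1) b(1,2) by (auto simp: less_Suc_eq)
    qed
  qed
qed

text \<open>Obtained with \<open>Q\<close> constantly the identity; the trace of the resolution of
  the identity fixes the number of branches, which can therefore be indexed by the type
  itself.\<close>

theorem rellich:
  fixes A :: "real \<Rightarrow> 'n::finite cmat"
  assumes A: "\<And>s. s \<ge> t0 \<Longrightarrow> analytic_mat {t0..} s A" "\<And>t. t \<ge> t0 \<Longrightarrow> hermitian (A t)"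
  obtains e :: "'n \<Rightarrow> real \<Rightarrow> complex^'n" and ev :: "'n \<Rightarrow> real \<Rightarrow> complex" where
    "\<And>k s. s \<ge> t0 \<Longrightarrow> analytic_vec {t0..} s (e k)" "\<And>k s. s \<ge> t0 \<Longrightarrow> analytic_within {t0..} s (ev k)"
    "\<And>k l t. t \<ge> t0 \<Longrightarrow> cdot (e k t) (e l t) = (if k = l then 1 else 0)"
    "\<And>k t. t \<ge> t0 \<Longrightarrow> A t *v e k t = ev k t *s e k t"
proof -
  obtain N where N: "Re (mtrace (mat 1 :: 'n cmat)) < of_nat N" using reals_Archimedean2 by blast
  have "\<exists>n e ev. (\<forall>k<n. \<forall>s\<ge>t0. analytic_vec {t0..} s (e k) \<and> analytic_within {t0..} s (ev k)) \<and>
      (\<forall>t\<ge>t0. orthonormal_fam n (\<lambda>k. e k t) \<and> (mat 1 :: 'n cmat) = (\<Sum>k<n. outer (e k t) (e k t)) \<and>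
        (\<forall>k<n. A t *v e k t = ev k t *s e k t))"
    by (rule analytic_orthonormal_eigenbasis[OF A, where Q = "\<lambda>_. mat 1"])
      (use N in \<open>auto simp: hproj_def\<close>)
  then obtain n e ev where e: "\<And>k s. k < n \<Longrightarrow> s \<ge> t0 \<Longrightarrow> analytic_vec {t0..} s (e k) \<and> analytic_within {t0..} s (ev k)"
      "\<And>t. t \<ge> t0 \<Longrightarrow> orthonormal_fam n (\<lambda>k. e k t)" "\<And>t. t \<ge> t0 \<Longrightarrow> (mat 1 :: 'n cmat) = (\<Sum>k<n. outer (e k t) (e k t))"
      "\<And>k t. k < n \<Longrightarrow> t \<ge> t0 \<Longrightarrow> A t *v e k t = ev k t *s e k t" by blast
  have "n = CARD('n)" using orthonormal_fam_card[OF e(2,3)[OF order_refl]] .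
  then obtain h :: "'n \<Rightarrow> nat" where h: "bij_betw h UNIV {..<n}"
    by (metis card_lessThan finite finite_lessThan finite_same_card_bij)
  have hn: "h k < n" for k using h by (auto simp: bij_betw_def)
  have hi: "h k = h l \<longleftrightarrow> k = l" for k l using h by (auto simp: bij_betw_def inj_on_def)
  show thesis
    by (rule that[of "\<lambda>k. e (h k)" "\<lambda>k. ev (h k)"])
      (use e hn hi in \<open>auto simp: orthonormal_fam_def\<close>)
qed

section \<open>The Laplace-Beltrami operators\<close>

definition vec_of_mat :: "'n::finite cmat \<Rightarrow> complex^('n \<times> 'n)" where
  "vec_of_mat a = (\<chi> p. a $ fst p $ snd p)"

definition mat_of_vec :: "complex^('n \<times> 'n) \<Rightarrow> 'n::finite cmat" where
  "mat_of_vec w = (\<chi> i j. w $ (i, j))"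

lemma vec_of_mat_of_vec [simp]: "vec_of_mat (mat_of_vec w) = w" "mat_of_vec (vec_of_mat a) = a"
  by (simp_all add: vec_of_mat_def mat_of_vec_def vec_eq_iff)

lemma vec_of_mat_smul: "vec_of_mat (smul z a) = z *s vec_of_mat a"
  by (simp add: vec_of_mat_def vec_eq_iff)

lemma cdot_vec_of_mat: "cdot (vec_of_mat a) (vec_of_mat b) = mtrace (madj a ** b)"
proof -
  have "cdot (vec_of_mat a) (vec_of_mat b) = (\<Sum>p\<in>UNIV \<times> UNIV. cnj (a $ fst p $ snd p) * b $ fst p $ snd p)"
    by (simp add: cdot_def vec_of_mat_def)
  also have "\<dots> = (\<Sum>i\<in>UNIV. \<Sum>j\<in>UNIV. cnj (a $ i $ j) * b $ i $ j)"
    by (subst sum.cartesian_product) (simp add: case_prod_beta)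
  also have "\<dots> = mtrace (madj a ** b)"
    by (subst sum.swap) (simp add: mtrace_def matrix_matrix_mult_def)
  finally show ?thesis .
qed

text \<open>The coordinate matrix with respect to the matrix units. These are orthonormal for the
  trace inner product, so symmetry of an operator becomes hermiticity of its matrix.\<close>

definition mat_of_op :: "('n::finite cmat \<Rightarrow> 'n cmat) \<Rightarrow> ('n \<times> 'n) cmat" where
  "mat_of_op T = (\<chi> p q. vec_of_mat (T (mat_of_vec (axis q 1))) $ p)"

lemma mat_of_op_mult:
  assumes "\<And>a b. T (a + b) = T a + T b" "\<And>z a. T (smul z a) = smul z (T a)"
  shows "mat_of_op T *v vec_of_mat a = vec_of_mat (T a)"
proof -
  have zero: "T 0 = 0" using assms(2)[of 0 0] by simp
  have sum: "T (sum f I) = (\<Sum>i\<in>I. T (f i))" for f :: "'b \<Rightarrow> 'a cmat" and I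
    by (induction I rule: infinite_finite_induct) (simp_all add: zero assms(1))
  have a: "a = (\<Sum>q\<in>UNIV. smul (vec_of_mat a $ q) (mat_of_vec (axis q 1)))"
    by (simp add: vec_eq_iff sum_component mat_of_vec_def vec_of_mat_def axis_def if_distrib cong: if_cong)
  have "vec_of_mat (T a) $ p = (\<Sum>q\<in>UNIV. vec_of_mat a $ q * vec_of_mat (T (mat_of_vec (axis q 1))) $ p)" for p
    by (subst a) (simp add: sum assms(2) vec_of_mat_def sum_component)
  then show ?thesis
    by (simp add: vec_eq_iff mat_of_op_def matrix_vector_mult_def mult.commute)
qed

lemma hermitian_mat_of_op:
  fixes T :: "'n::finite cmat \<Rightarrow> 'n cmat"
  assumes "\<And>a b. mtrace (madj a ** T b) = mtrace (madj (T a) ** b)"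
  shows "hermitian (mat_of_op T)"
proof -
  have entry: "cdot (axis p 1) w = w $ p" for p and w :: "complex^('n \<times> 'n)"
  proof -
    have "(\<Sum>i\<in>UNIV. cnj (axis p 1 $ i) * w $ i) = (\<Sum>i\<in>UNIV. if i = p then w $ p else 0)"
      by (intro sum.cong) (auto simp: axis_def)
    then show ?thesis by (simp add: cdot_def)
  qed
  have "cnj (mat_of_op T $ q $ p) = mat_of_op T $ p $ q" for p q
  proof -
    let ?E = "\<lambda>q. mat_of_vec (axis q 1) :: 'n cmat"
    have "mat_of_op T $ p $ q = mtrace (madj (?E p) ** T (?E q))" for p q
      by (simp add: mat_of_op_def entry flip: cdot_vec_of_mat)
    moreover have "cnj (mtrace (madj (?E q) ** T (?E p))) = mtrace (madj (T (?E p)) ** ?E q)"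
      by (simp flip: mtrace_simps(6))
    ultimately show ?thesis using assms by simp
  qed
  then show ?thesis by (simp add: hermitian_def vec_eq_iff)
qed

section \<open>Symmetry of the Laplacian and the conjugated operator\<close>

lemma comm_self_adjoint:
  assumes "hermitian y"
  shows "mtrace (madj a ** comm y b) = mtrace (madj (comm y a) ** b)"
  using mtrace_mult_commute[of "madj a ** b" y] assms
  by (simp add: comm_def hermitian_def matrix_mul_diff_ldistrib matrix_mul_diff_rdistrib matrix_mul_assoc)

text \<open>Cyclicity of the trace makes the commutator with a hermitian matrix symmetric, so each
  of the two nested commutators can be moved across in turn.\<close>

lemma lap_self_adjoint:
  assumes "hermitian x" "hermitian y"
  shows "mtrace (madj a ** lap x y b) = mtrace (madj (lap x y a) ** b)"
  by (simp add: lap_def matrix_add_ldistrib matrix_mul_add_rdistrib comm_self_adjoint assms)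

lemma analytic_mat_lap: "analytic_mat J s a \<Longrightarrow> analytic_mat J s (\<lambda>t. lap x y (a t))"
  unfolding lap_def comm_def by (intro analytic_mat_simps analytic_mat_mult)

lemma matrix_inv_eq: "A ** B = mat 1 \<Longrightarrow> B ** A = mat 1 \<Longrightarrow> matrix_inv A = B"
  unfolding matrix_inv_def by (rule some_equality) (auto, metis matrix_mul_assoc matrix_mul_lid matrix_mul_rid)

lemma matrix_inv_metric:
  assumes "c \<in> metrics"
  shows "matrix_inv c = minv_sqrt c ** minv_sqrt c" "matrix_inv c ** c = mat 1"
proof -
  have "c ** (minv_sqrt c ** minv_sqrt c) = minv_sqrt c ** minv_sqrt c ** c"
    using minv_sqrt_props(3)[OF assms] by (metis matrix_mul_assoc)
  then show "matrix_inv c = minv_sqrt c ** minv_sqrt c"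
    using minv_sqrt_props(2)[OF assms] by (intro matrix_inv_eq) simp_all
  then show "matrix_inv c ** c = mat 1" using minv_sqrt_props(2)[OF assms] by simp
qed

text \<open>Conjugating by right multiplication with \<open>c\<^sup>-\<^sup>1\<^sup>/\<^sup>2\<close>, an isometry from the trace inner product
  onto \<open>H\<^sub>c\<close>, turns the Laplace-Beltrami operator into the hermitian operator
  \<open>b \<mapsto> \<triangle>(b c\<^sup>-\<^sup>1\<^sup>/\<^sup>2) c\<^sup>-\<^sup>1\<^sup>/\<^sup>2\<close>.\<close>

lemma laplace_beltrami_analytic_eigenbasis:
  fixes x y :: "'n::finite cmat" and c :: "real \<Rightarrow> 'n cmat"
  assumes xy: "hermitian x" "hermitian y" and P: "\<And>t. t \<ge> t0 \<Longrightarrow> c t \<in> metrics"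
    and c: "\<And>s. s \<ge> t0 \<Longrightarrow> analytic_mat {t0..} s c"
  obtains ev :: "'n \<times> 'n \<Rightarrow> real \<Rightarrow> complex" and e :: "'n \<times> 'n \<Rightarrow> real \<Rightarrow> 'n cmat" where
    "\<And>k s. s \<ge> t0 \<Longrightarrow> analytic_within {t0..} s (ev k)" "\<And>k s. s \<ge> t0 \<Longrightarrow> analytic_mat {t0..} s (e k)"
    "\<And>k t. t \<ge> t0 \<Longrightarrow> lapc x y (c t) (e k t) = smul (ev k t) (e k t)"
    "\<And>k l t. t \<ge> t0 \<Longrightarrow> ipc (c t) (e k t) (e l t) = (if k = l then 1 else 0)"
proof -
  let ?J = "{t0..}"
  define D where "D t = minv_sqrt (c t)" for t
  have D: "analytic_mat ?J s D" if s: "s \<ge> t0" for s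
    unfolding D_def
    by (intro analytic_mat_minv_sqrt c s eventually_mono[OF eventually_nhds_within_in] P) (use s in auto)
  have Dh: "madj (D t) = D t" and DDc: "D t ** D t ** c t = mat 1" and Dc: "D t ** c t = c t ** D t"
    if "t \<ge> t0" for t
    using minv_sqrt_props[OF P[OF that]] by (simp_all add: D_def hermitian_def)
  \<comment> \<open>As \<open>D t ** D t\<close> is the inverse of \<open>c t\<close>, an
    eigenmatrix \<open>b\<close> of \<open>T t\<close> yields the eigenmatrix
    \<open>b ** D t\<close> of the Laplace-Beltrami operator, with the same eigenvalue.\<close>
  define T where "T t b = lap x y (b ** D t) ** D t" for t b
  have T_add: "T t (a + b) = T t a + T t b" and T_smul: "T t (smul z a) = smul z (T t a)" for t a b z
    by (simp_all add: T_def matrix_mul_add_rdistrib lap_simps)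
  have T_sym: "mtrace (madj a ** T t b) = mtrace (madj (T t a) ** b)" if "t \<ge> t0" for t a b
  proof -
    have "mtrace (madj a ** T t b) = mtrace (D t ** (madj a ** lap x y (b ** D t)))"
      unfolding T_def matrix_mul_assoc by (subst mtrace_mult_commute) (simp add: matrix_mul_assoc)
    also have "\<dots> = mtrace (madj (a ** D t) ** lap x y (b ** D t))"
      by (simp add: Dh[OF that] matrix_mul_assoc)
    also have "\<dots> = mtrace (madj (lap x y (a ** D t)) ** b ** D t)"
      unfolding lap_self_adjoint[OF xy] by (simp add: matrix_mul_assoc)
    also have "\<dots> = mtrace (madj (T t a) ** b)"
      by (subst mtrace_mult_commute) (simp add: T_def Dh[OF that] matrix_mul_assoc)
    finally show ?thesis .
  qed
  define A where "A t = mat_of_op (T t)" for t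
  have A: "analytic_mat ?J s A" if s: "s \<ge> t0" for s
  proof -
    have "analytic_mat ?J s (\<lambda>t. T t (mat_of_vec (axis q 1)))" for q
      unfolding T_def by (intro analytic_mat_mult analytic_mat_lap D[OF s] analytic_mat_simps(1))
    then show ?thesis by (simp add: analytic_mat_def A_def mat_of_op_def vec_of_mat_def)
  qed
  have A_herm: "hermitian (A t)" if "t \<ge> t0" for t
    unfolding A_def by (rule hermitian_mat_of_op) (rule T_sym[OF that])
  have A_mult: "A t *v vec_of_mat b = vec_of_mat (T t b)" for t b
    unfolding A_def by (rule mat_of_op_mult) (simp_all add: T_add T_smul)
  from rellich[of t0 A, OF A A_herm]
  obtain w :: "'n \<times> 'n \<Rightarrow> real \<Rightarrow> complex^('n \<times> 'n)" and ev :: "'n \<times> 'n \<Rightarrow> real \<Rightarrow> complex" where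
    w: "\<And>k s. s \<ge> t0 \<Longrightarrow> analytic_vec ?J s (w k)" and ev: "\<And>k s. s \<ge> t0 \<Longrightarrow> analytic_within ?J s (ev k)"
    and orth: "\<And>k l t. t \<ge> t0 \<Longrightarrow> cdot (w k t) (w l t) = (if k = l then 1 else 0)"
    and eig: "\<And>k t. t \<ge> t0 \<Longrightarrow> A t *v w k t = ev k t *s w k t" by blast
  define b where "b k t = mat_of_vec (w k t)" for k t
  have w_b: "w k t = vec_of_mat (b k t)" for k t by (simp add: b_def)
  have b: "analytic_mat ?J s (b k)" if "s \<ge> t0" for s k
    using w[OF that, of k] by (simp add: analytic_mat_def analytic_vec_def b_def mat_of_vec_def)
  have Tb: "T t (b k t) = smul (ev k t) (b k t)" if "t \<ge> t0" for t k
  proof -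
    have "vec_of_mat (T t (b k t)) = vec_of_mat (smul (ev k t) (b k t))"
      using eig[OF that, of k] by (simp add: w_b A_mult vec_of_mat_smul)
    then show ?thesis by (metis vec_of_mat_of_vec(2))
  qed
  show thesis
  proof (rule that[of ev "\<lambda>k t. b k t ** D t"])
    show "analytic_within ?J s (ev k)" if "s \<ge> t0" for s k by (rule ev[OF that])
    show "analytic_mat ?J s (\<lambda>t. b k t ** D t)" if "s \<ge> t0" for s k
      by (intro analytic_mat_mult b D that)
    fix t assume t: "t \<ge> t0"
    show "lapc x y (c t) (b k t ** D t) = smul (ev k t) (b k t ** D t)" for k
    proof -
      have "lapc x y (c t) (b k t ** D t) = T t (b k t) ** D t"
        unfolding lapc_def matrix_inv_metric(1)[OF P[OF t]] T_def by (simp add: D_def matrix_mul_assoc)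
      then show ?thesis by (simp add: Tb[OF t])
    qed
    show "ipc (c t) (b k t ** D t) (b l t ** D t) = (if k = l then 1 else 0)" for k l
    proof -
      have "ipc (c t) (b k t ** D t) (b l t ** D t) = mtrace (c t ** D t ** madj (b k t) ** b l t ** D t)"
        by (simp add: ipc_def Dh[OF t] matrix_mul_assoc)
      also have "\<dots> = mtrace (D t ** c t ** D t ** madj (b k t) ** b l t)"
        by (subst mtrace_mult_commute) (simp add: matrix_mul_assoc)
      also have "D t ** c t ** D t = mat 1"
        unfolding matrix_mul_assoc[symmetric] Dc[OF t, symmetric]
        using DDc[OF t] by (simp add: matrix_mul_assoc)
      finally show ?thesis using orth[OF t, of k l] by (simp add: w_b cdot_vec_of_mat)
    qed
  qed
qed

section \<open>Derivative of an eigenvalue\<close>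

definition has_mat_deriv :: "(real \<Rightarrow> 'n::finite cmat) \<Rightarrow> 'n cmat \<Rightarrow> real filter \<Rightarrow> bool" where
  "has_mat_deriv f D F \<longleftrightarrow> (\<forall>i j. ((\<lambda>t. f t $ i $ j) has_vector_derivative D $ i $ j) F)"

lemma has_mat_deriv_mult:
  assumes "has_mat_deriv f f' (at t within S)" "has_mat_deriv g g' (at t within S)"
  shows "has_mat_deriv (\<lambda>t. f t ** g t) (f' ** g t + f t ** g') (at t within S)"
proof -
  have "((\<lambda>t. f t $ i $ k * g t $ k $ j) has_vector_derivative
      (f' $ i $ k * g t $ k $ j + f t $ i $ k * g' $ k $ j)) (at t within S)" for i j k
    using has_vector_derivative_mult[of "\<lambda>t. f t $ i $ k" "f' $ i $ k" t S "\<lambda>t. g t $ k $ j" "g' $ k $ j"] assms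
    by (simp add: has_mat_deriv_def add.commute)
  then show ?thesis
    unfolding has_mat_deriv_def matrix_matrix_mult_def
    by (auto simp: sum.distrib[symmetric] intro!: has_vector_derivative_sum)
qed

lemma has_mat_deriv_simps:
  "has_mat_deriv f f' (at t within S) \<Longrightarrow> has_mat_deriv g g' (at t within S) \<Longrightarrow>
    has_mat_deriv (\<lambda>t. f t + g t) (f' + g') (at t within S)"
  "has_mat_deriv f f' (at t within S) \<Longrightarrow> has_mat_deriv g g' (at t within S) \<Longrightarrow>
    has_mat_deriv (\<lambda>t. f t - g t) (f' - g') (at t within S)"
  "has_mat_deriv f f' (at t within S) \<Longrightarrow> has_mat_deriv (\<lambda>t. madj (f t)) (madj f') (at t within S)"
  "has_mat_deriv (\<lambda>_. a) 0 (at t within S)"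
  unfolding has_mat_deriv_def
  by (auto intro!: has_vector_derivative_add has_vector_derivative_diff
      bounded_linear.has_vector_derivative[OF bounded_linear_cnj])

lemma has_mat_deriv_comm:
  assumes "has_mat_deriv f f' (at t within S)"
  shows "has_mat_deriv (\<lambda>t. comm y (f t)) (comm y f') (at t within S)"
  using has_mat_deriv_simps(2)[OF has_mat_deriv_mult[OF has_mat_deriv_simps(4)[of y] assms]
      has_mat_deriv_mult[OF assms has_mat_deriv_simps(4)[of y]]]
  by (simp add: comm_def)

lemma has_mat_deriv_lap:
  "has_mat_deriv f f' (at t within S) \<Longrightarrow> has_mat_deriv (\<lambda>t. lap x y (f t)) (lap x y f') (at t within S)"
  unfolding lap_def by (intro has_mat_deriv_simps(1) has_mat_deriv_comm)

lemma has_mat_deriv_mtrace: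
  "has_mat_deriv f f' F \<Longrightarrow> ((\<lambda>t. mtrace (f t)) has_vector_derivative mtrace f') F"
  unfolding has_mat_deriv_def mtrace_def by (intro has_vector_derivative_sum) auto

lemma has_mat_deriv_if_has_vector_derivative:
  "(f has_vector_derivative f') F \<Longrightarrow> has_mat_deriv f f' F"
  unfolding has_mat_deriv_def
  by (intro allI bounded_linear.has_vector_derivative[OF bounded_linear_vec_nth])

text \<open>A Hellmann-Feynman computation. Symmetry of \<open>lap\<close> and reality of
  \<open>lam t\<close> make both terms containing \<open>a'\<close> carry the factor
  \<open>lam t\<close>; together they are \<open>lam t\<close> times the \<open>a'\<close> part of
  the differentiated normalisation, which equals minus the trace containing \<open>c'\<close>.
  Differentiability of \<open>lam\<close> itself comes from its expression through
  \<open>a\<close>.\<close>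

lemma laplace_beltrami_eigenvalue_derivative:
  fixes x y :: "'n::finite cmat"
  assumes xy: "hermitian x" "hermitian y" and J: "t \<in> J" "t islimpt J"
    and P: "\<And>t. t \<in> J \<Longrightarrow> c t \<in> metrics"
    and eig: "\<And>t. t \<in> J \<Longrightarrow> lapc x y (c t) (a t) = smul (lam t) (a t)"
    and norm: "\<And>t. t \<in> J \<Longrightarrow> ipc (c t) (a t) (a t) = 1"
    and c: "has_mat_deriv c c' (at t within J)" and a: "has_mat_deriv a a' (at t within J)"
  shows "(lam has_vector_derivative - (lam t * mtrace (madj (a t) ** a t ** c'))) (at t within J)"
proof -
  \<comment> \<open>Multiplying by \<open>c t\<close> clears the inverse, so that no derivative of
    \<open>matrix_inv\<close> is needed.\<close>
  have lap_a: "lap x y (a t) = smul (lam t) (a t ** c t)" if "t \<in> J" for t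
  proof -
    have "lap x y (a t) = lapc x y (c t) (a t) ** c t"
      unfolding lapc_def by (simp add: matrix_inv_metric(2)[OF P[OF that]] flip: matrix_mul_assoc)
    then show ?thesis using eig[OF that] by simp
  qed
  have norm': "mtrace (madj (a t) ** a t ** c t) = 1" if "t \<in> J" for t
    using norm[OF that] mtrace_mult_commute[of "madj (a t) ** a t" "c t"]
    by (simp add: ipc_def matrix_mul_assoc)
  have lam_eq: "lam t = mtrace (madj (a t) ** lap x y (a t))" if "t \<in> J" for t
    using norm'[OF that] by (simp add: lap_a[OF that] matrix_mul_assoc)
  have lam_real: "cnj (lam t) = lam t"
    using lap_self_adjoint[OF xy, of "a t" "a t"] lam_eq[OF J(1)]
    by (simp flip: mtrace_simps(6))
  have herm_c: "madj (c t) = c t" using P[OF J(1)] by (simp add: metrics_def hermitian_def)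
  have "((\<lambda>t. mtrace (madj (a t) ** lap x y (a t))) has_vector_derivative
      mtrace (madj a' ** lap x y (a t) + madj (a t) ** lap x y a')) (at t within J)"
    by (intro has_mat_deriv_mtrace has_mat_deriv_mult has_mat_deriv_lap has_mat_deriv_simps(3) a)
  then have deriv: "(lam has_vector_derivative
      mtrace (madj a' ** lap x y (a t) + madj (a t) ** lap x y a')) (at t within J)"
    by (rule has_vector_derivative_transform[OF J(1) _, rotated]) (use lam_eq in simp)
  have "((\<lambda>t. mtrace (madj (a t) ** a t ** c t)) has_vector_derivative
      mtrace ((madj a' ** a t + madj (a t) ** a') ** c t + madj (a t) ** a t ** c')) (at t within J)"
    by (intro has_mat_deriv_mtrace has_mat_deriv_mult has_mat_deriv_simps(3) a c)
  then have "((\<lambda>_. 1) has_vector_derivative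
      mtrace ((madj a' ** a t + madj (a t) ** a') ** c t + madj (a t) ** a t ** c')) (at t within J)"
    by (rule has_vector_derivative_transform[OF J(1) _, rotated]) (use norm' in simp)
  moreover have "((\<lambda>_. 1 :: complex) has_vector_derivative 0) (at t within J)"
    by (rule has_vector_derivative_const)
  moreover have "at t within J \<noteq> bot" using J(2) by (simp add: trivial_limit_within)
  ultimately have "mtrace ((madj a' ** a t + madj (a t) ** a') ** c t + madj (a t) ** a t ** c') = 0"
    by (rule vector_derivative_unique_within[rotated])
  then have zero: "mtrace (madj a' ** a t ** c t) + mtrace (madj (a t) ** a' ** c t)
      = - mtrace (madj (a t) ** a t ** c')"
    by (simp add: matrix_mul_add_rdistrib add_eq_0_iff)
  have "mtrace (madj (a t) ** lap x y a') = lam t * mtrace (c t ** madj (a t) ** a')"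
    unfolding lap_self_adjoint[OF xy] lap_a[OF J(1)] by (simp add: lam_real herm_c)
  also have "mtrace (c t ** madj (a t) ** a') = mtrace (madj (a t) ** a' ** c t)"
    using mtrace_mult_commute[of "c t" "madj (a t) ** a'"] by (simp add: matrix_mul_assoc)
  finally have "mtrace (madj a' ** lap x y (a t) + madj (a t) ** lap x y a') =
      lam t * (mtrace (madj a' ** a t ** c t) + mtrace (madj (a t) ** a' ** c t))"
    by (simp add: lap_a[OF J(1)] matrix_mul_assoc ring_distribs)
  then show ?thesis using deriv by (simp add: zero)
qed

lemma has_mat_deriv_if_real_analytic:
  fixes a :: "real \<Rightarrow> 'n::finite cmat"
  assumes "real_analytic_on {t0..} a" "t \<ge> t0"
  obtains a' where "has_mat_deriv a a' (at t within {t0..})"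
proof -
  define d where "d i j = (SOME d. ((\<lambda>t. a t $ i $ j) has_vector_derivative d) (at t within {t0..}))" for i j
  have "((\<lambda>t. a t $ i $ j) has_vector_derivative d i j) (at t within {t0..})" for i j
  proof -
    have "\<exists>d. ((\<lambda>t. a t $ i $ j) has_vector_derivative d) (at t within {t0..})"
      using assms by (intro analytic_within_deriv analytic_within_if_real_analytic_on real_analytic_on_vec_nth) auto
    then show ?thesis unfolding d_def by (rule someI_ex)
  qed
  then have "has_mat_deriv a (\<chi> i j. d i j) (at t within {t0..})"
    by (simp add: has_mat_deriv_def)
  then show thesis by (rule that)
qed

theorem theorem5p1:
  fixes m :: nat and u v x y :: "'n::finite cmat" and c :: "real \<Rightarrow> 'n cmat" and t0 :: real
  assumes n2: "CARD('n) \<ge> 2"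
    and m_range: "1 \<le> m" "m \<le> CARD('n) - 1"
    and m_coprime: "coprime m CARD('n)"
    and uv_unitary: "unitary u" "unitary v"
    and uv_gen: "gen_alg {u, v} = UNIV"
    and uv_rel: "v ** u = smul (exp (2 * pi * \<i> * of_nat m / of_nat CARD('n))) (u ** v)"
    and xy_herm: "hermitian x" "hermitian y"
    and u_exp: "u = hfun (\<lambda>s. exp (2 * pi * \<i> * complex_of_real s / of_nat CARD('n))) x"
    and v_exp: "v = hfun (\<lambda>s. exp (2 * pi * \<i> * complex_of_real s / of_nat CARD('n))) y"
    and c_P: "\<forall>t\<ge>t0. c t \<in> metrics"
    and c_flow: "\<forall>t\<ge>t0. (c has_vector_derivative (- lap x y (mlog (c t)))) (at t within {t0..})"
    and c_C1: "continuous_on {t0..} (\<lambda>t. lap x y (mlog (c t)))"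
  shows "(\<exists>lam :: 'n \<times> 'n \<Rightarrow> real \<Rightarrow> complex. \<exists>e :: 'n \<times> 'n \<Rightarrow> real \<Rightarrow> 'n cmat.
            (\<forall>k. real_analytic_on {t0..} (lam k) \<and> real_analytic_on {t0..} (e k)) \<and>
            (\<forall>t\<ge>t0. \<forall>k. lapc x y (c t) (e k t) = smul (lam k t) (e k t)) \<and>
            (\<forall>t\<ge>t0. \<forall>k l. ipc (c t) (e k t) (e l t) = (if k = l then 1 else 0)))
       \<and> (\<forall>(lam :: real \<Rightarrow> complex) (a :: real \<Rightarrow> 'n cmat).
            real_analytic_on {t0..} lam \<and> real_analytic_on {t0..} a \<and>
            (\<forall>t\<ge>t0. lapc x y (c t) (a t) = smul (lam t) (a t) \<and> ipc (c t) (a t) (a t) = 1)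
            \<longrightarrow> (\<forall>t\<ge>t0. (lam has_vector_derivative
                   (lam t * mtrace ((madj (a t) ** a t) ** lap x y (mlog (c t))))) (at t within {t0..})))"
proof (intro conjI allI impI)
  have c: "analytic_mat {t0..} s c" if "s \<ge> t0" for s
    by (rule analytic_mat_ricci_flow[where x = x and y = y]) (use that c_P c_flow in auto)
  obtain ev :: "'n \<times> 'n \<Rightarrow> real \<Rightarrow> complex" and e :: "'n \<times> 'n \<Rightarrow> real \<Rightarrow> 'n cmat" where
    ev: "\<And>k s. s \<ge> t0 \<Longrightarrow> analytic_within {t0..} s (ev k)" and e: "\<And>k s. s \<ge> t0 \<Longrightarrow> analytic_mat {t0..} s (e k)"
    and eig: "\<And>k t. t \<ge> t0 \<Longrightarrow> lapc x y (c t) (e k t) = smul (ev k t) (e k t)"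
    and orth: "\<And>k l t. t \<ge> t0 \<Longrightarrow> ipc (c t) (e k t) (e l t) = (if k = l then 1 else 0)"
    using laplace_beltrami_analytic_eigenbasis[OF xy_herm, of t0 c] c c_P by blast
  have "real_analytic_on {t0..} (ev k)" for k
    by (intro real_analytic_on_if_analytic_within ev) simp
  moreover have "real_analytic_on {t0..} (e k)" for k
    by (intro real_analytic_on_vec real_analytic_on_if_analytic_within analytic_matD e) simp
  ultimately show "\<exists>lam e. (\<forall>k. real_analytic_on {t0..} (lam k) \<and> real_analytic_on {t0..} (e k)) \<and>
      (\<forall>t\<ge>t0. \<forall>k. lapc x y (c t) (e k t) = smul (lam k t) (e k t)) \<and>
      (\<forall>t\<ge>t0. \<forall>k l :: 'n \<times> 'n. ipc (c t) (e k t) (e l t) = (if k = l then 1 else 0))"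
    using eig orth by (intro exI[of _ ev] exI[of _ e]) blast
next
  fix lam :: "real \<Rightarrow> complex" and a :: "real \<Rightarrow> 'n cmat" and t
  assume la: "real_analytic_on {t0..} lam \<and> real_analytic_on {t0..} a \<and>
      (\<forall>t\<ge>t0. lapc x y (c t) (a t) = smul (lam t) (a t) \<and> ipc (c t) (a t) (a t) = 1)" and t: "t0 \<le> t"
  obtain a' where a': "has_mat_deriv a a' (at t within {t0..})"
    using has_mat_deriv_if_real_analytic la t by blast
  have c': "has_mat_deriv c (- lap x y (mlog (c t))) (at t within {t0..})"
    using c_flow t by (intro has_mat_deriv_if_has_vector_derivative) simp
  \<comment> \<open>Here \<open>c'\<close> is minus the Laplacian of the logarithm, so the two minus
    signs cancel.\<close>
  have "(lam has_vector_derivative - (lam t * mtrace (madj (a t) ** a t ** (- lap x y (mlog (c t)))))) (at t within {t0..})"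
    by (rule laplace_beltrami_eigenvalue_derivative[OF xy_herm _ islimpt_atLeast[OF t] _ _ _ c' a'])
      (use la t c_P in auto)
  then show "(lam has_vector_derivative (lam t * mtrace ((madj (a t) ** a t) ** lap x y (mlog (c t))))) (at t within {t0..})"
    by (simp add: matrix_mul_minus)
qed

end
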